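(* Let $X:\Sigma\to M$ be an immersed submanifold (spacelike if $M=\mathbb{R}^{n,k}$) with Gauss map $\rho$ and induced metric $g$, and let $\alpha=-\epsilon$. Then $X$ is a soliton of the mean curvature flow $\partial_tX=H$, i.e. satisfies either $$H+\lambda X^\perp=0\ \text{ with } \lambda=1 \text{ (shrinking) or } \lambda=-1 \text{ (expanding)},\qquad\text{or}\qquad H=V^\perp\ \text{ for a constant vector field } V \text{ (translating)},$$ if and only if the pair $(\rho,g)$ is a gradient soliton of the corresponding harmonic-Ricci flow $\partial_t\rho=\tau_g(\rho)$, $\partial_tg=-2\,\mathrm{Ric}_g+2\alpha\,d\rho\otimes d\rho$ with coupling constant $\alpha=-\epsilon$, i.e. satisfies $$\mathrm{Ric}_g-\alpha\, d\rho\otimes d\rho+\nabla^2f=\lambda g,\qquad \Delta\rho=\langle\nabla f,\nabla\rho\rangle$$ for a potential function $f$ on $\Sigma$ and a constant $\lambda\in\{-1,0,1\}$ (shrinking, steady, expanding for $\lambda=1,0,-1$ respectively). The corresponding potential functions $f$ and constants $\lambda$ in the gradient soliton equations are: (a) shrinkers, $H+X^\perp=0$: $f=\tfrac12|X|^2$ and $\lambda=1$; (b) expanders, $H-X^\perp=0$: $f=-\tfrac12|X|^2$ and $\lambda=-1$; (c) translators, $H=V^\perp$: $f=-\langle X,V\rangle$ and $\lambda=0$.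
   Context: $\Sigma$ is a compact or complete non-compact $n$-dimensional manifold. $M$ is one of two flat spaces with inner product $\langle\cdot,\cdot\rangle$: Euclidean space $\mathbb{R}^{n+k}$, with sign $\epsilon=1$; or pseudo-Euclidean space $\mathbb{R}^{n,k}$ (positive definite in $n$ directions, negative definite in $k$ directions), with sign $\epsilon=-1$. Here $|X|^2=\langle X,X\rangle$. An immersion into $\mathbb{R}^{n,k}$ is spacelike if its induced metric is positive definite. "Mean curvature flow" refers to both cases (the spacelike mean curvature flow when $M=\mathbb{R}^{n,k}$). The second fundamental form is $A(u,v)=(D_u\,dX(v))^\perp$, where $D$ is the flat derivative of $M$ and $\perp$ denotes orthogonal projection onto the normal space of $X$; $H=\operatorname{tr}_gA$ is the mean curvature vector. $G$ is the Grassmannian of oriented $n$-dimensional (spacelike, if $M=\mathbb{R}^{n,k}$) linear subspaces of $M$. With the identification $T_PG=\mathrm{Hom}(P,P^\perp)$, it carries the canonical positive definite metric $g_G(\varphi,\psi)=\epsilon\sum_{i=1}^n\langle\varphi(e_i),\psi(e_i)\rangle$, where $\{e_i\}$ is an orthonormal basis of $P$. The Gauss map of $X$ is $\rho:\Sigma\to G$, $\rho(x)=dX(T_x\Sigma)$ (with the orientation induced from $\Sigma$). $d\rho\otimes d\rho$ denotes the symmetric 2-tensor $\rho^*g_G$ on $\Sigma$; $\Delta\rho=\tau_g(\rho)=\operatorname{tr}_g\nabla d\rho$ is the tension field of $\rho:(\Sigma,g)\to(G,g_G)$; $\langle\nabla f,\nabla\rho\rangle=d\rho(\nabla f)$; $\mathrm{Ric}_g$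 is the Ricci tensor of $g$, and $\nabla^2f$ is the Hessian of $f$ with respect to $g$.
   Formalization: In the converse, Σ is assumed connected and X is a soliton only after translation by a fixed vector (for shrinkers and expanders), with f determined up to a constant; the literal converse fails, e.g. for a sphere of radius √n not centred at the origin. Parts (a)–(c) are literal. *)

theory Defs
  imports "HOL-Analysis.Analysis"
begin

section \<open>Calculus in coordinates\<close>

definition dir_deriv ::
  "('e::real_normed_vector \<Rightarrow> 'f::real_normed_vector) \<Rightarrow> 'e \<Rightarrow> 'e \<Rightarrow> 'f" where
  "dir_deriv F y u = vector_derivative (\<lambda>t::real. F (y + t *\<^sub>R u)) (at 0)"

primrec Ck_on ::
  "nat \<Rightarrow> 'e::real_normed_vector set \<Rightarrow> ('e \<Rightarrow> 'f::real_normed_vector) \<Rightarrow> bool" where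
  "Ck_on 0 S F \<longleftrightarrow> continuous_on S F"
| "Ck_on (Suc k) S F \<longleftrightarrow>
     (\<forall>y\<in>S. F differentiable (at y)) \<and> (\<forall>u. Ck_on k S (\<lambda>y. dir_deriv F y u))"

definition smooth_on ::
  "'e::real_normed_vector set \<Rightarrow> ('e \<Rightarrow> 'f::real_normed_vector) \<Rightarrow> bool" where
  "smooth_on S F \<longleftrightarrow> (\<forall>k. Ck_on k S F)"


section \<open>Riemannian geometry in coordinates\<close>

text \<open>
  A metric in coordinates is a function \<open>h\<close> with \<open>h y u v\<close> the value at the point \<open>y\<close> on the
  tangent vectors \<open>u\<close>, \<open>v\<close>. The coordinates range over an open part of a finite-dimensional
  linear subspace \<open>S\<close> of the ambient type (\<open>S = UNIV\<close> for charts of \<open>\<Sigma>\<close>).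
  Vectors \<open>u\<close>, \<open>v\<close> below always stand for vector fields with constant coefficients.
\<close>

text \<open>The Christoffel map \<open>\<Gamma> y u v = \<nabla>\<^sub>u v\<close> of the Levi-Civita connection (Koszul formula).\<close>

definition christoffel ::
  "'e::real_normed_vector set \<Rightarrow> ('e \<Rightarrow> 'e \<Rightarrow> 'e \<Rightarrow> real) \<Rightarrow> 'e \<Rightarrow> 'e \<Rightarrow> 'e \<Rightarrow> 'e" where
  "christoffel S h y u v = (THE w. w \<in> S \<and> (\<forall>z\<in>S.
     2 * h y w z = dir_deriv (\<lambda>p. h p v z) y u + dir_deriv (\<lambda>p. h p u z) y v
                   - dir_deriv (\<lambda>p. h p u v) y z))"

definition metric_trace ::
  "(real^'n \<Rightarrow> real^'n \<Rightarrow> real^'n \<Rightarrow> real) \<Rightarrow> real^'n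
     \<Rightarrow> (real^'n \<Rightarrow> real^'n \<Rightarrow> 'f::real_normed_vector) \<Rightarrow> 'f" where
  "metric_trace h y b = (\<Sum>i\<in>UNIV. \<Sum>j\<in>UNIV.
     (matrix_inv (\<chi> i j. h y (axis i 1) (axis j 1)) $ i $ j) *\<^sub>R b (axis i 1) (axis j 1))"

definition curvature ::
  "(real^'n \<Rightarrow> real^'n \<Rightarrow> real^'n \<Rightarrow> real) \<Rightarrow> real^'n
     \<Rightarrow> real^'n \<Rightarrow> real^'n \<Rightarrow> real^'n \<Rightarrow> real^'n" where
  "curvature h y u v w =
     dir_deriv (\<lambda>p. christoffel UNIV h p v w) y u
     - dir_deriv (\<lambda>p. christoffel UNIV h p u w) y v
     + christoffel UNIV h y u (christoffel UNIV h y v w)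
     - christoffel UNIV h y v (christoffel UNIV h y u w)"

definition ricci ::
  "(real^'n \<Rightarrow> real^'n \<Rightarrow> real^'n \<Rightarrow> real) \<Rightarrow> real^'n \<Rightarrow> real^'n \<Rightarrow> real^'n \<Rightarrow> real" where
  "ricci h y v w = (\<Sum>i\<in>UNIV. curvature h y (axis i 1) v w $ i)"

definition hessian ::
  "(real^'n \<Rightarrow> real^'n \<Rightarrow> real^'n \<Rightarrow> real) \<Rightarrow> (real^'n \<Rightarrow> real)
     \<Rightarrow> real^'n \<Rightarrow> real^'n \<Rightarrow> real^'n \<Rightarrow> real" where
  "hessian h f y u v =
     dir_deriv (\<lambda>p. dir_deriv f p v) y u - dir_deriv f y (christoffel UNIV h y u v)"

definition gradient ::
  "(real^'n \<Rightarrow> real^'n \<Rightarrow> real^'n \<Rightarrow> real) \<Rightarrow> (real^'n \<Rightarrow> real) \<Rightarrow> real^'n \<Rightarrow> real^'n" where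
  "gradient h f y = (THE w. \<forall>z. h y w z = dir_deriv f y z)"

text \<open>
  \<open>\<nabla>dF\<close> and the tension field of a map \<open>F\<close> from coordinates with metric \<open>h\<close> to coordinates in
  \<open>S\<close> with metric \<open>h'\<close>.
\<close>

definition map_hessian ::
  "(real^'n \<Rightarrow> real^'n \<Rightarrow> real^'n \<Rightarrow> real)
     \<Rightarrow> 'e::real_normed_vector set \<Rightarrow> ('e \<Rightarrow> 'e \<Rightarrow> 'e \<Rightarrow> real)
     \<Rightarrow> (real^'n \<Rightarrow> 'e) \<Rightarrow> real^'n \<Rightarrow> real^'n \<Rightarrow> real^'n \<Rightarrow> 'e" where
  "map_hessian h S h' F y u v =
     dir_deriv (\<lambda>p. dir_deriv F p v) y u - dir_deriv F y (christoffel UNIV h y u v)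
     + christoffel S h' (F y) (dir_deriv F y u) (dir_deriv F y v)"

definition tension ::
  "(real^'n \<Rightarrow> real^'n \<Rightarrow> real^'n \<Rightarrow> real)
     \<Rightarrow> 'e::real_normed_vector set \<Rightarrow> ('e \<Rightarrow> 'e \<Rightarrow> 'e \<Rightarrow> real)
     \<Rightarrow> (real^'n \<Rightarrow> 'e) \<Rightarrow> real^'n \<Rightarrow> 'e" where
  "tension h S h' F y = metric_trace h y (map_hessian h S h' F y)"


section \<open>The flat ambient space\<close>

text \<open>
  The ambient space is Euclidean for \<open>\<epsilon> = 1\<close> and the pseudo-Euclidean space of signature
  \<open>(n,k)\<close> for \<open>\<epsilon> = -1\<close>.
\<close>

type_synonym ('n, 'k) ambient = "(real^'n) \<times> (real^'k)"

definition ip :: "real \<Rightarrow> ('n::finite, 'k::finite) ambient \<Rightarrow> ('n, 'k) ambient \<Rightarrow> real" where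
  "ip \<epsilon> v w = fst v \<bullet> fst w + \<epsilon> * (snd v \<bullet> snd w)"

definition perp :: "real \<Rightarrow> ('n::finite, 'k::finite) ambient set \<Rightarrow> ('n, 'k) ambient set" where
  "perp \<epsilon> T = {v. \<forall>w\<in>T. ip \<epsilon> v w = 0}"

definition normal_part ::
  "real \<Rightarrow> ('n::finite, 'k::finite) ambient set \<Rightarrow> ('n, 'k) ambient \<Rightarrow> ('n, 'k) ambient" where
  "normal_part \<epsilon> T v = (THE w. w \<in> perp \<epsilon> T \<and> v - w \<in> T)"


section \<open>The Grassmannian of oriented spacelike subspaces\<close>

text \<open>
  An oriented \<open>n\<close>-dimensional subspace is represented by the set of its positively oriented
  bases, which are families indexed by \<open>'n\<close>.
\<close>

type_synonym ('n, 'k) frame = "'n \<Rightarrow> ('n, 'k) ambient"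

text \<open>This implies linear independence; for \<open>\<epsilon> = 1\<close> it is equivalent to it.\<close>

definition spacelike_frame :: "real \<Rightarrow> ('n::finite, 'k::finite) frame \<Rightarrow> bool" where
  "spacelike_frame \<epsilon> b \<longleftrightarrow> (\<forall>c::real^'n. c \<noteq> 0 \<longrightarrow>
     ip \<epsilon> (\<Sum>i\<in>UNIV. (c $ i) *\<^sub>R b i) (\<Sum>i\<in>UNIV. (c $ i) *\<^sub>R b i) > 0)"

definition oriented_span ::
  "('n::finite, 'k::finite) frame \<Rightarrow> ('n, 'k) frame set" where
  "oriented_span b =
     {(\<lambda>i. \<Sum>j\<in>UNIV. (a $ i $ j) *\<^sub>R b j) | a :: real^'n^'n. det a > 0}"

definition grassmannian :: "real \<Rightarrow> ('n::finite, 'k::finite) frame set set" where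
  "grassmannian \<epsilon> = {oriented_span b | b. spacelike_frame \<epsilon> b}"

definition plane :: "('n::finite, 'k::finite) frame set \<Rightarrow> ('n, 'k) ambient set" where
  "plane P = span (\<Union>e\<in>P. range e)"

text \<open>\<open>Hom(P, P\<^sup>\<bottom>)\<close>, its elements being extended by zero on \<open>P\<^sup>\<bottom>\<close>.\<close>

definition hom_perp ::
  "real \<Rightarrow> ('n::finite, 'k::finite) frame set
     \<Rightarrow> (('n, 'k) ambient \<Rightarrow>\<^sub>L ('n, 'k) ambient) set" where
  "hom_perp \<epsilon> P = {L. (\<forall>v. blinfun_apply L v \<in> perp \<epsilon> (plane P)) \<and>
                      (\<forall>v\<in>perp \<epsilon> (plane P). blinfun_apply L v = 0)}"

text \<open>
  The chart of the Grassmannian centred at \<open>P\<close>: \<open>L \<in> Hom(P, P\<^sup>\<bottom>)\<close> parametrises the graph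
  \<open>{v + L v | v \<in> P}\<close>, and \<open>graph_coord\<close> is the inverse of this parametrisation. Its
  differential at \<open>P\<close> is the identification \<open>T\<^sub>P G = Hom(P, P\<^sup>\<bottom>)\<close>.
\<close>

definition graph ::
  "('n::finite, 'k::finite) frame set \<Rightarrow> (('n, 'k) ambient \<Rightarrow>\<^sub>L ('n, 'k) ambient)
     \<Rightarrow> ('n, 'k) frame set" where
  "graph P L = (\<lambda>e i. e i + blinfun_apply L (e i)) ` P"

definition graph_coord ::
  "real \<Rightarrow> ('n::finite, 'k::finite) frame set \<Rightarrow> ('n, 'k) frame set
     \<Rightarrow> (('n, 'k) ambient \<Rightarrow>\<^sub>L ('n, 'k) ambient)" where
  "graph_coord \<epsilon> P = inv_into {L \<in> hom_perp \<epsilon> P. graph P L \<in> grassmannian \<epsilon>} (graph P)"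

definition grass_metric ::
  "real \<Rightarrow> ('n::finite, 'k::finite) frame set \<Rightarrow> (('n, 'k) ambient \<Rightarrow>\<^sub>L ('n, 'k) ambient)
     \<Rightarrow> (('n, 'k) ambient \<Rightarrow>\<^sub>L ('n, 'k) ambient) \<Rightarrow> real" where
  "grass_metric \<epsilon> P \<phi> \<psi> =
     (let e = (SOME e. e \<in> P \<and> (\<forall>i j. ip \<epsilon> (e i) (e j) = (if i = j then 1 else 0)))
      in \<epsilon> * (\<Sum>i\<in>UNIV. ip \<epsilon> (blinfun_apply \<phi> (e i)) (blinfun_apply \<psi> (e i))))"

text \<open>
  The metric of the Grassmannian in the chart centred at \<open>P\<close>: the velocity at \<open>t = 0\<close> of
  \<open>t \<mapsto> graph P (L + t B)\<close> is identified with an element of \<open>Hom(Q, Q\<^sup>\<bottom>)\<close>, \<open>Q = graph P L\<close>,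
  by means of the chart centred at \<open>Q\<close>.
\<close>

definition grass_chart_metric ::
  "real \<Rightarrow> ('n::finite, 'k::finite) frame set \<Rightarrow> (('n, 'k) ambient \<Rightarrow>\<^sub>L ('n, 'k) ambient)
     \<Rightarrow> (('n, 'k) ambient \<Rightarrow>\<^sub>L ('n, 'k) ambient)
     \<Rightarrow> (('n, 'k) ambient \<Rightarrow>\<^sub>L ('n, 'k) ambient) \<Rightarrow> real" where
  "grass_chart_metric \<epsilon> P L B B' =
     grass_metric \<epsilon> (graph P L)
       (dir_deriv (\<lambda>K. graph_coord \<epsilon> (graph P L) (graph P K)) L B)
       (dir_deriv (\<lambda>K. graph_coord \<epsilon> (graph P L) (graph P K)) L B')"


section \<open>Oriented manifolds and immersions\<close>

text \<open>
  The manifold \<open>\<Sigma>\<close> is a Hausdorff, second countable type \<open>'a\<close> with an oriented smooth atlas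
  (not necessarily a maximal one). A chart is its domain together with the coordinate map.
\<close>

type_synonym ('a, 'n) chart = "'a set \<times> ('a \<Rightarrow> real^'n)"

definition chart_inv :: "('a, 'n) chart \<Rightarrow> real^'n \<Rightarrow> 'a" where
  "chart_inv C = inv_into (fst C) (snd C)"

definition oriented_atlas ::
  "('a::{t2_space,second_countable_topology}, 'n::finite) chart set \<Rightarrow> bool" where
  "oriented_atlas \<A> \<longleftrightarrow>
     (\<Union>C\<in>\<A>. fst C) = UNIV \<and>
     (\<forall>C\<in>\<A>. open (fst C) \<and> open (snd C ` fst C) \<and>
             homeomorphism (fst C) (snd C ` fst C) (snd C) (chart_inv C)) \<and>
     (\<forall>C\<in>\<A>. \<forall>D\<in>\<A>. smooth_on (snd C ` (fst C \<inter> fst D)) (snd D \<circ> chart_inv C) \<and>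
        (\<forall>y\<in>snd C ` (fst C \<inter> fst D).
           det (matrix (dir_deriv (snd D \<circ> chart_inv C) y)) > 0))"

definition smooth_map ::
  "('a::{t2_space,second_countable_topology}, 'n::finite) chart set
     \<Rightarrow> ('a \<Rightarrow> 'f::real_normed_vector) \<Rightarrow> bool" where
  "smooth_map \<A> F \<longleftrightarrow> (\<forall>C\<in>\<A>. smooth_on (snd C ` fst C) (F \<circ> chart_inv C))"

definition induced_metric ::
  "real \<Rightarrow> ('a \<Rightarrow> ('n::finite, 'k::finite) ambient) \<Rightarrow> ('a, 'n) chart
     \<Rightarrow> real^'n \<Rightarrow> real^'n \<Rightarrow> real^'n \<Rightarrow> real" where
  "induced_metric \<epsilon> X C y u v =
     ip \<epsilon> (dir_deriv (X \<circ> chart_inv C) y u) (dir_deriv (X \<circ> chart_inv C) y v)"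

text \<open>
  For \<open>\<epsilon> = 1\<close> positive definiteness of the induced metric just says that \<open>X\<close> is an immersion.
\<close>

definition spacelike_immersion ::
  "real \<Rightarrow> ('a::{t2_space,second_countable_topology}, 'n::finite) chart set
     \<Rightarrow> ('a \<Rightarrow> ('n, 'k::finite) ambient) \<Rightarrow> bool" where
  "spacelike_immersion \<epsilon> \<A> X \<longleftrightarrow> smooth_map \<A> X \<and>
     (\<forall>C\<in>\<A>. \<forall>y\<in>snd C ` fst C. \<forall>u. u \<noteq> 0 \<longrightarrow> induced_metric \<epsilon> X C y u u > 0)"

text \<open>
  Completeness of the induced metric \<open>g\<close>, in terms of the Riemannian distance. Note that
  \<open>g(c', c') = \<langle>(X \<circ> c)', (X \<circ> c)'\<rangle>\<close> for a curve \<open>c\<close>.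
\<close>

definition pw_C1_curve ::
  "('a::{t2_space,second_countable_topology}, 'n::finite) chart set \<Rightarrow> (real \<Rightarrow> 'a) \<Rightarrow> bool" where
  "pw_C1_curve \<A> c \<longleftrightarrow> continuous_on {0..1} c \<and>
     (\<forall>C\<in>\<A>. \<forall>a b. 0 \<le> a \<and> a \<le> b \<and> b \<le> 1 \<and> c ` {a..b} \<subseteq> fst C
        \<longrightarrow> (snd C \<circ> c) piecewise_C1_differentiable_on {a..b})"

definition riem_dist ::
  "real \<Rightarrow> ('a::{t2_space,second_countable_topology}, 'n::finite) chart set
     \<Rightarrow> ('a \<Rightarrow> ('n, 'k::finite) ambient) \<Rightarrow> 'a \<Rightarrow> 'a \<Rightarrow> ereal" where
  "riem_dist \<epsilon> \<A> X p q = Inf {ereal l | l. \<exists>c. pw_C1_curve \<A> c \<and> c 0 = p \<and> c 1 = q \<and>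
     ((\<lambda>t. sqrt (ip \<epsilon> (vector_derivative (X \<circ> c) (at t)) (vector_derivative (X \<circ> c) (at t))))
        has_integral l) {0..1}}"

definition complete_induced_metric ::
  "real \<Rightarrow> ('a::{t2_space,second_countable_topology}, 'n::finite) chart set
     \<Rightarrow> ('a \<Rightarrow> ('n, 'k::finite) ambient) \<Rightarrow> bool" where
  "complete_induced_metric \<epsilon> \<A> X \<longleftrightarrow>
     (\<forall>s::nat \<Rightarrow> 'a.
        (\<forall>e>0. \<exists>N. \<forall>i\<ge>N. \<forall>j\<ge>N. riem_dist \<epsilon> \<A> X (s i) (s j) < ereal e)
        \<longrightarrow> (\<exists>p. s \<longlonglongrightarrow> p))"


section \<open>Solitons of the mean curvature flow\<close>

definition tangent_plane ::
  "('a \<Rightarrow> ('n::finite, 'k::finite) ambient) \<Rightarrow> ('a, 'n) chart \<Rightarrow> real^'n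
     \<Rightarrow> ('n, 'k) ambient set" where
  "tangent_plane X C y = range (dir_deriv (X \<circ> chart_inv C) y)"

definition second_fundamental_form ::
  "real \<Rightarrow> ('a \<Rightarrow> ('n::finite, 'k::finite) ambient) \<Rightarrow> ('a, 'n) chart
     \<Rightarrow> real^'n \<Rightarrow> real^'n \<Rightarrow> real^'n \<Rightarrow> ('n, 'k) ambient" where
  "second_fundamental_form \<epsilon> X C y u v =
     normal_part \<epsilon> (tangent_plane X C y) (dir_deriv (\<lambda>p. dir_deriv (X \<circ> chart_inv C) p v) y u)"

definition mean_curvature ::
  "real \<Rightarrow> ('a \<Rightarrow> ('n::finite, 'k::finite) ambient) \<Rightarrow> ('a, 'n) chart \<Rightarrow> real^'n
     \<Rightarrow> ('n, 'k) ambient" where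
  "mean_curvature \<epsilon> X C y =
     metric_trace (induced_metric \<epsilon> X C) y (second_fundamental_form \<epsilon> X C y)"

text \<open>\<open>H + \<lambda> X\<^sup>\<bottom> = 0\<close>: shrinking for \<open>\<lambda> = 1\<close>, expanding for \<open>\<lambda> = -1\<close>.\<close>

definition self_similar ::
  "real \<Rightarrow> ('a::{t2_space,second_countable_topology}, 'n::finite) chart set
     \<Rightarrow> ('a \<Rightarrow> ('n, 'k::finite) ambient) \<Rightarrow> real \<Rightarrow> bool" where
  "self_similar \<epsilon> \<A> X lam \<longleftrightarrow> (\<forall>C\<in>\<A>. \<forall>x\<in>fst C.
     mean_curvature \<epsilon> X C (snd C x)
       + lam *\<^sub>R normal_part \<epsilon> (tangent_plane X C (snd C x)) (X x) = 0)"

definition translating ::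
  "real \<Rightarrow> ('a::{t2_space,second_countable_topology}, 'n::finite) chart set
     \<Rightarrow> ('a \<Rightarrow> ('n, 'k::finite) ambient) \<Rightarrow> ('n, 'k) ambient \<Rightarrow> bool" where
  "translating \<epsilon> \<A> X V \<longleftrightarrow> (\<forall>C\<in>\<A>. \<forall>x\<in>fst C.
     mean_curvature \<epsilon> X C (snd C x) = normal_part \<epsilon> (tangent_plane X C (snd C x)) V)"

text \<open>
  The equation \<open>H + \<lambda> X\<^sup>\<bottom> = 0\<close> singles out the origin of the ambient space, whereas the Gauss map
  and the induced metric are those of every translate \<open>X - p\<close>. So \<open>(\<rho>, g)\<close> can determine whether
  \<open>X\<close> is a soliton only up to a translation: a round sphere of radius \<open>\<surd>n\<close> has the same \<open>(\<rho>, g)\<close>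
  wherever its centre is.
\<close>

definition mcf_soliton ::
  "real \<Rightarrow> ('a::{t2_space,second_countable_topology}, 'n::finite) chart set
     \<Rightarrow> ('a \<Rightarrow> ('n, 'k::finite) ambient) \<Rightarrow> bool" where
  "mcf_soliton \<epsilon> \<A> X \<longleftrightarrow>
     (\<exists>lam\<in>{1, -1}. self_similar \<epsilon> \<A> X lam) \<or> (\<exists>V. translating \<epsilon> \<A> X V)"


section \<open>Gradient solitons of the harmonic-Ricci flow\<close>

text \<open>
  \<open>dX(T\<^sub>x \<Sigma>)\<close> with the induced orientation: the images under \<open>dX\<close> of the positively oriented
  bases of the tangent space.
\<close>

definition gauss_map ::
  "('a::{t2_space,second_countable_topology}, 'n::finite) chart set
     \<Rightarrow> ('a \<Rightarrow> ('n, 'k::finite) ambient) \<Rightarrow> 'a \<Rightarrow> ('n, 'k) frame set" where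
  "gauss_map \<A> X x = {(\<lambda>i. dir_deriv (X \<circ> chart_inv C) (snd C x) (u i)) | C u.
     C \<in> \<A> \<and> x \<in> fst C \<and> det (\<chi> i. u i) > 0}"

text \<open>
  The map \<open>\<rho>\<close> in the chart \<open>C\<close> of \<open>\<Sigma>\<close> and the chart of the Grassmannian centred at \<open>\<rho>(x)\<close>.
  Since the latter identifies the tangent space at \<open>\<rho>(x)\<close> with \<open>Hom(\<rho>(x), \<rho>(x)\<^sup>\<bottom>)\<close>, both \<open>d\<rho>\<close> and
  the tension field at \<open>x\<close> are computed in it.
\<close>

definition gauss_coord ::
  "real \<Rightarrow> ('a::{t2_space,second_countable_topology}, 'n::finite) chart set
     \<Rightarrow> ('a \<Rightarrow> ('n, 'k::finite) ambient) \<Rightarrow> ('a, 'n) chart \<Rightarrow> 'a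
     \<Rightarrow> real^'n \<Rightarrow> (('n, 'k) ambient \<Rightarrow>\<^sub>L ('n, 'k) ambient)" where
  "gauss_coord \<epsilon> \<A> X C x y =
     graph_coord \<epsilon> (gauss_map \<A> X x) (gauss_map \<A> X (chart_inv C y))"

definition d_gauss ::
  "real \<Rightarrow> ('a::{t2_space,second_countable_topology}, 'n::finite) chart set
     \<Rightarrow> ('a \<Rightarrow> ('n, 'k::finite) ambient) \<Rightarrow> ('a, 'n) chart \<Rightarrow> 'a
     \<Rightarrow> real^'n \<Rightarrow> (('n, 'k) ambient \<Rightarrow>\<^sub>L ('n, 'k) ambient)" where
  "d_gauss \<epsilon> \<A> X C x u = dir_deriv (gauss_coord \<epsilon> \<A> X C x) (snd C x) u"

definition gauss_tension ::
  "real \<Rightarrow> ('a::{t2_space,second_countable_topology}, 'n::finite) chart set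
     \<Rightarrow> ('a \<Rightarrow> ('n, 'k::finite) ambient) \<Rightarrow> ('a, 'n) chart \<Rightarrow> 'a
     \<Rightarrow> (('n, 'k) ambient \<Rightarrow>\<^sub>L ('n, 'k) ambient)" where
  "gauss_tension \<epsilon> \<A> X C x =
     tension (induced_metric \<epsilon> X C)
       (hom_perp \<epsilon> (gauss_map \<A> X x)) (grass_chart_metric \<epsilon> (gauss_map \<A> X x))
       (gauss_coord \<epsilon> \<A> X C x) (snd C x)"

definition gradient_soliton ::
  "real \<Rightarrow> real \<Rightarrow> ('a::{t2_space,second_countable_topology}, 'n::finite) chart set
     \<Rightarrow> ('a \<Rightarrow> ('n, 'k::finite) ambient) \<Rightarrow> ('a \<Rightarrow> real) \<Rightarrow> real \<Rightarrow> bool" where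
  "gradient_soliton \<epsilon> \<alpha> \<A> X f lam \<longleftrightarrow> smooth_map \<A> f \<and>
     (\<forall>C\<in>\<A>. \<forall>x\<in>fst C. let g = induced_metric \<epsilon> X C; y = snd C x in
        (\<forall>u v. ricci g y u v
               - \<alpha> * grass_metric \<epsilon> (gauss_map \<A> X x) (d_gauss \<epsilon> \<A> X C x u) (d_gauss \<epsilon> \<A> X C x v)
               + hessian g (f \<circ> chart_inv C) y u v
             = lam * g y u v) \<and>
        gauss_tension \<epsilon> \<A> X C x = d_gauss \<epsilon> \<A> X C x (gradient g (f \<circ> chart_inv C) y))"

end

theory Submission
  imports Defs
begin

text \<open>
  Write \<open>A\<close> for the second fundamental form. Since \<open>d\<rho>(u) = A(u, _)\<close>, the Gauss equation reads
  \<open>Ric - \<alpha> d\<rho> \<otimes> d\<rho> = \<langle>A, H\<rangle>\<close> for \<open>\<alpha> = -\<epsilon>\<close>, and by Ruh and Vilms \<open>\<Delta>\<rho>\<close> is the normal derivative of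
  \<open>H\<close>. Consider the vector field \<open>W = dX(\<nabla>f) - H - \<lambda>X\<close> along the immersion. The tangential part of
  its derivative is the difference of the two sides of the first soliton equation and the normal
  part is that of the second one, so \<open>(\<rho>, g)\<close> is a gradient soliton with potential \<open>f\<close> if and only if
  \<open>W\<close> is locally constant. For a soliton of the mean curvature flow and the potential given in the
  theorem, \<open>W\<close> is \<open>0\<close> or \<open>-V\<close>. Conversely, if \<open>W\<close> is a constant \<open>-\<lambda>p\<close> or \<open>-V\<close>, then its
  normal part is the equation of a soliton of the mean curvature flow, and its tangential part
  determines \<open>df\<close>.

  The metric of the Grassmannian in graph coordinates agrees to first order at the centre with its
  value there, so the Christoffel map vanishes at the centre and the tension field involves only the
  second derivatives of the graph coordinates of the Gauss map.
\<close>

section \<open>Directional derivatives and smooth functions\<close>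

text \<open>Many notions of the statement are given by descriptions or choices (\<open>THE\<close>,
  \<open>SOME\<close>, \<open>inv_into\<close>), which cannot be differentiated as they stand. Each
  is replaced by a formula in the coordinate frame of a chart: orthogonal projections, gradients and
  the metric of the Grassmannian become expressions in the inverse Gram matrix, which only has to be
  invertible on the tangent spaces, so both signatures are treated at once. Neither normal
  coordinates nor orthonormal moving frames are used; the Christoffel terms are carried along and
  cancel. The value \<alpha> = -\<epsilon> enters through \<epsilon>^2 = 1: the metric of the
  Grassmannian carries a factor \<epsilon>, and its product with -\<alpha> restores the quadratic
  term that the contracted Gauss equation subtracts. A locally constant \<open>W\<close> has one
  constant value only on a connected manifold, and only once \<open>W\<close> is known not to depend
  on the chart; this is the purpose of the changes of coordinates. For \<lambda> \<noteq> 0 the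
  value can be absorbed into a translation of X.\<close>

lemma dir_deriv_eqI:
  assumes "(F has_derivative F') (at y)"
  shows "dir_deriv F y u = F' u"
proof -
  have "((\<lambda>t::real. y + t *\<^sub>R u) has_derivative (\<lambda>t. t *\<^sub>R u)) (at 0)"
    by (auto intro!: derivative_eq_intros)
  from has_derivative_compose[OF this, of F F'] assms
  have "((\<lambda>t::real. F (y + t *\<^sub>R u)) has_derivative (\<lambda>t. F' (t *\<^sub>R u))) (at 0)" by simp
  moreover have "F' (t *\<^sub>R u) = t *\<^sub>R F' u" for t
    using has_derivative_bounded_linear[OF assms] by (simp add: linear_simps)
  ultimately show ?thesis
    unfolding dir_deriv_def by (intro vector_derivative_at) (simp add: has_vector_derivative_def)
qed

lemma has_derivative_dir_deriv:
  assumes "F differentiable (at y)"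
  shows "(F has_derivative dir_deriv F y) (at y)"
  using assms dir_deriv_eqI unfolding differentiable_def by (metis ext)

lemma dir_deriv_cong:
  assumes "\<forall>\<^sub>F p in nhds y. F p = G p"
  shows "dir_deriv F y u = dir_deriv G y u"
proof -
  have "((\<lambda>t::real. y + t *\<^sub>R u) \<longlongrightarrow> y + 0 *\<^sub>R u) (nhds 0)"
    by (intro tendsto_intros filterlim_ident)
  then have "\<forall>\<^sub>F t in nhds (0::real). F (y + t *\<^sub>R u) = G (y + t *\<^sub>R u)"
    using assms by (auto dest: filterlim_iff[THEN iffD1, rule_format])
  then show ?thesis
    unfolding dir_deriv_def by (intro vector_derivative_cong_eq) auto
qed

text \<open>A constant shift leaves the set of candidates for \<open>vector_derivative\<close>
  unchanged, so the chosen value is the same even where no derivative exists. This later makes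
  everything except the position vector invariant under translations of the ambient space.\<close>

lemma dir_deriv_diff_const [simp]: "dir_deriv (\<lambda>x. F x - c) = dir_deriv F"
proof (intro ext)
  fix y u
  have "((\<lambda>t. F (y + t *\<^sub>R u) - c) has_vector_derivative d) (at (0::real))
      \<longleftrightarrow> ((\<lambda>t. F (y + t *\<^sub>R u)) has_vector_derivative d) (at (0::real))" for d
    using has_vector_derivative_diff[OF _ has_vector_derivative_const[of c], of "\<lambda>t. F (y + t *\<^sub>R u)" d "at (0::real)"]
      has_vector_derivative_add[OF _ has_vector_derivative_const[of c], of "\<lambda>t. F (y + t *\<^sub>R u) - c" d "at (0::real)"]
    by auto
  then show "dir_deriv (\<lambda>x. F x - c) y u = dir_deriv F y u"
    by (simp add: dir_deriv_def vector_derivative_def)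
qed

lemma dir_deriv_add_const [simp]: "dir_deriv (\<lambda>x. F x + c) = dir_deriv F"
  using dir_deriv_diff_const[of F "- c"] by simp

lemma has_derivative_zero_on_open:
  assumes "open S" "y \<in> S" "\<And>p. p \<in> S \<Longrightarrow> g p = c"
  shows "(g has_derivative (\<lambda>u. 0)) (at y)"
  by (rule has_derivative_transform_within_open[OF has_derivative_const assms(1,2)]) (simp add: assms(3))

lemma has_derivative_cong_nhds:
  assumes "(G has_derivative F') (at p)" "\<forall>\<^sub>F q in nhds p. F q = G q"
  shows "(F has_derivative F') (at p)"
  using assms has_derivative_transform_within_open[OF assms(1)] unfolding eventually_nhds by metis

lemma tendsto_nhds_of_has_derivative:
  assumes "(F has_derivative F') (at p)"
  shows "(F \<longlongrightarrow> F p) (nhds p)"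
  using has_derivative_continuous[OF assms] by (simp add: continuous_at tendsto_nhds_iff)

section \<open>Closure properties of smooth functions\<close>

lemma Ck_on_cong:
  assumes "open S" "\<And>y. y \<in> S \<Longrightarrow> F y = G y" "Ck_on k S F"
  shows "Ck_on k S G"
  using assms(2,3)
proof (induction k arbitrary: F G)
  case 0
  then show ?case by (auto cong: continuous_on_cong)
next
  case (Suc k)
  have ev: "\<forall>\<^sub>F p in nhds y. F p = G p" if "y \<in> S" for y
    using eventually_nhds_in_open[OF assms(1) that] Suc.prems(1) by (auto elim: eventually_mono)
  have "G differentiable (at y)" if "y \<in> S" for y
  proof -
    have "(F has_derivative dir_deriv F y) (at y)"
      using Suc.prems(2) that by (auto intro: has_derivative_dir_deriv)
    then have "(G has_derivative dir_deriv F y) (at y)"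
      by (rule has_derivative_transform_within_open[OF _ assms(1) that]) (use Suc.prems(1) in auto)
    then show ?thesis by (auto simp: differentiable_def)
  qed
  moreover have "Ck_on k S (\<lambda>y. dir_deriv G y u)" for u
    by (rule Suc.IH[of "\<lambda>y. dir_deriv F y u"]) (use Suc.prems ev in \<open>auto intro: dir_deriv_cong\<close>)
  ultimately show ?case by simp
qed

lemma Ck_on_Suc_imp:
  assumes "Ck_on (Suc k) S F"
  shows "Ck_on k S F"
  using assms
proof (induction k arbitrary: F)
  case 0
  then show ?case
    by (auto intro!: continuous_at_imp_continuous_on differentiable_imp_continuous_within)
next
  case (Suc k)
  then show ?case by auto
qed

lemma Ck_on_const:
  fixes S :: "'e::real_normed_vector set"
  shows "Ck_on k S (\<lambda>y. c)"
proof (induction k arbitrary: c)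
  case (Suc k)
  have "dir_deriv (\<lambda>y. c) y u = 0" for y u :: 'e
    by (rule dir_deriv_eqI[where F'="\<lambda>_. 0"]) auto
  then have "(\<lambda>y. dir_deriv (\<lambda>y. c) y u) = (\<lambda>y. 0)" for u :: 'e by (intro ext)
  with Suc show ?case by simp
qed simp

lemma Ck_on_add:
  assumes "open S" "Ck_on k S F" "Ck_on k S G"
  shows "Ck_on k S (\<lambda>y. F y + G y)"
  using assms(2,3)
proof (induction k arbitrary: F G)
  case 0
  then show ?case by (auto intro: continuous_intros)
next
  case (Suc k)
  have "Ck_on k S (\<lambda>y. dir_deriv (\<lambda>y. F y + G y) y u)" for u
  proof (rule Ck_on_cong[OF assms(1)])
    show "Ck_on k S (\<lambda>y. dir_deriv F y u + dir_deriv G y u)"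
      using Suc by auto
    show "dir_deriv F y u + dir_deriv G y u = dir_deriv (\<lambda>y. F y + G y) y u" if "y \<in> S" for y
      using Suc.prems that
      by (intro dir_deriv_eqI[symmetric] has_derivative_add has_derivative_dir_deriv) auto
  qed
  with Suc.prems show ?case by auto
qed

lemma Ck_on_bilinear:
  assumes "bounded_bilinear b" "open S" "Ck_on k S F" "Ck_on k S G"
  shows "Ck_on k S (\<lambda>y. b (F y) (G y))"
  using assms(3,4)
proof (induction k arbitrary: F G)
  case 0
  then show ?case using assms(1) by (auto intro: bounded_bilinear.continuous_on)
next
  case (Suc k)
  have D: "((\<lambda>y. b (F y) (G y)) has_derivative
      (\<lambda>u. b (F y) (dir_deriv G y u) + b (dir_deriv F y u) (G y))) (at y)" if "y \<in> S" for y
    using Suc.prems that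
    by (intro bounded_bilinear.FDERIV[OF assms(1)] has_derivative_dir_deriv) auto
  have "Ck_on k S (\<lambda>y. dir_deriv (\<lambda>y. b (F y) (G y)) y u)" for u
  proof (rule Ck_on_cong[OF assms(2)])
    \<comment> \<open>In each term of the product rule one factor is not differentiated; it is
      lowered from order k + 1 to k so that the induction hypothesis applies to the pair.\<close>
    show "Ck_on k S (\<lambda>y. b (F y) (dir_deriv G y u) + b (dir_deriv F y u) (G y))"
      using Suc Ck_on_Suc_imp[of k S F] Ck_on_Suc_imp[of k S G] by (intro Ck_on_add assms) auto
    show "b (F y) (dir_deriv G y u) + b (dir_deriv F y u) (G y)
        = dir_deriv (\<lambda>y. b (F y) (G y)) y u" if "y \<in> S" for y
      using dir_deriv_eqI[OF D[OF that]] by simp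
  qed
  with D show ?case by (auto simp: differentiable_def)
qed

lemma smooth_on_const: "smooth_on S (\<lambda>y. c)"
  by (simp add: smooth_on_def Ck_on_const)

lemma smooth_on_add:
  "open S \<Longrightarrow> smooth_on S F \<Longrightarrow> smooth_on S G \<Longrightarrow> smooth_on S (\<lambda>y. F y + G y)"
  by (simp add: smooth_on_def Ck_on_add)

lemma smooth_on_bilinear:
  "bounded_bilinear b \<Longrightarrow> open S \<Longrightarrow> smooth_on S F \<Longrightarrow> smooth_on S G
    \<Longrightarrow> smooth_on S (\<lambda>y. b (F y) (G y))"
  by (simp add: smooth_on_def Ck_on_bilinear)

lemma smooth_on_has_derivative:
  assumes "smooth_on S F" "y \<in> S"
  shows "(F has_derivative dir_deriv F y) (at y)"
proof -
  have "Ck_on (Suc 0) S F" using assms(1) smooth_on_def by blast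
  with assms(2) show ?thesis by (auto intro: has_derivative_dir_deriv)
qed

lemma smooth_on_dir_deriv:
  assumes "smooth_on S F"
  shows "smooth_on S (\<lambda>y. dir_deriv F y u)"
  unfolding smooth_on_def
proof
  fix k
  have "Ck_on (Suc k) S F" using assms smooth_on_def by blast
  then show "Ck_on k S (\<lambda>y. dir_deriv F y u)" by auto
qed

lemma smooth_on_continuous_on: "smooth_on S F \<Longrightarrow> continuous_on S F"
  using Ck_on.simps(1) smooth_on_def by blast

lemma smooth_on_dir_deriv_linear:
  assumes "smooth_on S F" "y \<in> S"
  shows "linear (dir_deriv F y)"
  using smooth_on_has_derivative[OF assms] has_derivative_linear by blast

lemma smooth_on_bounded_linear:
  assumes "bounded_linear b" "open S" "smooth_on S F"
  shows "smooth_on S (\<lambda>y. b (F y))"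
proof -
  \<comment> \<open>A linear map is treated as a bilinear one whose first argument is the constant
    1.\<close>
  have "bounded_bilinear (\<lambda>(r::real) x. r *\<^sub>R b x)"
    using bounded_bilinear.comp[OF bounded_bilinear_scaleR bounded_linear_ident assms(1)]
    by simp
  from smooth_on_bilinear[OF this assms(2) smooth_on_const[of S 1] assms(3)]
  show ?thesis by simp
qed

lemma dir_deriv_bounded_linear:
  assumes "bounded_linear b" "smooth_on S F" "y \<in> S"
  shows "dir_deriv (\<lambda>y. b (F y)) y u = b (dir_deriv F y u)"
  by (intro dir_deriv_eqI bounded_linear.has_derivative[OF assms(1)] smooth_on_has_derivative[OF assms(2,3)])


text \<open>Both mixed derivatives are limits of the same second difference quotient.\<close>

lemma second_difference_MVT:
  fixes F :: "'e::real_normed_vector \<Rightarrow> real"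
  assumes F: "smooth_on S F" and s: "0 < s"
    and sub: "\<And>a b. 0 \<le> a \<Longrightarrow> a \<le> s \<Longrightarrow> 0 \<le> b \<Longrightarrow> b \<le> s \<Longrightarrow> y + a *\<^sub>R u + b *\<^sub>R v \<in> S"
  shows "\<exists>a b. 0 < a \<and> a < s \<and> 0 < b \<and> b < s \<and>
    F (y + s *\<^sub>R u + s *\<^sub>R v) - F (y + s *\<^sub>R u) - F (y + s *\<^sub>R v) + F y
      = s * s * dir_deriv (\<lambda>p. dir_deriv F p u) (y + a *\<^sub>R u + b *\<^sub>R v) v"
proof -
  have der: "((\<lambda>t. G (q + t *\<^sub>R w)) has_field_derivative dir_deriv G (q + t *\<^sub>R w) w) (at t)"
    if "smooth_on S G" "q + t *\<^sub>R w \<in> S" for G :: "'e \<Rightarrow> real" and q w t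
  proof -
    have "((\<lambda>t::real. q + t *\<^sub>R w) has_derivative (\<lambda>t. t *\<^sub>R w)) (at t)"
      by (auto intro!: derivative_eq_intros)
    from has_derivative_compose[OF this smooth_on_has_derivative[OF that]]
    have "((\<lambda>t. G (q + t *\<^sub>R w)) has_derivative (\<lambda>r. dir_deriv G (q + t *\<^sub>R w) (r *\<^sub>R w))) (at t)" .
    moreover have "(\<lambda>r. dir_deriv G (q + t *\<^sub>R w) (r *\<^sub>R w)) = (*) (dir_deriv G (q + t *\<^sub>R w) w)"
      using linear_cmul[OF smooth_on_dir_deriv_linear[OF that], of _ w] by (simp add: fun_eq_iff)
    ultimately show ?thesis by (simp add: has_field_derivative_def)
  qed
  \<comment> \<open>\<open>g\<close> is the increment of F in the direction v as a function of the
    position along u. The mean value theorem is applied to it along u, and then to the resulting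
    difference of derivatives along v.\<close>
  define g where "g = (\<lambda>t. F (y + s *\<^sub>R v + t *\<^sub>R u) - F (y + t *\<^sub>R u))"
  have "\<exists>a. 0 < a \<and> a < s \<and> g s - g 0 = (s - 0) *
      (dir_deriv F (y + s *\<^sub>R v + a *\<^sub>R u) u - dir_deriv F (y + a *\<^sub>R u) u)"
    unfolding g_def
  proof (rule MVT2[OF s])
    fix x assume "0 \<le> x" "x \<le> s"
    then show "((\<lambda>t. F (y + s *\<^sub>R v + t *\<^sub>R u) - F (y + t *\<^sub>R u)) has_field_derivative
        dir_deriv F (y + s *\<^sub>R v + x *\<^sub>R u) u - dir_deriv F (y + x *\<^sub>R u) u) (at x)"
      using sub[of x s] sub[of x 0] s by (intro DERIV_diff der F) (auto simp: algebra_simps)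
  qed
  then obtain a where a: "0 < a" "a < s"
    and ga: "g s - g 0 = s * (dir_deriv F (y + s *\<^sub>R v + a *\<^sub>R u) u - dir_deriv F (y + a *\<^sub>R u) u)"
    by auto
  have "\<exists>b. 0 < b \<and> b < s \<and>
      dir_deriv F (y + a *\<^sub>R u + s *\<^sub>R v) u - dir_deriv F (y + a *\<^sub>R u + 0 *\<^sub>R v) u
      = (s - 0) * dir_deriv (\<lambda>p. dir_deriv F p u) (y + a *\<^sub>R u + b *\<^sub>R v) v"
    using s a sub[of a] by (intro MVT2 der smooth_on_dir_deriv F) auto
  then obtain b where "0 < b" "b < s"
    "dir_deriv F (y + a *\<^sub>R u + s *\<^sub>R v) u - dir_deriv F (y + a *\<^sub>R u) u
      = s * dir_deriv (\<lambda>p. dir_deriv F p u) (y + a *\<^sub>R u + b *\<^sub>R v) v" by auto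
  then have "g s - g 0 = s * s * dir_deriv (\<lambda>p. dir_deriv F p u) (y + a *\<^sub>R u + b *\<^sub>R v) v"
    using ga by (simp add: add.commute add.left_commute)
  moreover have "g s - g 0
      = F (y + s *\<^sub>R u + s *\<^sub>R v) - F (y + s *\<^sub>R u) - F (y + s *\<^sub>R v) + F y"
    by (simp add: g_def algebra_simps)
  ultimately show ?thesis using a \<open>0 < b\<close> \<open>b < s\<close> by metis
qed

text \<open>If the mixed derivatives \<open>A\<close> and \<open>B\<close> differed at y, then by
  continuity each would stay within half of the gap near y, and no value of \<open>A\<close> there
  could equal a value of \<open>B\<close>; but the common second difference produces two points
  where they agree.\<close>

lemma dir_deriv_commute_real:
  fixes F :: "'e::real_normed_vector \<Rightarrow> real"
  assumes S: "open S" and F: "smooth_on S F" and y: "y \<in> S"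
  shows "dir_deriv (\<lambda>p. dir_deriv F p v) y u = dir_deriv (\<lambda>p. dir_deriv F p u) y v"
proof (rule ccontr)
  define A where "A = (\<lambda>p. dir_deriv (\<lambda>p. dir_deriv F p v) p u)"
  define B where "B = (\<lambda>p. dir_deriv (\<lambda>p. dir_deriv F p u) p v)"
  assume "dir_deriv (\<lambda>p. dir_deriv F p v) y u \<noteq> dir_deriv (\<lambda>p. dir_deriv F p u) y v"
  then have e: "0 < \<bar>A y - B y\<bar> / 2" by (simp add: A_def B_def)
  have "continuous_on S A" "continuous_on S B"
    unfolding A_def B_def by (intro smooth_on_continuous_on smooth_on_dir_deriv F)+
  then have "(A \<longlongrightarrow> A y) (nhds y)" "(B \<longlongrightarrow> B y) (nhds y)"
    using S y by (simp_all add: continuous_on_eq_continuous_at isCont_def tendsto_nhds_iff)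
  from tendstoD[OF this(1) e] tendstoD[OF this(2) e] eventually_nhds_in_open[OF S y]
  have "\<forall>\<^sub>F p in nhds y. dist (A p) (A y) < \<bar>A y - B y\<bar> / 2
      \<and> dist (B p) (B y) < \<bar>A y - B y\<bar> / 2 \<and> p \<in> S"
    by eventually_elim auto
  then obtain d where d: "0 < d" and near: "\<And>p. dist p y < d \<Longrightarrow> dist (A p) (A y) < \<bar>A y - B y\<bar> / 2
      \<and> dist (B p) (B y) < \<bar>A y - B y\<bar> / 2 \<and> p \<in> S"
    unfolding eventually_nhds_metric by blast
  \<comment> \<open>With this side length the parallelogram spanned by s u and s v stays within
    distance d / 2 of y; the summand 1 keeps the denominator positive when u and v vanish.\<close>
  define s where "s = d / (2 * (norm u + norm v + 1))"
  have pos: "0 < norm u + norm v + 1" by (smt (verit) norm_ge_zero)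
  then have s: "0 < s" using d by (simp add: s_def)
  have close: "dist (y + a *\<^sub>R u + b *\<^sub>R v) y < d"
    if "0 \<le> a" "a \<le> s" "0 \<le> b" "b \<le> s" for a b
  proof -
    have "dist (y + a *\<^sub>R u + b *\<^sub>R v) y = norm (a *\<^sub>R u + b *\<^sub>R v)"
      by (simp add: dist_norm add.assoc)
    also have "\<dots> \<le> a * norm u + b * norm v"
      using norm_triangle_ineq[of "a *\<^sub>R u" "b *\<^sub>R v"] that by simp
    also have "\<dots> \<le> s * norm u + s * norm v"
      using that by (intro add_mono mult_right_mono) auto
    also have "\<dots> \<le> s * (norm u + norm v + 1)" using s by (simp add: algebra_simps)
    also have "\<dots> = d / 2" using pos by (simp add: s_def field_simps)
    also have "\<dots> < d" using d by simp
    finally show ?thesis .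
  qed
  obtain a b where ab: "0 < a" "a < s" "0 < b" "b < s" and
    1: "F (y + s *\<^sub>R u + s *\<^sub>R v) - F (y + s *\<^sub>R u) - F (y + s *\<^sub>R v) + F y
      = s * s * B (y + a *\<^sub>R u + b *\<^sub>R v)"
    using second_difference_MVT[OF F s, of y u v] near close unfolding B_def by blast
  have "y + a *\<^sub>R v + b *\<^sub>R u \<in> S" if "0 \<le> a" "a \<le> s" "0 \<le> b" "b \<le> s" for a b
    using near[OF close[of b a]] that by (simp add: algebra_simps)
  then obtain a' b' where ab': "0 < a'" "a' < s" "0 < b'" "b' < s" and
    2: "F (y + s *\<^sub>R v + s *\<^sub>R u) - F (y + s *\<^sub>R v) - F (y + s *\<^sub>R u) + F y
      = s * s * A (y + a' *\<^sub>R v + b' *\<^sub>R u)"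
    using second_difference_MVT[OF F s, of y v u] unfolding A_def by blast
  have "s * s * A (y + a' *\<^sub>R v + b' *\<^sub>R u) = s * s * B (y + a *\<^sub>R u + b *\<^sub>R v)"
    unfolding 1[symmetric] 2[symmetric] by (simp add: algebra_simps)
  then have "A (y + b' *\<^sub>R u + a' *\<^sub>R v) = B (y + a *\<^sub>R u + b *\<^sub>R v)"
    using s by (simp add: algebra_simps)
  then have "\<bar>A y - B y\<bar> \<le> dist (A (y + b' *\<^sub>R u + a' *\<^sub>R v)) (A y) + dist (B (y + a *\<^sub>R u + b *\<^sub>R v)) (B y)"
    by (simp add: dist_real_def)
  with near[OF close[of b' a']] near[OF close[of a b]] ab ab' show False
    by (smt (verit) field_sum_of_halves)
qed

lemma dir_deriv_commute:
  fixes F :: "'e::real_normed_vector \<Rightarrow> 'f::euclidean_space"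
  assumes S: "open S" and F: "smooth_on S F" and y: "y \<in> S"
  shows "dir_deriv (\<lambda>p. dir_deriv F p v) y u = dir_deriv (\<lambda>p. dir_deriv F p u) y v"
proof (rule euclidean_eqI)
  fix b :: 'f assume "b \<in> Basis"
  have bl: "bounded_linear (\<lambda>x. x \<bullet> b)" by (rule bounded_linear_inner_left)
  have eq: "dir_deriv (\<lambda>p. dir_deriv F p v) y u \<bullet> b
      = dir_deriv (\<lambda>p. dir_deriv (\<lambda>p. F p \<bullet> b) p v) y u" for u v
  proof -
    have "dir_deriv (\<lambda>p. dir_deriv F p v) y u \<bullet> b = dir_deriv (\<lambda>p. dir_deriv F p v \<bullet> b) y u"
      by (rule dir_deriv_bounded_linear[OF bl smooth_on_dir_deriv[OF F] y, symmetric])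
    also have "\<dots> = dir_deriv (\<lambda>p. dir_deriv (\<lambda>p. F p \<bullet> b) p v) y u"
      using eventually_nhds_in_open[OF S y] dir_deriv_bounded_linear[OF bl F]
      by (intro dir_deriv_cong) (auto elim: eventually_mono)
    finally show ?thesis .
  qed
  show "dir_deriv (\<lambda>p. dir_deriv F p v) y u \<bullet> b = dir_deriv (\<lambda>p. dir_deriv F p u) y v \<bullet> b"
    unfolding eq
    by (rule dir_deriv_commute_real[OF S smooth_on_bounded_linear[OF bl S F] y])
qed


section \<open>Derivative of the inverse matrix\<close>

lemma bounded_bilinear_matrix_mult:
  "bounded_bilinear ((**) :: real^'n^'m \<Rightarrow> real^'p^'n \<Rightarrow> real^'p^'m)"
  unfolding bilinear_conv_bounded_bilinear[symmetric] bilinear_def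
  by (auto intro!: linearI simp: matrix_matrix_mult_def vec_eq_iff algebra_simps sum.distrib sum_distrib_left)

lemma bounded_bilinear_matrix_vector_mult:
  "bounded_bilinear ((*v) :: real^'n^'m \<Rightarrow> real^'n \<Rightarrow> real^'m)"
  unfolding bilinear_conv_bounded_bilinear[symmetric] bilinear_def
  by (auto intro!: linearI simp: matrix_vector_mult_def vec_eq_iff algebra_simps sum.distrib sum_distrib_left)

lemma has_derivative_vec_nth_iff:
  fixes f :: "'e::real_normed_vector \<Rightarrow> real^'n"
  shows "(f has_derivative f') (at p)
    \<longleftrightarrow> (\<forall>i. ((\<lambda>q. f q $ i) has_derivative (\<lambda>u. f' u $ i)) (at p))"
  unfolding has_derivative_componentwise_within[of f]
  by (auto simp: Basis_vec_def inner_axis)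

lemma has_derivative_matrix_nth_iff:
  fixes f :: "'e::real_normed_vector \<Rightarrow> real^'n^'m"
  shows "(f has_derivative f') (at p)
    \<longleftrightarrow> (\<forall>i j. ((\<lambda>q. f q $ i $ j) has_derivative (\<lambda>u. f' u $ i $ j)) (at p))"
proof -
  have "(f has_derivative f') (at p) \<longleftrightarrow>
    (\<forall>i. ((\<lambda>q. f q $ i) has_derivative (\<lambda>u. f' u $ i)) (at p))"
    unfolding has_derivative_componentwise_within[of f]
      has_derivative_componentwise_within[of "\<lambda>q. f q $ i" for i]
    by (auto simp: Basis_vec_def inner_axis)
  then show ?thesis by (simp add: has_derivative_vec_nth_iff)
qed

lemma differentiable_det:
  fixes M :: "'e::real_normed_vector \<Rightarrow> real^'n^'n"
  assumes "\<And>i j. (\<lambda>q. M q $ i $ j) differentiable (at p)"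
  shows "(\<lambda>q. det (M q)) differentiable (at p)"
proof -
  have "\<forall>i j. \<exists>D. ((\<lambda>q. M q $ i $ j) has_derivative D) (at p)"
    using assms by (auto simp: differentiable_def)
  then obtain D where "\<And>i j. ((\<lambda>q. M q $ i $ j) has_derivative D i j) (at p)" by metis
  then have "(\<lambda>q. \<Prod>i\<in>UNIV. M q $ i $ \<pi> i) differentiable (at p)" for \<pi>
    using has_derivative_prod[of UNIV "\<lambda>i q. M q $ i $ \<pi> i" "\<lambda>i. D i (\<pi> i)" p UNIV]
    by (auto simp: differentiable_def)
  then show ?thesis
    unfolding det_def by (intro differentiable_sum finite_permutations differentiable_mult) auto
qed

lemma matrix_inv_mult:
  fixes A :: "real^'n^'n"
  assumes "det A \<noteq> 0"
  shows "matrix_inv A ** A = mat 1" "A ** matrix_inv A = mat 1"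
  using someI_ex[OF invertible_det_nz[THEN iffD2, OF assms, unfolded invertible_def]]
  by (auto simp: matrix_inv_def)

lemma matrix_inv_unique:
  fixes A :: "real^'n^'n"
  assumes "A ** B = mat 1"
  shows "matrix_inv A = B"
proof -
  have "det A \<noteq> 0" using assms by (metis det_I det_mul mult_zero_left zero_neq_one)
  then show ?thesis
    using assms matrix_inv_mult(1) by (metis matrix_mul_assoc matrix_mul_lid matrix_mul_rid)
qed

lemma matrix_axis: "(\<chi> i. axis i 1) = (mat 1 :: real^'n^'n)"
  by (auto simp: vec_eq_iff mat_def axis_def)

lemma matrix_inv_one: "matrix_inv (mat 1 :: real^'n^'n) = mat 1"
  by (rule matrix_inv_unique) simp

text \<open>Writes each entry of the inverse as a quotient of determinants, hence of polynomials in
  the entries of A; this is what makes the inverse of a varying matrix differentiable.\<close>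

lemma matrix_inv_cramer:
  fixes A :: "real^'n^'n"
  assumes "det A \<noteq> 0"
  shows "matrix_inv A $ i $ j
    = det (\<chi> a b. if b = i then axis j 1 $ a else A $ a $ b) / det A"
proof -
  have "A *v (matrix_inv A *v axis j 1) = axis j 1"
    by (simp add: matrix_vector_mul_assoc matrix_inv_mult[OF assms])
  then have "matrix_inv A *v axis j 1
      = (\<chi> k. det (\<chi> a b. if b = k then axis j 1 $ a else A $ a $ b) / det A)"
    using cramer[OF assms] by simp
  then show ?thesis
    by (simp add: vec_eq_iff matrix_vector_mult_basis column_def)
qed

text \<open>Cramer's rule provides differentiability. The value then comes from differentiating
  \<open>M q ** matrix_inv (M q) = mat 1\<close>, valid on a neighbourhood where the determinant
  does not vanish.\<close>

lemma has_derivative_matrix_inv: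
  fixes M :: "'e::real_normed_vector \<Rightarrow> real^'n^'n"
  assumes M: "(M has_derivative M') (at p)" and det: "det (M p) \<noteq> 0"
  shows "((\<lambda>q. matrix_inv (M q)) has_derivative
    (\<lambda>u. - (matrix_inv (M p) ** M' u ** matrix_inv (M p)))) (at p)"
proof -
  have Mij: "(\<lambda>q. M q $ i $ j) differentiable (at p)" for i j
    using M by (auto simp: has_derivative_matrix_nth_iff differentiable_def)
  have dd: "(\<lambda>q. det (M q)) differentiable (at p)" by (intro differentiable_det Mij)
  then have "isCont (\<lambda>q. det (M q)) p" by (rule differentiable_imp_continuous_within)
  then have "((\<lambda>q. det (M q)) \<longlongrightarrow> det (M p)) (nhds p)"
    by (simp add: isCont_def tendsto_nhds_iff)
  then have ev: "\<forall>\<^sub>F q in nhds p. det (M q) \<noteq> 0"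
    using det by (rule tendsto_imp_eventually_ne)
  then obtain U where U: "open U" "p \<in> U" "\<And>q. q \<in> U \<Longrightarrow> det (M q) \<noteq> 0"
    by (auto simp: eventually_nhds)
  have "\<exists>D. ((\<lambda>q. matrix_inv (M q) $ i $ j) has_derivative D) (at p)" for i j
  proof -
    have "(\<lambda>q. (\<chi> a b. if b = i then axis j 1 $ a else M q $ a $ b) $ k $ l) differentiable (at p)" for k l
      using Mij by (cases "l = i") auto
    then have "(\<lambda>q. det (\<chi> a b. if b = i then axis j 1 $ a else M q $ a $ b) / det (M q))
        differentiable (at p)"
      by (intro differentiable_divide differentiable_det dd det)
    then obtain D where "((\<lambda>q. det (\<chi> a b. if b = i then axis j 1 $ a else M q $ a $ b) / det (M q))
        has_derivative D) (at p)" by (auto simp: differentiable_def)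
    then have "((\<lambda>q. matrix_inv (M q) $ i $ j) has_derivative D) (at p)"
      by (rule has_derivative_transform_within_open[OF _ U(1,2)]) (simp add: matrix_inv_cramer U(3))
    show ?thesis by (rule exI) fact
  qed
  then obtain D where D: "\<And>i j. ((\<lambda>q. matrix_inv (M q) $ i $ j) has_derivative D i j) (at p)"
    by metis
  define E where "E = (\<lambda>u. (\<chi> i j. D i j u) :: real^'n^'n)"
  have E: "((\<lambda>q. matrix_inv (M q)) has_derivative E) (at p)"
    using D by (simp add: has_derivative_matrix_nth_iff E_def)
  have "((\<lambda>q. M q ** matrix_inv (M q)) has_derivative
      (\<lambda>u. M p ** E u + M' u ** matrix_inv (M p))) (at p)"
    by (rule bounded_bilinear.FDERIV[OF bounded_bilinear_matrix_mult M E])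
  then have "((\<lambda>q. mat 1 :: real^'n^'n) has_derivative
      (\<lambda>u. M p ** E u + M' u ** matrix_inv (M p))) (at p)"
    by (rule has_derivative_transform_within_open[OF _ U(1,2)]) (simp add: matrix_inv_mult U(3))
  from has_derivative_unique[OF this has_derivative_const]
  have "M p ** E u + M' u ** matrix_inv (M p) = 0" for u by (rule fun_cong)
  then have *: "M p ** E u = - (M' u ** matrix_inv (M p))" for u by (simp add: eq_neg_iff_add_eq_0)
  have "E u = - (matrix_inv (M p) ** M' u ** matrix_inv (M p))" for u
  proof -
    have "E u = matrix_inv (M p) ** (M p ** E u)"
      by (simp add: matrix_mul_assoc matrix_inv_mult[OF det])
    also have "\<dots> = - (matrix_inv (M p) ** M' u ** matrix_inv (M p))"
      unfolding * by (simp add: bounded_bilinear.minus_right[OF bounded_bilinear_matrix_mult] matrix_mul_assoc)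
    finally show ?thesis .
  qed
  then have "E = (\<lambda>u. - (matrix_inv (M p) ** M' u ** matrix_inv (M p)))" by (intro ext)
  with E show ?thesis by simp
qed

text \<open>Vectors of the ambient space are pairs, but their components play no role below.\<close>

declare split_paired_All [simp del] split_paired_Ex [simp del]


section \<open>Linear combinations of frames\<close>

definition comb :: "('n::finite \<Rightarrow> 'b::real_vector) \<Rightarrow> real^'n \<Rightarrow> 'b" where
  "comb b c = (\<Sum>i\<in>UNIV. c $ i *\<^sub>R b i)"

text \<open>Matrices act on frames from the left, row i holding the coefficients of the new i-th
  vector; this is the action by which \<open>oriented_span\<close> changes bases.\<close>

definition mact :: "real^'n^'n \<Rightarrow> ('n::finite \<Rightarrow> 'b::real_vector) \<Rightarrow> 'n \<Rightarrow> 'b" where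
  "mact a b i = comb b (a $ i)"

lemma linear_comb: "linear (comb b)"
  by (auto intro!: linearI simp: comb_def algebra_simps sum.distrib scaleR_sum_right)

lemma comb_zero_right [simp]: "comb b 0 = 0"
  and comb_add_right: "comb b (c + d) = comb b c + comb b d"
  and comb_diff_right: "comb b (c - d) = comb b c - comb b d"
  and comb_minus_right: "comb b (- c) = - comb b c"
  and comb_scaleR_right: "comb b (r *\<^sub>R c) = r *\<^sub>R comb b c"
  using linear_comb[of b] by (simp_all add: linear_0 linear_add linear_diff linear_neg linear_cmul)

lemma comb_zero_left [simp]: "comb (\<lambda>i. 0) c = 0"
  and comb_add_left: "comb (\<lambda>i. b i + b' i) c = comb b c + comb b' c"
  and comb_diff_left: "comb (\<lambda>i. b i - b' i) c = comb b c - comb b' c"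
  by (simp_all add: comb_def algebra_simps sum.distrib sum_subtractf)

lemma comb_axis [simp]: "comb b (axis i 1) = b i"
  by (simp add: comb_def axis_def if_distrib[of "\<lambda>x. x *\<^sub>R _"] cong: if_cong)

lemma linear_apply_comb: "linear T \<Longrightarrow> T (comb b c) = comb (\<lambda>i. T (b i)) c"
  by (simp add: comb_def linear_sum linear_cmul)

lemma linear_eq_comb:
  assumes "linear T"
  shows "T c = comb (\<lambda>i. T (axis i 1)) c"
proof -
  have "comb (\<lambda>i. axis i 1) c = c"
    by (simp add: comb_def vec_eq_iff axis_def if_distrib cong: if_cong)
  with linear_apply_comb[OF assms, of "\<lambda>i. axis i 1" c] show ?thesis by simp
qed

lemma comb_mact: "comb (mact a b) c = comb b (c v* a)"
proof -
  have "comb (mact a b) c = (\<Sum>i\<in>UNIV. \<Sum>j\<in>UNIV. (c $ i * a $ i $ j) *\<^sub>R b j)"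
    by (simp add: comb_def mact_def scaleR_sum_right)
  also have "\<dots> = (\<Sum>j\<in>UNIV. \<Sum>i\<in>UNIV. (c $ i * a $ i $ j) *\<^sub>R b j)" by (rule sum.swap)
  also have "\<dots> = comb b (c v* a)"
    by (simp add: comb_def vector_matrix_mult_def scaleR_sum_left mult.commute)
  finally show ?thesis .
qed

lemma mact_mult: "mact (a ** a') b = mact a (mact a' b)"
proof
  fix i
  have "(a ** a') $ i = a $ i v* a'"
    by (simp add: vec_eq_iff matrix_matrix_mult_def vector_matrix_mult_def mult.commute)
  then show "mact (a ** a') b i = mact a (mact a' b) i"
    by (simp add: mact_def[of "a ** a'"] mact_def[of a "mact a' b"] comb_mact)
qed

lemma mact_one [simp]: "mact (mat 1) b = b"
  by (auto simp: mact_def comb_def mat_def fun_eq_iff if_distrib[of "\<lambda>x. x *\<^sub>R _"] cong: if_cong)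

lemma mact_zero_right [simp]: "mact a (\<lambda>i. 0) = (\<lambda>i. 0)"
  by (simp add: mact_def fun_eq_iff)

lemma mact_minus_left: "mact (- a) b i = - mact a b i"
  by (simp add: mact_def comb_minus_right)

lemma mact_add_right: "mact a (\<lambda>i. b i + b' i) j = mact a b j + mact a b' j"
  and mact_diff_right: "mact a (\<lambda>i. b i - b' i) j = mact a b j - mact a b' j"
  by (simp_all add: mact_def comb_add_left comb_diff_left)

lemma linear_apply_mact: "linear T \<Longrightarrow> T (mact a b i) = mact a (\<lambda>i. T (b i)) i"
  by (simp add: mact_def linear_apply_comb)

lemma oriented_span_eq: "oriented_span b = {mact a b | a. det a > 0}"
  by (simp add: oriented_span_def mact_def comb_def fun_eq_iff)

lemma oriented_span_self: "b \<in> oriented_span b"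
  unfolding oriented_span_eq by (auto intro!: exI[of _ "mat 1"])

text \<open>The matrices of positive determinant form a group, and \<open>oriented_span b\<close> is
  the orbit of b under it.\<close>

lemma oriented_span_mact:
  assumes "det a > 0"
  shows "oriented_span (mact a b) = oriented_span b"
proof
  show "oriented_span (mact a b) \<subseteq> oriented_span b"
  proof
    fix e assume "e \<in> oriented_span (mact a b)"
    then obtain a' where a': "det a' > 0" "e = mact (a' ** a) b"
      by (auto simp: oriented_span_eq mact_mult)
    then have "det (a' ** a) > 0" using assms by (simp add: det_mul)
    with a' show "e \<in> oriented_span b" by (auto simp: oriented_span_eq)
  qed
  have "det (matrix_inv a) * det a = 1"
    using matrix_inv_mult(1)[of a] assms by (metis det_I det_mul less_irrefl)
  then have inv: "det (matrix_inv a) > 0" using assms by (metis zero_less_mult_pos2 zero_less_one)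
  show "oriented_span b \<subseteq> oriented_span (mact a b)"
  proof
    fix e assume "e \<in> oriented_span b"
    then obtain a' where a': "det a' > 0" "e = mact a' b" by (auto simp: oriented_span_eq)
    have "e = mact (a' ** matrix_inv a) (mact a b)"
      using assms by (simp add: a'(2) mact_mult[symmetric] matrix_mul_assoc[symmetric] matrix_inv_mult)
    moreover have "det (a' ** matrix_inv a) > 0" using a' inv by (simp add: det_mul)
    ultimately show "e \<in> oriented_span (mact a b)" by (auto simp: oriented_span_eq)
  qed
qed

lemma plane_oriented_span: "plane (oriented_span b) = range (comb b)"
proof
  have sub: "subspace (range (comb b))"
    by (rule linear_subspace_image[OF linear_comb subspace_UNIV])
  show "plane (oriented_span b) \<subseteq> range (comb b)"
    unfolding plane_def by (rule span_minimal[OF _ sub]) (auto simp: oriented_span_eq mact_def)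
  have "b i \<in> plane (oriented_span b)" for i
    unfolding plane_def by (rule span_base) (use oriented_span_self[of b] in auto)
  then show "range (comb b) \<subseteq> plane (oriented_span b)"
    by (auto simp: comb_def plane_def intro!: span_sum span_scale)
qed

lemma has_derivative_comb:
  assumes "\<And>i. ((\<lambda>p. b p i) has_derivative (\<lambda>u. b' u i)) (at p)"
    and "(c has_derivative c') (at p)"
  shows "((\<lambda>p. comb (b p) (c p)) has_derivative (\<lambda>u. comb (b p) (c' u) + comb (b' u) (c p))) (at p)"
proof -
  have "((\<lambda>q. c q $ i *\<^sub>R b q i) has_derivative
      (\<lambda>u. c p $ i *\<^sub>R b' u i + c' u $ i *\<^sub>R b p i)) (at p)" for i
    using assms(2) unfolding has_derivative_vec_nth_iff
    by (intro has_derivative_scaleR assms(1)) auto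
  from has_derivative_sum[of UNIV, OF this] show ?thesis
    by (simp add: comb_def sum.distrib add.commute)
qed

lemma has_derivative_mact:
  assumes "\<And>i. ((\<lambda>p. b p i) has_derivative (\<lambda>u. b' u i)) (at p)"
    and "(a has_derivative a') (at p)"
  shows "((\<lambda>p. mact (a p) (b p) j) has_derivative
    (\<lambda>u. mact (a p) (b' u) j + mact (a' u) (b p) j)) (at p)"
proof -
  have "((\<lambda>q. a q $ j) has_derivative (\<lambda>u. a' u $ j)) (at p)"
    using assms(2) by (simp add: has_derivative_matrix_nth_iff has_derivative_vec_nth_iff)
  from has_derivative_comb[OF assms(1) this] show ?thesis by (simp add: mact_def add.commute)
qed


section \<open>Frames of spacelike subspaces\<close>

lemma bounded_bilinear_ip: "bounded_bilinear (ip \<epsilon>)"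
  unfolding bilinear_conv_bounded_bilinear[symmetric] bilinear_def
  by (auto intro!: linearI simp: ip_def inner_add_left inner_add_right algebra_simps)

lemma ip_commute: "ip \<epsilon> v w = ip \<epsilon> w v"
  by (simp add: ip_def inner_commute)

lemma linear_ip_right: "linear (ip \<epsilon> v)"
  and linear_ip_left: "linear (\<lambda>v. ip \<epsilon> v w)"
  using bounded_bilinear_ip[of \<epsilon>]
  by (auto simp: bilinear_conv_bounded_bilinear[symmetric] bilinear_def)

lemmas ip_simps =
  linear_0[OF linear_ip_right] linear_0[OF linear_ip_left]
  linear_add[OF linear_ip_right] linear_add[OF linear_ip_left]
  linear_diff[OF linear_ip_right] linear_diff[OF linear_ip_left]
  linear_neg[OF linear_ip_right] linear_neg[OF linear_ip_left]
  linear_cmul[OF linear_ip_right] linear_cmul[OF linear_ip_left]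

lemma ip_nondegenerate:
  assumes "\<epsilon> \<noteq> 0" "\<And>w. ip \<epsilon> v w = 0"
  shows "v = 0"
  using assms(2)[of "(fst v, 0)"] assms(2)[of "(0, snd v)"] assms(1)
  by (simp add: ip_def prod_eq_iff)

section \<open>Explicit orthogonal projections in a frame\<close>

definition gram :: "real \<Rightarrow> ('n::finite, 'k::finite) frame \<Rightarrow> real^'n^'n" where
  "gram \<epsilon> F = (\<chi> i j. ip \<epsilon> (F i) (F j))"

text \<open>For a spacelike frame these are the coordinates of the tangential part of v, the
  solution c of the normal equations
  \<open>gram \<epsilon> F *v c = (\<chi> j. ip \<epsilon> (F j) v)\<close>. Unlike the description
  in \<open>normal_part\<close>, this formula can be differentiated in F and v.\<close>

definition dual :: "real \<Rightarrow> ('n::finite, 'k::finite) frame \<Rightarrow> ('n, 'k) ambient \<Rightarrow> real^'n" where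
  "dual \<epsilon> F v = matrix_inv (gram \<epsilon> F) *v (\<chi> j. ip \<epsilon> (F j) v)"

definition tang ::
  "real \<Rightarrow> ('n::finite, 'k::finite) frame \<Rightarrow> ('n, 'k) ambient \<Rightarrow> ('n, 'k) ambient" where
  "tang \<epsilon> F v = comb F (dual \<epsilon> F v)"

definition nor ::
  "real \<Rightarrow> ('n::finite, 'k::finite) frame \<Rightarrow> ('n, 'k) ambient \<Rightarrow> ('n, 'k) ambient" where
  "nor \<epsilon> F v = v - tang \<epsilon> F v"

text \<open>For a spacelike F, the linear map that sends \<open>F i\<close> to \<open>l i\<close>
  and vanishes on the normal space. With normal values \<open>l i\<close> it is an element of
  \<open>hom_perp\<close>, given by its values on the frame.\<close>

definition blin ::
  "real \<Rightarrow> ('n::finite, 'k::finite) frame \<Rightarrow> ('n, 'k) frame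
    \<Rightarrow> (('n, 'k) ambient \<Rightarrow>\<^sub>L ('n, 'k) ambient)" where
  "blin \<epsilon> F l = Blinfun (\<lambda>v. comb l (dual \<epsilon> F v))"

lemma linear_dual: "linear (dual \<epsilon> F)"
proof -
  have "linear (\<lambda>v. \<chi> j. ip \<epsilon> (F j) v)"
    by (intro linearI) (simp_all add: vec_eq_iff ip_simps)
  from linear_compose[OF this matrix_vector_mul_linear] show ?thesis
    by (simp add: dual_def[abs_def] o_def)
qed

lemma vec_nth_dual: "dual \<epsilon> f v $ i = (\<Sum>j\<in>UNIV. matrix_inv (gram \<epsilon> f) $ i $ j * ip \<epsilon> (f j) v)"
  by (simp add: dual_def matrix_vector_mult_def)

lemma linear_tang: "linear (tang \<epsilon> F)"
  using linear_compose[OF linear_dual linear_comb] by (simp add: tang_def[abs_def] o_def)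

lemma linear_nor: "linear (nor \<epsilon> F)"
  unfolding nor_def[abs_def] by (intro linear_compose_sub linear_ident linear_tang)

lemmas nor_simps = linear_0[OF linear_nor] linear_add[OF linear_nor] linear_diff[OF linear_nor]
  linear_neg[OF linear_nor] linear_cmul[OF linear_nor]

lemma blin_apply [simp]: "blinfun_apply (blin \<epsilon> F l) v = comb l (dual \<epsilon> F v)"
proof -
  have "linear (\<lambda>v. comb l (dual \<epsilon> F v))"
    using linear_compose[OF linear_dual linear_comb] by (simp add: o_def)
  then have "bounded_linear (\<lambda>v. comb l (dual \<epsilon> F v))" by (rule linear_conv_bounded_linear[THEN iffD1])
  then show ?thesis by (simp add: blin_def bounded_linear_Blinfun_apply)
qed

lemma blin_zero [simp]: "blin \<epsilon> F (\<lambda>i. 0) = 0"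
  by (rule blinfun_eqI) simp

lemma linear_blinfun_apply: "linear (blinfun_apply L)"
  by (rule bounded_linear.linear[OF blinfun.bounded_linear_right])

lemma blin_scaleR: "r *\<^sub>R blin \<epsilon> f l = blin \<epsilon> f (\<lambda>i. r *\<^sub>R l i)"
  by (rule blinfun_eqI) (simp add: blinfun.scaleR_left comb_def scaleR_sum_right mult.commute)

lemma blin_add: "blin \<epsilon> f l + blin \<epsilon> f l' = blin \<epsilon> f (\<lambda>i. l i + l' i)"
  and blin_diff: "blin \<epsilon> f l - blin \<epsilon> f l' = blin \<epsilon> f (\<lambda>i. l i - l' i)"
  by (rule blinfun_eqI, simp add: blinfun.add_left blinfun.diff_left comb_add_left comb_diff_left)+

lemma blin_sum: "finite S \<Longrightarrow> (\<Sum>s\<in>S. blin \<epsilon> f (l s)) = blin \<epsilon> f (\<lambda>i. \<Sum>s\<in>S. l s i)"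
  by (induction S rule: finite_induct) (simp_all add: blin_add)

lemma has_derivative_blin:
  assumes "\<And>i. ((\<lambda>p. l p i) has_derivative (\<lambda>u. l' u i)) (at p)"
  shows "((\<lambda>p. blin \<epsilon> F (l p)) has_derivative (\<lambda>u. blin \<epsilon> F (l' u))) (at p)"
proof -
  have bl: "bounded_linear (\<lambda>v. dual \<epsilon> F v $ i)" for i
    using bounded_linear_compose[OF bounded_linear_vec_nth linear_dual[THEN linear_conv_bounded_linear[THEN iffD1]]] .
  \<comment> \<open>A sum of rank-one maps, each bounded linear in \<open>l i\<close>, since the
    coordinate functionals of the fixed frame do not vary.\<close>
  have eq: "blin \<epsilon> F l = (\<Sum>i\<in>UNIV. blinfun_scaleR_left (l i) o\<^sub>L Blinfun (\<lambda>v. dual \<epsilon> F v $ i))" for l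
    by (rule blinfun_eqI) (simp add: comb_def blinfun.sum_left bounded_linear_Blinfun_apply[OF bl])
  have "bounded_linear (\<lambda>x. blinfun_scaleR_left x o\<^sub>L Blinfun (\<lambda>v. dual \<epsilon> F v $ i))" for i
    by (rule bounded_linear_compose[OF bounded_bilinear.bounded_linear_left[OF bounded_bilinear_blinfun_compose] bounded_linear_blinfun_scaleR_left])
  from bounded_linear.has_derivative[OF this assms] show ?thesis
    unfolding eq by (intro has_derivative_sum)
qed

locale spacelike =
  fixes \<epsilon> :: real and F :: "('n::finite, 'k::finite) frame"
  assumes spacelike: "spacelike_frame \<epsilon> F"
begin

lemma comb_pos: "c \<noteq> 0 \<Longrightarrow> ip \<epsilon> (comb F c) (comb F c) > 0"
  using spacelike by (simp add: spacelike_frame_def comb_def)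

lemma gram_mult: "gram \<epsilon> F *v c = (\<chi> i. ip \<epsilon> (F i) (comb F c))"
  by (simp add: vec_eq_iff matrix_vector_mult_def gram_def linear_apply_comb[OF linear_ip_right])
    (simp add: comb_def mult.commute)

text \<open>A vector c in the kernel of the Gram matrix yields a vector of the span that is
  orthogonal to the frame and hence to itself; positivity on the span then forces c = 0, although
  the ambient form may be indefinite.\<close>

lemma det_gram: "det (gram \<epsilon> F) \<noteq> 0"
proof -
  have "c = 0" if "gram \<epsilon> F *v c = 0" for c
  proof (rule ccontr)
    assume "c \<noteq> 0"
    have "ip \<epsilon> (F i) (comb F c) = 0" for i using that by (simp add: gram_mult vec_eq_iff)
    then have "ip \<epsilon> (comb F c) (comb F c) = 0"
      using linear_apply_comb[OF linear_ip_right, of \<epsilon> "comb F c" F c]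
      by (simp add: ip_commute)
    with comb_pos[OF \<open>c \<noteq> 0\<close>] show False by simp
  qed
  then have "invertible (gram \<epsilon> F)"
    using matrix_left_invertible_ker invertible_left_inverse by blast
  then show ?thesis by (simp add: invertible_det_nz)
qed

lemma dual_comb [simp]: "dual \<epsilon> F (comb F c) = c"
  by (simp add: dual_def gram_mult[symmetric] matrix_vector_mul_assoc matrix_inv_mult[OF det_gram])

lemma dual_frame [simp]: "dual \<epsilon> F (F i) = axis i 1"
  using dual_comb[of "axis i 1"] by simp

lemma ip_tang: "ip \<epsilon> (F i) (tang \<epsilon> F v) = ip \<epsilon> (F i) v"
proof -
  have "gram \<epsilon> F *v dual \<epsilon> F v = (\<chi> i. ip \<epsilon> (F i) v)"
    by (simp add: dual_def matrix_vector_mul_assoc matrix_inv_mult[OF det_gram])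
  then show ?thesis by (simp add: gram_mult vec_eq_iff tang_def)
qed

lemma ip_nor [simp]: "ip \<epsilon> (F i) (nor \<epsilon> F v) = 0" "ip \<epsilon> (nor \<epsilon> F v) (F i) = 0"
  by (simp_all add: nor_def ip_simps ip_tang ip_commute[of \<epsilon> _ "F i"])

lemma ip_comb_nor [simp]: "ip \<epsilon> (comb F c) (nor \<epsilon> F v) = 0" "ip \<epsilon> (nor \<epsilon> F v) (comb F c) = 0"
  by (simp_all add: linear_apply_comb[OF linear_ip_right] linear_apply_comb[OF linear_ip_left])

lemma tang_comb [simp]: "tang \<epsilon> F (comb F c) = comb F c"
  by (simp add: tang_def)

lemma nor_comb [simp]: "nor \<epsilon> F (comb F c) = 0"
  by (simp add: nor_def)

lemma nor_frame [simp]: "nor \<epsilon> F (F i) = 0"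
  using nor_comb[of "axis i 1"] by simp

lemma dual_eq_0:
  assumes "\<And>i. ip \<epsilon> (F i) v = 0"
  shows "dual \<epsilon> F v = 0"
proof -
  have "(\<chi> j. ip \<epsilon> (F j) v) = 0" by (simp add: vec_eq_iff assms)
  then show ?thesis by (simp add: dual_def)
qed

lemma nor_eq_self: "(\<And>i. ip \<epsilon> (F i) v = 0) \<Longrightarrow> nor \<epsilon> F v = v"
  by (simp add: nor_def tang_def dual_eq_0)

lemma nor_nor [simp]: "nor \<epsilon> F (nor \<epsilon> F v) = nor \<epsilon> F v"
  by (simp add: nor_eq_self)

lemma tang_plus_nor: "tang \<epsilon> F v + nor \<epsilon> F v = v"
  by (simp add: nor_def)

text \<open>A vector orthogonal to the frame is its own normal part. This splits the vanishing of
  the derivative of \<open>W\<close> into a tangential and a normal equation.\<close>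

lemma eq_0_iff_nor: "v = 0 \<longleftrightarrow> (\<forall>i. ip \<epsilon> (F i) v = 0) \<and> nor \<epsilon> F v = 0"
  using nor_eq_self[of v] by (auto simp: ip_simps nor_simps)

lemma ip_comb: "ip \<epsilon> (comb F c) v = 0" if "\<And>i. ip \<epsilon> (F i) v = 0"
  by (simp add: linear_apply_comb[OF linear_ip_left] that)

lemma perp_range: "perp \<epsilon> (range (comb F)) = {v. \<forall>i. ip \<epsilon> (F i) v = 0}"
proof (intro set_eqI iffI)
  fix v assume v: "v \<in> perp \<epsilon> (range (comb F))"
  have "ip \<epsilon> v (comb F (axis i 1)) = 0" for i using v unfolding perp_def by blast
  then show "v \<in> {v. \<forall>i. ip \<epsilon> (F i) v = 0}" by (simp add: ip_commute[of \<epsilon> "F _" v])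
next
  fix v assume "v \<in> {v. \<forall>i. ip \<epsilon> (F i) v = 0}"
  then have "ip \<epsilon> v (comb F c) = 0" for c
    using ip_comb[of v c] by (simp add: ip_commute[of \<epsilon> v])
  then show "v \<in> perp \<epsilon> (range (comb F))" by (auto simp: perp_def)
qed

lemma perp_plane: "perp \<epsilon> (plane (oriented_span F)) = {v. \<forall>i. ip \<epsilon> (F i) v = 0}"
  by (simp add: plane_oriented_span perp_range)

lemma normal_part_eq: "normal_part \<epsilon> (range (comb F)) v = nor \<epsilon> F v"
  unfolding normal_part_def perp_range
proof (rule the_equality)
  show "nor \<epsilon> F v \<in> {v. \<forall>i. ip \<epsilon> (F i) v = 0} \<and> v - nor \<epsilon> F v \<in> range (comb F)"
    by (simp add: nor_def[of \<epsilon> F v, symmetric]) (simp add: nor_def tang_def)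
next
  fix w assume w: "w \<in> {v. \<forall>i. ip \<epsilon> (F i) v = 0} \<and> v - w \<in> range (comb F)"
  then obtain c where c: "v - w = comb F c" by auto
  have "nor \<epsilon> F w = w" using w by (intro nor_eq_self) auto
  moreover have "v = w + comb F c" using c by (simp add: algebra_simps)
  ultimately show "w = nor \<epsilon> F v" by (simp add: nor_simps)
qed

lemma hom_perp_iff:
  "L \<in> hom_perp \<epsilon> (oriented_span F) \<longleftrightarrow>
    (\<forall>v i. ip \<epsilon> (F i) (blinfun_apply L v) = 0) \<and>
    (\<forall>v. (\<forall>i. ip \<epsilon> (F i) v = 0) \<longrightarrow> blinfun_apply L v = 0)"
  by (auto simp: hom_perp_def perp_plane)

lemma hom_perp_eqI:
  assumes "L \<in> hom_perp \<epsilon> (oriented_span F)" "K \<in> hom_perp \<epsilon> (oriented_span F)"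
    and "\<And>i. blinfun_apply L (F i) = blinfun_apply K (F i)"
  shows "L = K"
proof (rule blinfun_eqI)
  fix v
  have "blinfun_apply L (comb F c) = blinfun_apply K (comb F c)" for c
    by (simp add: linear_apply_comb[OF linear_blinfun_apply] assms(3))
  moreover have "blinfun_apply L (nor \<epsilon> F v) = 0" "blinfun_apply K (nor \<epsilon> F v) = 0"
    using assms(1,2) by (auto simp: hom_perp_iff)
  ultimately have "blinfun_apply L (tang \<epsilon> F v + nor \<epsilon> F v) = blinfun_apply K (tang \<epsilon> F v + nor \<epsilon> F v)"
    by (simp add: blinfun.add_right tang_def)
  then show "blinfun_apply L v = blinfun_apply K v" by (simp add: tang_plus_nor)
qed

lemma blin_in_hom_perp:
  assumes "\<And>i j. ip \<epsilon> (F i) (l j) = 0"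
  shows "blin \<epsilon> F l \<in> hom_perp \<epsilon> (oriented_span F)"
  by (simp add: hom_perp_iff linear_apply_comb[OF linear_ip_right] assms dual_eq_0)

lemma blin_eq_iff: "blin \<epsilon> F l = blin \<epsilon> F l' \<longleftrightarrow> l = l'"
proof
  assume eq: "blin \<epsilon> F l = blin \<epsilon> F l'"
  show "l = l'"
    using arg_cong[OF eq, of "\<lambda>L. blinfun_apply L (F i)" for i] by (simp add: fun_eq_iff)
qed simp

text \<open>Gram-Schmidt, carried out on the rows of the coefficient matrix. Rows outside I are
  unconstrained, and in the induction step the rows already treated are fewer than n, so they do not
  span and leave a vector \<open>c\<close> to be orthonormalised.\<close>

lemma ex_orthonormal_on:
  "\<exists>a :: real^'n^'n. \<forall>i\<in>I. \<forall>j\<in>I. ip \<epsilon> (mact a F i) (mact a F j) = (if i = j then 1 else 0)"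
  (is "\<exists>a. ?P a I")
  using finite[of I]
proof (induction I rule: finite_induct)
  case (insert i I)
  then obtain a where a: "?P a I" by auto
  have "card ((\<lambda>j. a $ j) ` I) \<le> card I" by (rule card_image_le) simp
  also have "card I < card (insert i I)" using insert by simp
  also have "\<dots> \<le> CARD('n)" by (rule card_mono) auto
  finally have "card ((\<lambda>j. a $ j) ` I) < CARD('n)" .
  then have "dim (span ((\<lambda>j. a $ j) ` I)) \<noteq> DIM(real^'n)"
    using dim_le_card[of "(\<lambda>j. a $ j) ` I" "(\<lambda>j. a $ j) ` I"] by (auto simp: span_superset)
  then have "span ((\<lambda>j. a $ j) ` I) \<noteq> UNIV" using dim_UNIV by metis
  then obtain c where c: "c \<notin> span ((\<lambda>j. a $ j) ` I)" by auto
  define d where "d = c - (\<Sum>j\<in>I. ip \<epsilon> (comb F c) (mact a F j) *\<^sub>R a $ j)"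
  have "(\<Sum>j\<in>I. ip \<epsilon> (comb F c) (mact a F j) *\<^sub>R a $ j) \<in> span ((\<lambda>j. a $ j) ` I)"
    by (intro span_sum span_scale span_base) auto
  with c have "d \<noteq> 0" by (auto simp: d_def)
  have orth: "ip \<epsilon> (comb F d) (mact a F j) = 0" if "j \<in> I" for j
  proof -
    have "comb F d = comb F c - (\<Sum>j\<in>I. ip \<epsilon> (comb F c) (mact a F j) *\<^sub>R mact a F j)"
      by (simp add: d_def comb_diff_right linear_sum[OF linear_comb] comb_scaleR_right mact_def)
    also have "ip \<epsilon> \<dots> (mact a F j) = ip \<epsilon> (comb F c) (mact a F j)
        - (\<Sum>k\<in>I. ip \<epsilon> (comb F c) (mact a F k) * (if k = j then 1 else 0))"
      using a that by (simp add: ip_simps linear_sum[OF linear_ip_left])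
    also have "\<dots> = 0"
      using that insert.hyps(1) by (simp add: if_distrib[of "\<lambda>x. _ * x"] cong: if_cong)
    finally show ?thesis .
  qed
  define r where "r = sqrt (ip \<epsilon> (comb F d) (comb F d))"
  have r: "r > 0" "r * r = ip \<epsilon> (comb F d) (comb F d)"
    using comb_pos[OF \<open>d \<noteq> 0\<close>] by (simp_all add: r_def)
  define a' where "a' = (\<chi> j. if j = i then (1 / r) *\<^sub>R d else a $ j)"
  have new: "mact a' F j = (if j = i then (1 / r) *\<^sub>R comb F d else mact a F j)" for j
    by (simp add: mact_def a'_def comb_scaleR_right)
  have "?P a' (insert i I)"
    using a orth r insert.hyps(2)
    by (auto simp: new ip_simps ip_commute[of \<epsilon> "mact a F _" "comb F d"] field_simps)
  then show ?case by (rule exI)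
qed auto

lemma gram_mact: "gram \<epsilon> (mact a F) = a ** gram \<epsilon> F ** transpose a"
proof -
  have "(a ** (gram \<epsilon> F ** transpose a)) $ i $ j = ip \<epsilon> (mact a F i) (mact a F j)" for i j
  proof -
    have "(gram \<epsilon> F ** transpose a) $ k $ j = (gram \<epsilon> F *v (a $ j)) $ k" for k
      by (simp add: matrix_matrix_mult_def matrix_vector_mult_def transpose_def)
    then show ?thesis
      by (simp add: gram_mult matrix_matrix_mult_def mact_def
          linear_apply_comb[OF linear_ip_left[of \<epsilon> "comb F (a $ j)"], of F "a $ i"])
        (simp add: comb_def[of "\<lambda>i. ip \<epsilon> (F i) (comb F (a $ j))"])
  qed
  then show ?thesis by (simp add: vec_eq_iff gram_def matrix_mul_assoc)
qed

text \<open>Reversing one vector of an orthonormal frame keeps it orthonormal and changes its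
  orientation, so one of the two frames lies in \<open>oriented_span F\<close>.\<close>

lemma ex_orthonormal:
  "\<exists>e\<in>oriented_span F. \<forall>i j. ip \<epsilon> (e i) (e j) = (if i = j then 1 else 0)"
proof -
  obtain a :: "real^'n^'n" where a: "\<And>i j. ip \<epsilon> (mact a F i) (mact a F j) = (if i = j then 1 else 0)"
    using ex_orthonormal_on[of UNIV] by auto
  have "gram \<epsilon> (mact a F) = mat 1" by (simp add: vec_eq_iff gram_def mat_def a)
  then have "a ** (gram \<epsilon> F ** transpose a) = mat 1" by (simp add: gram_mact matrix_mul_assoc)
  then have "det a \<noteq> 0" by (metis det_I det_mul mult_zero_left zero_neq_one)
  then consider "det a > 0" | "det a < 0" by linarith
  then show ?thesis
  proof cases
    case 1
    then have "mact a F \<in> oriented_span F" by (auto simp: oriented_span_eq)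
    with a show ?thesis by blast
  next
    case 2
    fix k :: 'n
    define a' where "a' = (\<chi> i. if i = k then (-1) *s (a $ i) else a $ i)"
    have "det a' = (-1) * det (\<chi> i. if i = k then a $ i else a $ i)"
      unfolding a'_def by (rule det_row_mul)
    then have "det a' > 0" using 2 by simp
    then have "mact a' F \<in> oriented_span F" by (auto simp: oriented_span_eq)
    moreover have "mact a' F j = (if j = k then - mact a F j else mact a F j)" for j
      by (simp add: mact_def a'_def scalar_mult_eq_scaleR comb_minus_right)
    then have "ip \<epsilon> (mact a' F i) (mact a' F j) = (if i = j then 1 else 0)" for i j
      using a by (auto simp: ip_simps)
    ultimately show ?thesis by blast
  qed
qed

text \<open>For the orthonormal \<open>e = mact a F\<close> picked by the definition,
  \<open>a ** gram \<epsilon> F ** transpose a = mat 1\<close> gives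
  \<open>matrix_inv (gram \<epsilon> F) = transpose a ** a\<close>, so the sum over e is a trace in
  the frame F, independent of the choice of e.\<close>

lemma grass_metric_eq:
  "grass_metric \<epsilon> (oriented_span F) \<phi> \<psi> = \<epsilon> * (\<Sum>i\<in>UNIV. \<Sum>j\<in>UNIV.
    matrix_inv (gram \<epsilon> F) $ i $ j * ip \<epsilon> (blinfun_apply \<phi> (F i)) (blinfun_apply \<psi> (F j)))"
proof -
  define e where "e = (SOME e. e \<in> oriented_span F \<and> (\<forall>i j. ip \<epsilon> (e i) (e j) = (if i = j then 1 else 0)))"
  have "\<exists>e. e \<in> oriented_span F \<and> (\<forall>i j. ip \<epsilon> (e i) (e j) = (if i = j then 1 else 0))"
    using ex_orthonormal by auto
  from someI_ex[OF this] have e: "e \<in> oriented_span F"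
    "\<And>i j. ip \<epsilon> (e i) (e j) = (if i = j then 1 else 0)" unfolding e_def by blast+
  then obtain a where a: "e = mact a F" by (auto simp: oriented_span_eq)
  have "gram \<epsilon> e = mat 1" by (simp add: vec_eq_iff gram_def mat_def e(2))
  then have "a ** (gram \<epsilon> F ** transpose a) = mat 1" by (simp add: a gram_mact matrix_mul_assoc)
  then have "gram \<epsilon> F ** transpose a ** a = mat 1" using matrix_left_right_inverse by blast
  then have inv: "matrix_inv (gram \<epsilon> F) = transpose a ** a"
    by (intro matrix_inv_unique) (simp add: matrix_mul_assoc)
  have "ip \<epsilon> (blinfun_apply \<phi> (e k)) (blinfun_apply \<psi> (e k)) = (\<Sum>i\<in>UNIV. \<Sum>j\<in>UNIV.
      a $ k $ i * a $ k $ j * ip \<epsilon> (blinfun_apply \<phi> (F i)) (blinfun_apply \<psi> (F j)))" for k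
    by (simp add: a mact_def linear_apply_comb[OF linear_blinfun_apply])
      (simp add: comb_def linear_sum[OF linear_ip_left] linear_sum[OF linear_ip_right] ip_simps sum_distrib_left mult.assoc,
        subst sum.swap, simp add: mult.left_commute)
  then have "(\<Sum>k\<in>UNIV. ip \<epsilon> (blinfun_apply \<phi> (e k)) (blinfun_apply \<psi> (e k))) =
    (\<Sum>k\<in>UNIV. \<Sum>i\<in>UNIV. \<Sum>j\<in>UNIV.
      a $ k $ i * a $ k $ j * ip \<epsilon> (blinfun_apply \<phi> (F i)) (blinfun_apply \<psi> (F j)))" by simp
  also have "\<dots> = (\<Sum>i\<in>UNIV. \<Sum>k\<in>UNIV. \<Sum>j\<in>UNIV.
      a $ k $ i * a $ k $ j * ip \<epsilon> (blinfun_apply \<phi> (F i)) (blinfun_apply \<psi> (F j)))"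
    by (rule sum.swap)
  also have "\<dots> = (\<Sum>i\<in>UNIV. \<Sum>j\<in>UNIV. \<Sum>k\<in>UNIV.
      a $ k $ i * a $ k $ j * ip \<epsilon> (blinfun_apply \<phi> (F i)) (blinfun_apply \<psi> (F j)))"
    by (intro sum.cong refl sum.swap)
  also have "\<dots> = (\<Sum>i\<in>UNIV. \<Sum>j\<in>UNIV.
      matrix_inv (gram \<epsilon> F) $ i $ j * ip \<epsilon> (blinfun_apply \<phi> (F i)) (blinfun_apply \<psi> (F j)))"
    by (simp add: inv matrix_matrix_mult_def transpose_def sum_distrib_right)
  finally show ?thesis unfolding grass_metric_def e_def[symmetric] Let_def by simp
qed

lemma transpose_gram_inv: "transpose (matrix_inv (gram \<epsilon> F)) = matrix_inv (gram \<epsilon> F)"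
proof -
  have "transpose (gram \<epsilon> F) = gram \<epsilon> F" by (simp add: vec_eq_iff transpose_def gram_def ip_commute)
  then have "gram \<epsilon> F ** transpose (matrix_inv (gram \<epsilon> F)) = mat 1"
    using matrix_inv_mult(1)[OF det_gram] by (metis matrix_transpose_mul transpose_mat)
  then show ?thesis using matrix_inv_unique by metis
qed

lemma gram_inv_sym: "matrix_inv (gram \<epsilon> F) $ i $ j = matrix_inv (gram \<epsilon> F) $ j $ i"
proof -
  have "transpose (matrix_inv (gram \<epsilon> F)) $ j $ i = matrix_inv (gram \<epsilon> F) $ j $ i"
    by (simp only: transpose_gram_inv)
  then show ?thesis by (simp add: transpose_def)
qed

end

section \<open>Derivatives of projections along a moving frame\<close>

lemma has_derivative_gram:
  assumes "\<And>i. ((\<lambda>q. f q i) has_derivative (\<lambda>u. f' u i)) (at p)"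
  shows "((\<lambda>q. gram \<epsilon> (f q)) has_derivative
    (\<lambda>u. \<chi> i j. ip \<epsilon> (f p i) (f' u j) + ip \<epsilon> (f' u i) (f p j))) (at p)"
  unfolding has_derivative_matrix_nth_iff gram_def
  by (auto intro!: bounded_bilinear.FDERIV[OF bounded_bilinear_ip] assms)

text \<open>Product rule for w minus its tangential part. The derivative D of the coordinates stays
  unspecified: it enters through \<open>comb (f p) (D u)\<close>, a tangential vector, which drops
  out wherever normal components are taken.\<close>

lemma has_derivative_dual_nor:
  assumes "spacelike_frame \<epsilon> (f p)"
    and f: "\<And>i. ((\<lambda>q. f q i) has_derivative (\<lambda>u. f' u i)) (at p)"
    and w: "(w has_derivative w') (at p)"
  shows "\<exists>D. ((\<lambda>q. dual \<epsilon> (f q) (w q)) has_derivative D) (at p) \<and>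
    ((\<lambda>q. nor \<epsilon> (f q) (w q)) has_derivative
      (\<lambda>u. w' u - (comb (f p) (D u) + comb (f' u) (dual \<epsilon> (f p) (w p))))) (at p)"
proof -
  interpret spacelike \<epsilon> "f p" by unfold_locales fact
  have "((\<lambda>q. \<chi> j. ip \<epsilon> (f q j) (w q)) has_derivative
      (\<lambda>u. \<chi> j. ip \<epsilon> (f p j) (w' u) + ip \<epsilon> (f' u j) (w p))) (at p)"
    unfolding has_derivative_vec_nth_iff
    by (auto intro!: bounded_bilinear.FDERIV[OF bounded_bilinear_ip] f w)
  from bounded_bilinear.FDERIV[OF bounded_bilinear_matrix_vector_mult
      has_derivative_matrix_inv[OF has_derivative_gram[OF f] det_gram] this]
  obtain D where D: "((\<lambda>q. dual \<epsilon> (f q) (w q)) has_derivative D) (at p)"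
    unfolding dual_def by blast
  show ?thesis
    by (intro exI[of _ D] conjI D) (unfold nor_def tang_def,
      intro has_derivative_diff has_derivative_comb f w D)
qed

text \<open>The quadratic form of the Gram matrix at p has a positive minimum m on the compact unit
  sphere. If all n^2 entries move by less than m / n^2, the form changes there by less than m and
  stays positive; homogeneity extends this to all c.\<close>

lemma eventually_spacelike_frame:
  assumes "spacelike_frame \<epsilon> (f p)" and f: "\<And>i. ((\<lambda>q. f q i) \<longlongrightarrow> f p i) (nhds p)"
  shows "\<forall>\<^sub>F q in nhds p. spacelike_frame \<epsilon> (f q :: ('n::finite, 'k::finite) frame)"
proof -
  interpret spacelike \<epsilon> "f p" by unfold_locales fact
  define Q where "Q = (\<lambda>q c. ip \<epsilon> (comb (f q) c) (comb (f q) c))"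
  have Q: "Q q c = (\<Sum>i\<in>UNIV. \<Sum>j\<in>UNIV. c $ i * c $ j * ip \<epsilon> (f q i) (f q j))" for q c
    by (simp add: Q_def comb_def linear_sum[OF linear_ip_left] linear_sum[OF linear_ip_right]
        ip_simps sum_distrib_left mult.assoc, subst sum.swap, simp add: mult.left_commute)
  have "compact (sphere (0::real^'n) 1)" by (rule compact_sphere)
  moreover have "sphere (0::real^'n) 1 \<noteq> {}" by (simp add: sphere_eq_empty)
  moreover have "continuous_on (sphere (0::real^'n) 1) (Q p)"
    unfolding Q by (intro continuous_intros)
  ultimately have "\<exists>c0\<in>sphere 0 1. \<forall>c\<in>sphere 0 1. Q p c0 \<le> Q p c"
    by (rule continuous_attains_inf)
  then obtain c0 where c0: "c0 \<in> sphere 0 1" "\<And>c. c \<in> sphere 0 1 \<Longrightarrow> Q p c0 \<le> Q p c" by auto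
  define m where "m = Q p c0"
  have "c0 \<noteq> 0" using c0(1) by auto
  then have m: "m > 0" using comb_pos by (simp add: m_def Q_def)
  define N where "N = real (CARD('n) * CARD('n))"
  have N: "N > 0" by (simp add: N_def)
  have "((\<lambda>q. ip \<epsilon> (f q i) (f q j)) \<longlongrightarrow> ip \<epsilon> (f p i) (f p j)) (nhds p)" for i j
    by (intro bounded_bilinear.tendsto[OF bounded_bilinear_ip] f)
  from tendstoD[OF this, of "m / N"] m N
  have "\<forall>\<^sub>F q in nhds p. dist (ip \<epsilon> (f q i) (f q j)) (ip \<epsilon> (f p i) (f p j)) < m / N" for i j
    by simp
  then have "\<forall>\<^sub>F q in nhds p. \<forall>i j. dist (ip \<epsilon> (f q i) (f q j)) (ip \<epsilon> (f p i) (f p j)) < m / N"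
    by (simp add: eventually_all_finite)
  then show ?thesis
  proof eventually_elim
    case (elim q)
    have unit: "Q q c > 0" if "norm c = 1" for c
    proof -
      have le1: "\<bar>c $ i\<bar> \<le> 1" for i using component_le_norm_cart[of c i] that by simp
      have "Q p c - Q q c = (\<Sum>i\<in>UNIV. \<Sum>j\<in>UNIV. c $ i * c $ j * (ip \<epsilon> (f p i) (f p j) - ip \<epsilon> (f q i) (f q j)))"
        by (simp add: Q algebra_simps sum_subtractf)
      also have "\<dots> < (\<Sum>i\<in>(UNIV::'n set). \<Sum>j\<in>(UNIV::'n set). m / N)"
      proof (intro sum_strict_mono)
        fix i j
        have "c $ i * c $ j * (ip \<epsilon> (f p i) (f p j) - ip \<epsilon> (f q i) (f q j))
            \<le> \<bar>c $ i\<bar> * \<bar>c $ j\<bar> * \<bar>ip \<epsilon> (f p i) (f p j) - ip \<epsilon> (f q i) (f q j)\<bar>"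
          by (metis abs_ge_self abs_mult)
        also have "\<dots> \<le> 1 * 1 * \<bar>ip \<epsilon> (f p i) (f p j) - ip \<epsilon> (f q i) (f q j)\<bar>"
          by (intro mult_right_mono mult_mono le1) auto
        also have "\<dots> < m / N" using elim by (simp add: dist_real_def abs_minus_commute)
        finally show "c $ i * c $ j * (ip \<epsilon> (f p i) (f p j) - ip \<epsilon> (f q i) (f q j)) < m / N" .
      qed auto
      also have "\<dots> = m" by (simp add: N_def)
      finally show ?thesis using c0(2)[of c] that by (simp add: m_def)
    qed
    have "Q q c > 0" if "c \<noteq> 0" for c
    proof -
      have "Q q c = (norm c)\<^sup>2 * Q q ((1 / norm c) *\<^sub>R c)"
        using that by (simp add: Q_def comb_scaleR_right ip_simps power2_eq_square)
      with unit[of "(1 / norm c) *\<^sub>R c"] that show ?thesis by simp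
    qed
    then show ?case by (simp add: spacelike_frame_def Q_def comb_def)
  qed
qed


section \<open>Graph coordinates on the Grassmannian\<close>

text \<open>The values on the frame \<open>F\<close> of the linear map whose graph over the span of \<open>F\<close> is the span
  of \<open>f\<close>.\<close>

definition slope ::
  "real \<Rightarrow> ('n::finite, 'k::finite) frame \<Rightarrow> ('n, 'k) frame \<Rightarrow> ('n, 'k) frame" where
  "slope \<epsilon> F f = mact (matrix_inv (\<chi> i. dual \<epsilon> F (f i))) (\<lambda>i. nor \<epsilon> F (f i))"

lemma graph_oriented_span:
  "graph (oriented_span F) L = oriented_span (\<lambda>i. F i + blinfun_apply L (F i))"
proof -
  have "(\<lambda>i. mact a F i + blinfun_apply L (mact a F i)) = mact a (\<lambda>i. F i + blinfun_apply L (F i))" for a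
    by (simp add: fun_eq_iff mact_add_right linear_apply_mact[OF linear_blinfun_apply])
  then show ?thesis by (simp add: graph_def oriented_span_eq setcompr_eq_image image_image)
qed

context spacelike
begin

lemma slope_self: "slope \<epsilon> F F = (\<lambda>i. 0)"
  by (simp add: slope_def)

lemma slope_normal: "ip \<epsilon> (F i) (slope \<epsilon> F f j) = 0"
  by (simp add: slope_def mact_def linear_apply_comb[OF linear_ip_right])

text \<open>The frame F + L F of the common graph also has the form a F + K (a F). Since L and K
  take normal values, the tangential parts give a F = F, and then the normal parts give L = K on the
  frame.\<close>

lemma inj_on_graph: "inj_on (graph (oriented_span F)) (hom_perp \<epsilon> (oriented_span F))"
proof (rule inj_onI)
  fix L K
  assume LK: "L \<in> hom_perp \<epsilon> (oriented_span F)" "K \<in> hom_perp \<epsilon> (oriented_span F)"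
    and eq: "graph (oriented_span F) L = graph (oriented_span F) K"
  have "(\<lambda>i. F i + blinfun_apply L (F i)) \<in> graph (oriented_span F) L"
    unfolding graph_oriented_span by (rule oriented_span_self)
  then obtain a where "(\<lambda>i. F i + blinfun_apply L (F i)) = (\<lambda>i. mact a F i + blinfun_apply K (mact a F i))"
    unfolding eq by (auto simp: graph_def oriented_span_eq)
  then have a: "F i + blinfun_apply L (F i) = mact a F i + blinfun_apply K (mact a F i)" for i
    by (rule fun_cong)
  have tangL: "tang \<epsilon> F (blinfun_apply L v) = 0" "tang \<epsilon> F (blinfun_apply K v) = 0" for v
    using LK by (simp_all add: hom_perp_iff tang_def dual_eq_0)
  have "tang \<epsilon> F (mact a F i) = mact a F i" for i by (simp add: mact_def)
  moreover have "tang \<epsilon> F (F i) = F i" for i using tang_comb[of "axis i 1"] by simp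
  ultimately have "mact a F i = F i" for i
    using arg_cong[OF a, of "tang \<epsilon> F" i] by (simp add: linear_add[OF linear_tang] tangL)
  with a have "blinfun_apply L (F i) = blinfun_apply K (F i)" for i by (metis add_left_cancel)
  with LK show "L = K" by (rule hom_perp_eqI)
qed

text \<open>The determinant condition says that orthogonal projection maps the span of f onto that
  of F preserving orientations. The oriented span of f then has a frame whose projection is F
  itself, with the slope as normal part, and injectivity of \<open>graph\<close> identifies the
  coordinate.\<close>

lemma graph_coord_eq:
  assumes f: "spacelike_frame \<epsilon> f" and det: "det (\<chi> i. dual \<epsilon> F (f i)) > 0"
  shows "graph_coord \<epsilon> (oriented_span F) (oriented_span f) = blin \<epsilon> F (slope \<epsilon> F f)"
proof -
  define a where "a = (\<chi> i. dual \<epsilon> F (f i))"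
  have det_a: "det a \<noteq> 0" "det a > 0" using det by (simp_all add: a_def)
  have mem: "blin \<epsilon> F (slope \<epsilon> F f) \<in> hom_perp \<epsilon> (oriented_span F)"
    by (rule blin_in_hom_perp) (rule slope_normal)
  have F: "F = mact (matrix_inv a) (\<lambda>i. tang \<epsilon> F (f i))"
  proof -
    have "(\<lambda>i. tang \<epsilon> F (f i)) = mact a F" by (simp add: tang_def mact_def a_def fun_eq_iff)
    then show ?thesis by (simp add: mact_mult[symmetric] matrix_inv_mult[OF det_a(1)])
  qed
  have "F i + slope \<epsilon> F f i = mact (matrix_inv a) f i" for i
  proof -
    have "F i + slope \<epsilon> F f i
        = mact (matrix_inv a) (\<lambda>i. tang \<epsilon> F (f i)) i + mact (matrix_inv a) (\<lambda>i. nor \<epsilon> F (f i)) i"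
      using fun_cong[OF F, of i] by (simp add: slope_def a_def)
    then show ?thesis by (simp add: mact_add_right[symmetric] tang_plus_nor)
  qed
  then have "graph (oriented_span F) (blin \<epsilon> F (slope \<epsilon> F f)) = oriented_span (mact (matrix_inv a) f)"
    by (simp add: graph_oriented_span)
  also have "\<dots> = oriented_span f"
  proof (rule oriented_span_mact)
    have "det (matrix_inv a) * det a = 1"
      using matrix_inv_mult(1)[OF det_a(1)] by (metis det_I det_mul)
    then show "det (matrix_inv a) > 0" using det_a by (metis zero_less_mult_pos2 zero_less_one)
  qed
  finally have graph: "graph (oriented_span F) (blin \<epsilon> F (slope \<epsilon> F f)) = oriented_span f" .
  moreover have "oriented_span f \<in> grassmannian \<epsilon>" using f by (auto simp: grassmannian_def)
  ultimately show ?thesis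
    unfolding graph_coord_def
    by (intro inv_into_f_eq inj_on_subset[OF inj_on_graph]) (use mem in auto)
qed

text \<open>Obtained by differentiating \<open>a S = N f\<close>, where \<open>S\<close> is the slope, \<open>N\<close> the normal projection
  and \<open>a\<close> the matrix of coordinates of the tangential part of \<open>f\<close>.\<close>

lemma has_derivative_slope:
  assumes f: "\<And>i. ((\<lambda>q. f q i) has_derivative (\<lambda>u. f' u i)) (at p)"
    and det: "det (\<chi> i. dual \<epsilon> F (f p i)) \<noteq> 0"
  shows "((\<lambda>q. slope \<epsilon> F (f q) j) has_derivative
    (\<lambda>u. mact (matrix_inv (\<chi> i. dual \<epsilon> F (f p i)))
      (\<lambda>i. nor \<epsilon> F (f' u i) - mact (\<chi> i. dual \<epsilon> F (f' u i)) (slope \<epsilon> F (f p)) i) j)) (at p)"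
proof -
  define a where "a = (\<lambda>q. \<chi> i. dual \<epsilon> F (f q i))"
  define a' where "a' = (\<lambda>u. \<chi> i. dual \<epsilon> F (f' u i))"
  have bl: "bounded_linear (dual \<epsilon> F)" "bounded_linear (nor \<epsilon> F)"
    using linear_dual linear_nor by (auto simp: linear_conv_bounded_linear)
  have "(a has_derivative a') (at p)"
    unfolding has_derivative_matrix_nth_iff a_def a'_def
    by (auto intro!: bounded_linear.has_derivative[OF bounded_linear_vec_nth]
        bounded_linear.has_derivative[OF bl(1)] f)
  from has_derivative_matrix_inv[OF this]
  have inv: "((\<lambda>q. matrix_inv (a q)) has_derivative
      (\<lambda>u. - (matrix_inv (a p) ** a' u ** matrix_inv (a p)))) (at p)"
    using det by (simp add: a_def)
  have "((\<lambda>q. nor \<epsilon> F (f q i)) has_derivative (\<lambda>u. nor \<epsilon> F (f' u i))) (at p)" for i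
    by (rule bounded_linear.has_derivative[OF bl(2) f])
  from has_derivative_mact[OF this inv]
  have "((\<lambda>q. slope \<epsilon> F (f q) j) has_derivative
      (\<lambda>u. mact (matrix_inv (a p)) (\<lambda>i. nor \<epsilon> F (f' u i)) j
        + mact (- (matrix_inv (a p) ** a' u ** matrix_inv (a p))) (\<lambda>i. nor \<epsilon> F (f p i)) j)) (at p)"
    by (simp add: slope_def a_def)
  moreover have "mact (- (matrix_inv (a p) ** a' u ** matrix_inv (a p))) (\<lambda>i. nor \<epsilon> F (f p i)) j
      = - mact (matrix_inv (a p)) (mact (a' u) (slope \<epsilon> F (f p))) j" for u
    by (simp add: mact_minus_left mact_mult slope_def a_def)
  ultimately show ?thesis
    by (simp add: mact_diff_right a_def a'_def)
qed

lemma eventually_det_dual_pos: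
  assumes "\<And>i. ((\<lambda>q. f q i) \<longlongrightarrow> f p i) (nhds p)" "det (\<chi> i. dual \<epsilon> F (f p i)) > 0"
  shows "\<forall>\<^sub>F q in nhds p. det (\<chi> i. dual \<epsilon> F (f q i)) > 0"
proof -
  have bl: "bounded_linear (dual \<epsilon> F)"
    using linear_dual by (auto simp: linear_conv_bounded_linear)
  have "((\<lambda>q. det (\<chi> i. dual \<epsilon> F (f q i))) \<longlongrightarrow> det (\<chi> i. dual \<epsilon> F (f p i))) (nhds p)"
    unfolding det_def
    by (auto intro!: tendsto_intros bounded_linear.tendsto[OF bl] assms(1))
  then show ?thesis by (rule order_tendstoD(1)) (rule assms(2))
qed

lemma has_derivative_graph_coord:
  assumes f: "\<And>i. ((\<lambda>q. f q i) has_derivative (\<lambda>u. f' u i)) (at p)"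
    and sp: "spacelike_frame \<epsilon> (f p)" and det: "det (\<chi> i. dual \<epsilon> F (f p i)) > 0"
  shows "((\<lambda>q. graph_coord \<epsilon> (oriented_span F) (oriented_span (f q))) has_derivative
    (\<lambda>u. blin \<epsilon> F (mact (matrix_inv (\<chi> i. dual \<epsilon> F (f p i)))
      (\<lambda>i. nor \<epsilon> F (f' u i) - mact (\<chi> i. dual \<epsilon> F (f' u i)) (slope \<epsilon> F (f p)) i)))) (at p)"
proof -
  have tend: "((\<lambda>q. f q i) \<longlongrightarrow> f p i) (nhds p)" for i by (rule tendsto_nhds_of_has_derivative[OF f])
  have "\<forall>\<^sub>F q in nhds p. graph_coord \<epsilon> (oriented_span F) (oriented_span (f q)) = blin \<epsilon> F (slope \<epsilon> F (f q))"
    using eventually_spacelike_frame[of \<epsilon> f p, OF sp tend] eventually_det_dual_pos[of f p, OF tend det]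
    by eventually_elim (rule graph_coord_eq)
  moreover have "((\<lambda>q. blin \<epsilon> F (slope \<epsilon> F (f q))) has_derivative
    (\<lambda>u. blin \<epsilon> F (mact (matrix_inv (\<chi> i. dual \<epsilon> F (f p i)))
      (\<lambda>i. nor \<epsilon> F (f' u i) - mact (\<chi> i. dual \<epsilon> F (f' u i)) (slope \<epsilon> F (f p)) i)))) (at p)"
    using det by (intro has_derivative_blin has_derivative_slope f) auto
  ultimately show ?thesis by (rule has_derivative_cong_nhds[rotated])
qed

text \<open>At the centre the coordinate matrix is the identity and the slope is 0, so only the
  normal part of the velocity of the frame survives. Applied with the centre at other subspaces Q,
  this is also the identification of the tangent space there with
  \<open>hom_perp \<epsilon> Q\<close>.\<close>

lemma has_derivative_graph_coord_centre:
  assumes f: "\<And>i. ((\<lambda>q. f q i) has_derivative (\<lambda>u. f' u i)) (at p)" and F: "f p = F"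
  shows "((\<lambda>q. graph_coord \<epsilon> (oriented_span F) (oriented_span (f q))) has_derivative
    (\<lambda>u. blin \<epsilon> F (\<lambda>i. nor \<epsilon> F (f' u i)))) (at p)"
  using has_derivative_graph_coord[of f f' p, OF f] spacelike
  by (simp add: F matrix_axis matrix_inv_one slope_self)

section \<open>The metric of the Grassmannian to first order at the centre of a chart\<close>

lemma grass_chart_metric_eq:
  defines "f \<equiv> \<lambda>K i. F i + blinfun_apply K (F i)"
  assumes sp: "spacelike_frame \<epsilon> (f K)"
  shows "grass_chart_metric \<epsilon> (oriented_span F) K B B' = \<epsilon> * (\<Sum>i\<in>UNIV. \<Sum>j\<in>UNIV.
    matrix_inv (gram \<epsilon> (f K)) $ i $ j *
    ip \<epsilon> (nor \<epsilon> (f K) (blinfun_apply B (F i))) (nor \<epsilon> (f K) (blinfun_apply B' (F j))))"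
proof -
  interpret K: spacelike \<epsilon> "f K" by unfold_locales (rule sp)
  have "((\<lambda>K. f K i) has_derivative (\<lambda>u. blinfun_apply u (F i))) (at K)" for i
    unfolding f_def by (auto intro!: derivative_eq_intros simp: blinfun.zero_right)
  from K.has_derivative_graph_coord_centre[of f, OF this refl]
  have "dir_deriv (\<lambda>K'. graph_coord \<epsilon> (oriented_span (f K)) (oriented_span (f K'))) K B
      = blin \<epsilon> (f K) (\<lambda>i. nor \<epsilon> (f K) (blinfun_apply B (F i)))" for B
    by (rule dir_deriv_eqI)
  moreover have "graph (oriented_span F) K = oriented_span (f K)" for K
    by (simp add: graph_oriented_span f_def)
  ultimately show ?thesis
    by (simp add: grass_chart_metric_def K.grass_metric_eq)
qed

text \<open>Two contributions, both zero. The first variation of the Gram matrix consists of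
  products of \<open>F i\<close> with normal vectors. The normal projection of the fixed normal
  vector B(F i) varies by a tangential vector, which is orthogonal to B'(F j).\<close>

lemma dir_deriv_grass_chart_metric:
  assumes hp: "B \<in> hom_perp \<epsilon> (oriented_span F)" "B' \<in> hom_perp \<epsilon> (oriented_span F)"
    "Z \<in> hom_perp \<epsilon> (oriented_span F)"
  shows "dir_deriv (\<lambda>K. grass_chart_metric \<epsilon> (oriented_span F) K B B') 0 Z = 0"
proof -
  define f where "f = (\<lambda>K i. F i + blinfun_apply K (F i))"
  have f0: "f 0 = F" by (simp add: f_def fun_eq_iff blinfun.zero_left)
  have f: "((\<lambda>K. f K i) has_derivative (\<lambda>u. blinfun_apply u (F i))) (at 0)" for i
    unfolding f_def by (auto intro!: derivative_eq_intros simp: blinfun.zero_right)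
  have "\<forall>\<^sub>F K in nhds 0. spacelike_frame \<epsilon> (f K)"
    by (intro eventually_spacelike_frame tendsto_nhds_of_has_derivative[OF f]) (simp add: f0 spacelike)
  then have ev: "\<forall>\<^sub>F K in nhds 0. grass_chart_metric \<epsilon> (oriented_span F) K B B'
      = \<epsilon> * (\<Sum>i\<in>UNIV. \<Sum>j\<in>UNIV. matrix_inv (gram \<epsilon> (f K)) $ i $ j *
          ip \<epsilon> (nor \<epsilon> (f K) (blinfun_apply B (F i))) (nor \<epsilon> (f K) (blinfun_apply B' (F j))))"
    by eventually_elim (simp add: grass_chart_metric_eq f_def)
  have n: "nor \<epsilon> F (blinfun_apply C v) = blinfun_apply C v" "dual \<epsilon> F (blinfun_apply C v) = 0"
    if "C \<in> hom_perp \<epsilon> (oriented_span F)" for C v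
    using that by (auto simp: hom_perp_iff intro: nor_eq_self dual_eq_0)
  have nd: "\<exists>D. ((\<lambda>K. nor \<epsilon> (f K) (blinfun_apply C (F i))) has_derivative (\<lambda>u. - comb F (D u))) (at 0)"
    if "C \<in> hom_perp \<epsilon> (oriented_span F)" for C i
    using has_derivative_dual_nor[of \<epsilon> f 0, OF _ f has_derivative_const[of "blinfun_apply C (F i)"]] spacelike n(2)[OF that]
    by (auto simp: f0)
  obtain D where D: "\<And>i. ((\<lambda>K. nor \<epsilon> (f K) (blinfun_apply B (F i))) has_derivative (\<lambda>u. - comb F (D i u))) (at 0)"
    using nd[OF hp(1)] by metis
  obtain D' where D': "\<And>i. ((\<lambda>K. nor \<epsilon> (f K) (blinfun_apply B' (F i))) has_derivative (\<lambda>u. - comb F (D' i u))) (at 0)"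
    using nd[OF hp(2)] by metis
  define G' where "G' = (\<lambda>u. (\<chi> i j. ip \<epsilon> (F i) (blinfun_apply u (F j)) + ip \<epsilon> (blinfun_apply u (F i)) (F j)) :: real^'n^'n)"
  have G: "((\<lambda>K. matrix_inv (gram \<epsilon> (f K))) has_derivative
      (\<lambda>u. - (matrix_inv (gram \<epsilon> F) ** G' u ** matrix_inv (gram \<epsilon> F)))) (at 0)"
    using has_derivative_matrix_inv[OF has_derivative_gram[of f _ 0, OF f]] det_gram by (simp add: f0 G'_def)
  have GZ: "G' Z = 0"
    using hp(3) by (simp add: G'_def vec_eq_iff hom_perp_iff ip_commute[of \<epsilon> "blinfun_apply Z _"])
  have ip0: "ip \<epsilon> (blinfun_apply C v) (comb F c) = 0" "ip \<epsilon> (comb F c) (blinfun_apply C v) = 0"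
    if "C \<in> hom_perp \<epsilon> (oriented_span F)" for C v c
    using ip_comb_nor(1)[of c "blinfun_apply C v"] ip_comb_nor(2)[of "blinfun_apply C v" c] by (simp_all add: n[OF that])
  have "((\<lambda>K. matrix_inv (gram \<epsilon> (f K)) $ i $ j *
          ip \<epsilon> (nor \<epsilon> (f K) (blinfun_apply B (F i))) (nor \<epsilon> (f K) (blinfun_apply B' (F j)))) has_derivative
        (\<lambda>u. matrix_inv (gram \<epsilon> (f 0)) $ i $ j *
          (ip \<epsilon> (nor \<epsilon> (f 0) (blinfun_apply B (F i))) (- comb F (D' j u)) + ip \<epsilon> (- comb F (D i u)) (nor \<epsilon> (f 0) (blinfun_apply B' (F j))))
          + (- (matrix_inv (gram \<epsilon> F) ** G' u ** matrix_inv (gram \<epsilon> F))) $ i $ j *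
          ip \<epsilon> (nor \<epsilon> (f 0) (blinfun_apply B (F i))) (nor \<epsilon> (f 0) (blinfun_apply B' (F j))))) (at 0)" for i j
    using G[unfolded has_derivative_matrix_nth_iff]
    by (intro has_derivative_mult bounded_bilinear.FDERIV[OF bounded_bilinear_ip] D D') auto
  from has_derivative_mult_right[OF has_derivative_sum[of UNIV, OF has_derivative_sum[of UNIV, OF this]]]
  show ?thesis
    unfolding dir_deriv_cong[OF ev]
    by (rule dir_deriv_eqI[THEN trans])
      (simp add: f0 n hp ip0 ip_simps GZ bounded_bilinear.zero_left[OF bounded_bilinear_matrix_mult]
        bounded_bilinear.zero_right[OF bounded_bilinear_matrix_mult])
qed

text \<open>At the centre the right-hand sides of the Koszul formula vanish, and nondegeneracy of
  the metric on \<open>hom_perp\<close> makes 0 the only solution.\<close>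

lemma christoffel_grass_centre:
  assumes hp: "B \<in> hom_perp \<epsilon> (oriented_span F)" "B' \<in> hom_perp \<epsilon> (oriented_span F)"
    and eps: "\<epsilon> \<noteq> 0"
  shows "christoffel (hom_perp \<epsilon> (oriented_span F)) (grass_chart_metric \<epsilon> (oriented_span F)) 0 B B' = 0"
proof -
  let ?S = "hom_perp \<epsilon> (oriented_span F)"
  have h0: "grass_chart_metric \<epsilon> (oriented_span F) 0 C C' = \<epsilon> * (\<Sum>i\<in>UNIV. \<Sum>j\<in>UNIV.
      matrix_inv (gram \<epsilon> F) $ i $ j * ip \<epsilon> (blinfun_apply C (F i)) (blinfun_apply C' (F j)))"
    if "C \<in> ?S" "C' \<in> ?S" for C C'
  proof -
    have "nor \<epsilon> F (blinfun_apply C v) = blinfun_apply C v" "nor \<epsilon> F (blinfun_apply C' v) = blinfun_apply C' v" for v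
      using that by (auto simp: hom_perp_iff intro: nor_eq_self)
    then show ?thesis
      using grass_chart_metric_eq[of 0 C C'] spacelike by (simp add: blinfun.zero_left)
  qed
  have zero: "0 \<in> ?S" by (simp add: hom_perp_iff blinfun.zero_left ip_simps)
  have nondeg: "C = 0" if C: "C \<in> ?S" and C0: "\<And>Z. Z \<in> ?S \<Longrightarrow> grass_chart_metric \<epsilon> (oriented_span F) 0 C Z = 0" for C
  proof (rule hom_perp_eqI[OF C zero])
    fix k
    have normal: "ip \<epsilon> (blinfun_apply C (F k)) (nor \<epsilon> F v) = 0" for v
    proof -
      \<comment> \<open>The factor \<open>gram \<epsilon> F $ j $ k\<close> cancels the inverse Gram
        matrix in the metric, so that testing C against this element isolates the value of C on
        \<open>F k\<close>.\<close>
      have Z: "blin \<epsilon> F (\<lambda>j. gram \<epsilon> F $ j $ k *\<^sub>R nor \<epsilon> F v) \<in> ?S"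
        by (rule blin_in_hom_perp) (simp add: ip_simps)
      have "0 = (\<Sum>i\<in>UNIV. \<Sum>j\<in>UNIV. matrix_inv (gram \<epsilon> F) $ i $ j *
          (gram \<epsilon> F $ j $ k * ip \<epsilon> (blinfun_apply C (F i)) (nor \<epsilon> F v)))"
        using C0[OF Z] h0[OF C Z] eps by (simp add: ip_simps)
      also have "\<dots> = (\<Sum>i\<in>UNIV. (matrix_inv (gram \<epsilon> F) ** gram \<epsilon> F) $ i $ k * ip \<epsilon> (blinfun_apply C (F i)) (nor \<epsilon> F v))"
        by (simp add: matrix_matrix_mult_def sum_distrib_right mult.assoc)
      also have "\<dots> = ip \<epsilon> (blinfun_apply C (F k)) (nor \<epsilon> F v)"
        by (simp add: matrix_inv_mult[OF det_gram] mat_def if_distrib[of "\<lambda>x. x * _"] cong: if_cong)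
      finally show ?thesis by simp
    qed
    have "nor \<epsilon> F (blinfun_apply C (F k)) = blinfun_apply C (F k)"
      using C by (auto simp: hom_perp_iff intro: nor_eq_self)
    then have tan: "ip \<epsilon> (blinfun_apply C (F k)) (tang \<epsilon> F v) = 0" for v
      using ip_comb_nor(2)[of "blinfun_apply C (F k)"] by (simp add: tang_def)
    have "ip \<epsilon> (blinfun_apply C (F k)) (tang \<epsilon> F v + nor \<epsilon> F v) = 0" for v
      by (simp only: ip_simps tan normal)
    then have "ip \<epsilon> (blinfun_apply C (F k)) v = 0" for v by (simp add: tang_plus_nor)
    then have "blinfun_apply C (F k) = 0" by (rule ip_nondegenerate[OF eps])
    then show "blinfun_apply C (F k) = blinfun_apply 0 (F k)" by (simp add: blinfun.zero_left)
  qed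
  show ?thesis
    unfolding christoffel_def
  proof (rule the_equality)
    show "0 \<in> ?S \<and> (\<forall>z\<in>?S. 2 * grass_chart_metric \<epsilon> (oriented_span F) 0 0 z =
      dir_deriv (\<lambda>p. grass_chart_metric \<epsilon> (oriented_span F) p B' z) 0 B
      + dir_deriv (\<lambda>p. grass_chart_metric \<epsilon> (oriented_span F) p B z) 0 B'
      - dir_deriv (\<lambda>p. grass_chart_metric \<epsilon> (oriented_span F) p B B') 0 z)"
      using zero hp by (simp add: dir_deriv_grass_chart_metric h0 blinfun.zero_left ip_simps)
  next
    fix w assume w: "w \<in> ?S \<and> (\<forall>z\<in>?S. 2 * grass_chart_metric \<epsilon> (oriented_span F) 0 w z =
      dir_deriv (\<lambda>p. grass_chart_metric \<epsilon> (oriented_span F) p B' z) 0 B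
      + dir_deriv (\<lambda>p. grass_chart_metric \<epsilon> (oriented_span F) p B z) 0 B'
      - dir_deriv (\<lambda>p. grass_chart_metric \<epsilon> (oriented_span F) p B B') 0 z)"
    then show "w = 0"
      using hp by (intro nondeg) (auto simp: dir_deriv_grass_chart_metric)
  qed
qed

end

section \<open>Local geometry of a spacelike immersion\<close>

text \<open>One coordinate expression of the immersion, \<open>X \<circ> chart_inv C\<close> in the
  application. The local identities are proved here on an open set of coordinates, without reference
  to the manifold.\<close>

locale immersion_patch =
  fixes \<epsilon> :: real and U :: "(real^'n) set" and \<phi> :: "real^'n \<Rightarrow> ('n::finite, 'k::finite) ambient"
  assumes eps: "\<epsilon> = 1 \<or> \<epsilon> = -1"
    and open_U: "open U"
    and smooth: "smooth_on U \<phi>"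
    and pos: "\<And>y u. y \<in> U \<Longrightarrow> u \<noteq> 0 \<Longrightarrow> ip \<epsilon> (dir_deriv \<phi> y u) (dir_deriv \<phi> y u) > 0"
begin

definition F :: "real^'n \<Rightarrow> ('n, 'k) frame" where
  "F y i = dir_deriv \<phi> y (axis i 1)"

definition h :: "real^'n \<Rightarrow> real^'n \<Rightarrow> real^'n \<Rightarrow> real" where
  "h y u v = ip \<epsilon> (dir_deriv \<phi> y u) (dir_deriv \<phi> y v)"

definition D2 :: "real^'n \<Rightarrow> real^'n \<Rightarrow> real^'n \<Rightarrow> ('n, 'k) ambient" where
  "D2 y u v = dir_deriv (\<lambda>p. dir_deriv \<phi> p v) y u"

definition D3 :: "real^'n \<Rightarrow> real^'n \<Rightarrow> real^'n \<Rightarrow> real^'n \<Rightarrow> ('n, 'k) ambient" where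
  "D3 y u v w = dir_deriv (\<lambda>p. D2 p v w) y u"

text \<open>The Levi-Civita connection as the tangential part of the flat derivative;
  \<open>christoffel_eq\<close> reconciles it with the Koszul formula.\<close>

definition \<Gamma> :: "real^'n \<Rightarrow> real^'n \<Rightarrow> real^'n \<Rightarrow> real^'n" where
  "\<Gamma> y u v = dual \<epsilon> (F y) (D2 y u v)"

definition II :: "real^'n \<Rightarrow> real^'n \<Rightarrow> real^'n \<Rightarrow> ('n, 'k) ambient" where
  "II y u v = nor \<epsilon> (F y) (D2 y u v)"

definition H :: "real^'n \<Rightarrow> ('n, 'k) ambient" where
  "H y = (\<Sum>i\<in>UNIV. \<Sum>j\<in>UNIV. matrix_inv (gram \<epsilon> (F y)) $ i $ j *\<^sub>R II y (axis i 1) (axis j 1))"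

lemma eps_nz: "\<epsilon> \<noteq> 0" using eps by auto

lemma dphi: "y \<in> U \<Longrightarrow> dir_deriv \<phi> y u = comb (F y) u"
  unfolding F_def by (rule linear_eq_comb) (rule smooth_on_dir_deriv_linear[OF smooth])

lemma spacelike_F: "y \<in> U \<Longrightarrow> spacelike_frame \<epsilon> (F y)"
  using pos[of y] by (simp add: spacelike_frame_def dphi comb_def)

lemma spacelike_loc: "y \<in> U \<Longrightarrow> spacelike \<epsilon> (F y)"
  by unfold_locales (rule spacelike_F)

lemma ev_U: "y \<in> U \<Longrightarrow> \<forall>\<^sub>F p in nhds y. p \<in> U"
  using open_U by (rule eventually_nhds_in_open)

lemma smooth_D2: "smooth_on U (\<lambda>p. D2 p u v)"
  unfolding D2_def by (intro smooth_on_dir_deriv smooth)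

lemma has_derivative_F: "y \<in> U \<Longrightarrow> ((\<lambda>p. F p i) has_derivative (\<lambda>u. D2 y u (axis i 1))) (at y)"
  unfolding F_def D2_def
  by (rule smooth_on_has_derivative[OF smooth_on_dir_deriv[OF smooth]])

lemma has_derivative_D2: "y \<in> U \<Longrightarrow> ((\<lambda>p. D2 p v w) has_derivative (\<lambda>u. D3 y u v w)) (at y)"
  unfolding D3_def by (rule smooth_on_has_derivative[OF smooth_D2])

lemma D2_sym: "y \<in> U \<Longrightarrow> D2 y u v = D2 y v u"
  unfolding D2_def by (rule dir_deriv_commute[OF open_U smooth])

lemma D2_linear_left: "y \<in> U \<Longrightarrow> linear (\<lambda>u. D2 y u v)"
  unfolding D2_def by (rule smooth_on_dir_deriv_linear[OF smooth_on_dir_deriv[OF smooth]])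

lemma D2_linear:
  assumes "y \<in> U"
  shows "linear (D2 y u)"
proof -
  have "D2 y u = (\<lambda>v. D2 y v u)" using D2_sym[OF assms] by (intro ext)
  then show ?thesis using D2_linear_left[OF assms, of u] by simp
qed

lemma D2_comb: "y \<in> U \<Longrightarrow> comb (\<lambda>i. D2 y u (axis i 1)) c = D2 y u c"
  by (rule linear_eq_comb[OF D2_linear, symmetric])

lemma D3_sym: "y \<in> U \<Longrightarrow> D3 y u v w = D3 y v u w"
  unfolding D3_def D2_def by (rule dir_deriv_commute[OF open_U smooth_on_dir_deriv[OF smooth]])

lemma D3_sym_right: "y \<in> U \<Longrightarrow> D3 y u v w = D3 y u w v"
  unfolding D3_def by (intro dir_deriv_cong eventually_mono[OF ev_U]) (auto intro: D2_sym)

lemma II_sym: "y \<in> U \<Longrightarrow> II y u v = II y v u"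
  by (simp add: II_def D2_sym[of y u v])

lemma \<Gamma>_sym: "y \<in> U \<Longrightarrow> \<Gamma> y u v = \<Gamma> y v u"
  by (simp add: \<Gamma>_def D2_sym[of y u v])

lemma II_linear: "y \<in> U \<Longrightarrow> linear (II y u)"
  unfolding II_def using linear_compose[OF D2_linear linear_nor] by (simp add: o_def)

lemma II_comb: "y \<in> U \<Longrightarrow> comb (\<lambda>i. II y u (axis i 1)) c = II y u c"
  by (rule linear_eq_comb[OF II_linear, symmetric])

lemma D2_decomp: "D2 y u v = comb (F y) (\<Gamma> y u v) + II y u v"
  by (simp add: II_def nor_def tang_def \<Gamma>_def)

lemma has_derivative_h:
  "y \<in> U \<Longrightarrow> ((\<lambda>p. h p v z) has_derivative
    (\<lambda>u. ip \<epsilon> (dir_deriv \<phi> y v) (D2 y u z) + ip \<epsilon> (D2 y u v) (dir_deriv \<phi> y z))) (at y)"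
  unfolding h_def D2_def
  by (intro bounded_bilinear.FDERIV[OF bounded_bilinear_ip] smooth_on_has_derivative[OF smooth_on_dir_deriv[OF smooth]])

lemma h_nondegenerate:
  assumes "y \<in> U" "\<And>z. h y w z = h y w' z"
  shows "w = w'"
proof (rule ccontr)
  interpret spacelike \<epsilon> "F y" by (rule spacelike_loc) fact
  assume "w \<noteq> w'"
  then have "ip \<epsilon> (comb (F y) (w - w')) (comb (F y) (w - w')) > 0" by (intro comb_pos) simp
  moreover have "ip \<epsilon> (comb (F y) w) (comb (F y) (w - w')) = ip \<epsilon> (comb (F y) w') (comb (F y) (w - w'))"
    using assms(2)[of "w - w'"] assms(1) by (simp add: h_def dphi)
  ultimately show False by (simp add: comb_diff_right ip_simps)
qed

lemma ip_II_F: "y \<in> U \<Longrightarrow> ip \<epsilon> (II y u v) (F y j) = 0" "y \<in> U \<Longrightarrow> ip \<epsilon> (F y j) (II y u v) = 0"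
  "y \<in> U \<Longrightarrow> ip \<epsilon> (II y u v) (comb (F y) c) = 0" "y \<in> U \<Longrightarrow> ip \<epsilon> (comb (F y) c) (II y u v) = 0"
  using spacelike.ip_nor[OF spacelike_loc] spacelike.ip_comb_nor[OF spacelike_loc]
  by (auto simp: II_def)

lemma nor_II: "y \<in> U \<Longrightarrow> nor \<epsilon> (F y) (II y u v) = II y u v"
  using spacelike.nor_nor[OF spacelike_loc] by (simp add: II_def)

text \<open>The tangential part of the flat derivative is torsion-free, because \<open>D2\<close> is
  symmetric, and compatible with h. So four of the six terms of the Koszul expression cancel and two
  copies of the product of \<open>D2 y u v\<close> with the tangent vector of z remain. Positivity
  of h gives uniqueness.\<close>

lemma christoffel_eq:
  assumes y: "y \<in> U"
  shows "christoffel UNIV h y u v = \<Gamma> y u v"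
proof -
  interpret spacelike \<epsilon> "F y" by (rule spacelike_loc) fact
  have koszul: "dir_deriv (\<lambda>p. h p v z) y u + dir_deriv (\<lambda>p. h p u z) y v - dir_deriv (\<lambda>p. h p u v) y z
      = 2 * h y (\<Gamma> y u v) z" for z
  proof -
    have "h y (\<Gamma> y u v) z = ip \<epsilon> (D2 y u v) (dir_deriv \<phi> y z)"
      by (simp add: h_def dphi[OF y] D2_decomp[of y u v] ip_simps ip_II_F[OF y])
    then show ?thesis
      unfolding has_derivative_h[OF y, THEN dir_deriv_eqI]
      by (simp add: D2_sym[OF y, of v u] D2_sym[OF y, of z u] D2_sym[OF y, of z v] ip_commute)
  qed
  show ?thesis
    unfolding christoffel_def koszul
  proof (rule the_equality)
    fix w assume "w \<in> UNIV \<and> (\<forall>z\<in>UNIV. 2 * h y w z = 2 * h y (\<Gamma> y u v) z)"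
    then show "w = \<Gamma> y u v" by (intro h_nondegenerate[OF y]) simp
  qed simp
qed

lemma gram_F: "(\<chi> i j. h y (axis i 1) (axis j 1)) = gram \<epsilon> (F y)"
  by (simp add: gram_def h_def F_def)

lemma metric_trace_eq:
  "metric_trace h y b = (\<Sum>i\<in>UNIV. \<Sum>j\<in>UNIV. matrix_inv (gram \<epsilon> (F y)) $ i $ j *\<^sub>R b (axis i 1) (axis j 1))"
  by (simp add: metric_trace_def gram_F)

lemma H_eq: "H y = metric_trace h y (II y)"
  by (simp add: H_def metric_trace_eq)


subsection \<open>The Gauss equation\<close>

lemma has_derivative_II:
  assumes y: "y \<in> U"
  shows "((\<lambda>p. II p v w) has_derivative
    (\<lambda>u. D3 y u v w - (comb (F y) (dir_deriv (\<lambda>p. \<Gamma> p v w) y u) + D2 y u (\<Gamma> y v w)))) (at y)"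
proof -
  from has_derivative_dual_nor[of \<epsilon> F y, OF spacelike_F[OF y] has_derivative_F[OF y] has_derivative_D2[OF y]]
  obtain D where D: "((\<lambda>p. \<Gamma> p v w) has_derivative D) (at y)"
    and II: "((\<lambda>p. II p v w) has_derivative
      (\<lambda>u. D3 y u v w - (comb (F y) (D u) + D2 y u (\<Gamma> y v w)))) (at y)"
    by (auto simp: \<Gamma>_def II_def D2_comb[OF y])
  have "dir_deriv (\<lambda>p. \<Gamma> p v w) y = D"
    using dir_deriv_eqI[OF D] by (intro ext)
  with II show ?thesis by simp
qed

text \<open>Differentiate the relation that \<open>F p j\<close> and \<open>N p\<close> are
  orthogonal. The derivative of the frame vector is \<open>D2\<close>, of which a normal vector sees
  only the part \<open>II\<close>.\<close>

lemma weingarten: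
  assumes y: "y \<in> U" and N: "(N has_derivative N') (at y)"
    and normal: "\<And>p. p \<in> U \<Longrightarrow> nor \<epsilon> (F p) (N p) = N p"
  shows "ip \<epsilon> (F y j) (N' u) = - ip \<epsilon> (N y) (II y u (axis j 1))"
proof -
  have z: "ip \<epsilon> (F p j) (N p) = 0" if "p \<in> U" for p
    using spacelike.ip_nor(1)[OF spacelike_loc[OF that], of j "N p"] normal[OF that] by simp
  have "((\<lambda>p. ip \<epsilon> (F p j) (N p)) has_derivative
      (\<lambda>u. ip \<epsilon> (F y j) (N' u) + ip \<epsilon> (D2 y u (axis j 1)) (N y))) (at y)"
    by (intro bounded_bilinear.FDERIV[OF bounded_bilinear_ip] has_derivative_F y N)
  then have "((\<lambda>p. 0) has_derivative
      (\<lambda>u. ip \<epsilon> (F y j) (N' u) + ip \<epsilon> (D2 y u (axis j 1)) (N y))) (at y)"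
    by (rule has_derivative_transform_within_open[OF _ open_U y]) (rule z)
  from fun_cong[OF has_derivative_unique[OF this has_derivative_const]]
  have "ip \<epsilon> (F y j) (N' u) + ip \<epsilon> (D2 y u (axis j 1)) (N y) = 0" .
  moreover have "ip \<epsilon> (comb (F y) c) (N y) = 0" for c
    using spacelike.ip_comb_nor(1)[OF spacelike_loc[OF y], of c "N y"] normal[OF y] by simp
  ultimately show ?thesis
    by (simp add: D2_decomp[of y u] ip_simps ip_commute[of \<epsilon> "N y"])
qed

text \<open>The tangential part of the derivative of \<open>II p v w\<close> is known twice: from
  Weingarten's formula, and from \<open>has_derivative_II\<close>, where the derivative of \<Gamma>
  and a composition of two \<Gamma> appear. Antisymmetrising in u and v forms the curvature and
  removes the third derivatives by \<open>D3_sym\<close>.\<close>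

lemma gauss_equation:
  assumes y: "y \<in> U"
  shows "ip \<epsilon> (F y j) (comb (F y) (curvature h y u v w))
    = ip \<epsilon> (II y u (axis j 1)) (II y v w) - ip \<epsilon> (II y v (axis j 1)) (II y u w)"
proof -
  interpret spacelike \<epsilon> "F y" by (rule spacelike_loc) fact
  have chr: "dir_deriv (\<lambda>p. christoffel UNIV h p v w) y u = dir_deriv (\<lambda>p. \<Gamma> p v w) y u" for u v w
    by (intro dir_deriv_cong eventually_mono[OF ev_U[OF y]]) (rule christoffel_eq)
  have half: "ip \<epsilon> (F y j) (comb (F y) (dir_deriv (\<lambda>p. \<Gamma> p v w) y u + \<Gamma> y u (\<Gamma> y v w)))
      = ip \<epsilon> (F y j) (D3 y u v w) + ip \<epsilon> (II y v w) (II y u (axis j 1))" for u v w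
    using weingarten[OF y has_derivative_II[OF y], of v w j u]
    by (simp add: nor_II ip_simps comb_add_right D2_decomp[of y u "\<Gamma> y v w"] ip_II_F[OF y])
  have "curvature h y u v w = (dir_deriv (\<lambda>p. \<Gamma> p v w) y u + \<Gamma> y u (\<Gamma> y v w))
      - (dir_deriv (\<lambda>p. \<Gamma> p u w) y v + \<Gamma> y v (\<Gamma> y u w))"
    by (simp add: curvature_def chr christoffel_eq[OF y])
  then show ?thesis
    by (simp add: comb_diff_right[of "F y" "_ + _" "_ + _"] ip_simps half D3_sym[OF y, of v u] ip_commute)
qed

text \<open>Contraction of the Gauss equation with the inverse Gram matrix. The subtracted sum is,
  up to the factor \<epsilon>, the pullback of the metric of the Grassmannian.\<close>

lemma ricci_eq:
  assumes y: "y \<in> U"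
  shows "ricci h y u v = ip \<epsilon> (H y) (II y u v)
    - (\<Sum>i\<in>UNIV. \<Sum>j\<in>UNIV. matrix_inv (gram \<epsilon> (F y)) $ i $ j * ip \<epsilon> (II y u (axis i 1)) (II y v (axis j 1)))"
proof -
  interpret spacelike \<epsilon> "F y" by (rule spacelike_loc) fact
  let ?g = "matrix_inv (gram \<epsilon> (F y))"
  have "ricci h y u v = (\<Sum>i\<in>UNIV. dual \<epsilon> (F y) (comb (F y) (curvature h y (axis i 1) u v)) $ i)"
    by (simp add: ricci_def)
  also have "\<dots> = (\<Sum>i\<in>UNIV. \<Sum>j\<in>UNIV. ?g $ i $ j *
      (ip \<epsilon> (II y (axis i 1) (axis j 1)) (II y u v) - ip \<epsilon> (II y u (axis j 1)) (II y (axis i 1) v)))"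
    by (simp only: vec_nth_dual gauss_equation[OF y])
  also have "\<dots> = ip \<epsilon> (H y) (II y u v)
      - (\<Sum>i\<in>UNIV. \<Sum>j\<in>UNIV. ?g $ i $ j * ip \<epsilon> (II y u (axis j 1)) (II y v (axis i 1)))"
    by (simp add: H_def linear_sum[OF linear_ip_left] ip_simps right_diff_distrib sum_subtractf
        II_sym[OF y, of "axis _ 1" v])
  also have "(\<Sum>i\<in>UNIV. \<Sum>j\<in>UNIV. ?g $ i $ j * ip \<epsilon> (II y u (axis j 1)) (II y v (axis i 1)))
      = (\<Sum>j\<in>UNIV. \<Sum>i\<in>UNIV. ?g $ j $ i * ip \<epsilon> (II y u (axis j 1)) (II y v (axis i 1)))"
    by (subst sum.swap) (simp add: gram_inv_sym)
  finally show ?thesis .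
qed


subsection \<open>The derivative of the mean curvature vector\<close>

lemma nor_H: "y \<in> U \<Longrightarrow> nor \<epsilon> (F y) (H y) = H y"
  by (simp add: H_def linear_sum[OF linear_nor] nor_simps nor_II)

text \<open>The derivative of the inverse Gram matrix yields the last two terms with \<Gamma>.
  Together with the normal part of the derivative of \<open>II\<close> they form the covariant
  derivative of the second fundamental form, whose trace is the normal derivative of H.\<close>

lemma derivative_H:
  assumes y: "y \<in> U"
  shows "(H has_derivative dir_deriv H y) (at y) \<and>
    nor \<epsilon> (F y) (dir_deriv H y u) = (\<Sum>a\<in>UNIV. \<Sum>b\<in>UNIV. matrix_inv (gram \<epsilon> (F y)) $ a $ b *\<^sub>R
      (nor \<epsilon> (F y) (D3 y u (axis a 1) (axis b 1)) - II y u (\<Gamma> y (axis a 1) (axis b 1))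
        - II y (axis a 1) (\<Gamma> y u (axis b 1)) - II y (axis b 1) (\<Gamma> y u (axis a 1))))"
proof -
  interpret spacelike \<epsilon> "F y" by (rule spacelike_loc) fact
  define g where "g = matrix_inv (gram \<epsilon> (F y))"
  have g_sym: "g $ a $ b = g $ b $ a" for a b unfolding g_def by (rule gram_inv_sym)
  define G' where "G' = (\<lambda>u. (\<chi> i j. ip \<epsilon> (F y i) (D2 y u (axis j 1)) + ip \<epsilon> (D2 y u (axis i 1)) (F y j)) :: real^'n^'n)"
  define dII where "dII = (\<lambda>u v w. D3 y u v w - (comb (F y) (dir_deriv (\<lambda>p. \<Gamma> p v w) y u) + D2 y u (\<Gamma> y v w)))"
  have "((\<lambda>p. matrix_inv (gram \<epsilon> (F p))) has_derivative (\<lambda>u. - (g ** G' u ** g))) (at y)"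
    using has_derivative_matrix_inv[OF has_derivative_gram[of F _ y, OF has_derivative_F[OF y]] det_gram]
    by (simp add: g_def G'_def)
  then have "((\<lambda>p. matrix_inv (gram \<epsilon> (F p)) $ a $ b *\<^sub>R II p (axis a 1) (axis b 1)) has_derivative
      (\<lambda>u. matrix_inv (gram \<epsilon> (F y)) $ a $ b *\<^sub>R dII u (axis a 1) (axis b 1)
        + (- (g ** G' u ** g)) $ a $ b *\<^sub>R II y (axis a 1) (axis b 1))) (at y)" for a b
    unfolding dII_def has_derivative_matrix_nth_iff
    by (intro has_derivative_scaleR has_derivative_II[OF y]) auto
  from has_derivative_sum[of UNIV, OF has_derivative_sum[of UNIV, OF this]]
  have H': "(H has_derivative (\<lambda>u. \<Sum>a\<in>UNIV. \<Sum>b\<in>UNIV. g $ a $ b *\<^sub>R dII u (axis a 1) (axis b 1)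
        + (- (g ** G' u ** g)) $ a $ b *\<^sub>R II y (axis a 1) (axis b 1))) (at y)"
    by (simp add: H_def[abs_def] g_def[symmetric])
  have "dir_deriv H y = (\<lambda>u. \<Sum>a\<in>UNIV. \<Sum>b\<in>UNIV. g $ a $ b *\<^sub>R dII u (axis a 1) (axis b 1)
        + (- (g ** G' u ** g)) $ a $ b *\<^sub>R II y (axis a 1) (axis b 1))"
    using dir_deriv_eqI[OF H'] by (intro ext)
  note dH = H'[folded this] this
  have \<Gamma>_nth: "\<Gamma> y u v $ a = (\<Sum>i\<in>UNIV. g $ a $ i * ip \<epsilon> (F y i) (D2 y u v))" for u v a
    by (simp add: \<Gamma>_def vec_nth_dual g_def)
  \<comment> \<open>\<open>G' u\<close> is the derivative of the metric. Multiplying it by the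
    inverse metric on both sides raises its indices and produces \<Gamma> once in each slot.\<close>
  have ggg: "(g ** G' u ** g) $ a $ b
      = (\<Sum>j\<in>UNIV. \<Gamma> y u (axis j 1) $ a * g $ j $ b) + (\<Sum>i\<in>UNIV. g $ a $ i * \<Gamma> y u (axis i 1) $ b)" for a b
  proof -
    have "(g ** G' u ** g) $ a $ b = (\<Sum>j\<in>UNIV. (\<Sum>i\<in>UNIV. g $ a $ i * G' u $ i $ j) * g $ j $ b)"
      by (simp add: matrix_matrix_mult_def)
    also have "\<dots> = (\<Sum>j\<in>UNIV. \<Gamma> y u (axis j 1) $ a * g $ j $ b)
        + (\<Sum>j\<in>UNIV. \<Sum>i\<in>UNIV. g $ a $ i * ip \<epsilon> (D2 y u (axis i 1)) (F y j) * g $ j $ b)"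
      by (simp add: G'_def \<Gamma>_nth distrib_left distrib_right sum.distrib sum_distrib_right)
    also have "(\<Sum>j\<in>UNIV. \<Sum>i\<in>UNIV. g $ a $ i * ip \<epsilon> (D2 y u (axis i 1)) (F y j) * g $ j $ b)
        = (\<Sum>i\<in>UNIV. \<Sum>j\<in>UNIV. g $ a $ i * (g $ b $ j * ip \<epsilon> (F y j) (D2 y u (axis i 1))))"
      by (subst sum.swap) (simp add: ip_commute[of \<epsilon> "F y _"] g_sym[of b] mult_ac)
    also have "\<dots> = (\<Sum>i\<in>UNIV. g $ a $ i * \<Gamma> y u (axis i 1) $ b)"
      by (simp add: \<Gamma>_nth sum_distrib_left)
    finally show ?thesis .
  qed
  \<comment> \<open>Apart from reordering sums, the components of \<Gamma> are summed against
    \<open>II\<close> on basis vectors, which by linearity puts \<Gamma> itself into an argument of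
    \<open>II\<close>.\<close>
  have tr1: "(\<Sum>a\<in>UNIV. \<Sum>b\<in>UNIV. (\<Sum>j\<in>UNIV. \<Gamma> y u (axis j 1) $ a * g $ j $ b) *\<^sub>R II y (axis a 1) (axis b 1))
      = (\<Sum>a\<in>UNIV. \<Sum>b\<in>UNIV. g $ a $ b *\<^sub>R II y (axis b 1) (\<Gamma> y u (axis a 1)))"
  proof -
    have "(\<Sum>a\<in>UNIV. \<Sum>b\<in>UNIV. (\<Sum>j\<in>UNIV. \<Gamma> y u (axis j 1) $ a * g $ j $ b) *\<^sub>R II y (axis a 1) (axis b 1))
      = (\<Sum>a\<in>UNIV. \<Sum>b\<in>UNIV. \<Sum>j\<in>UNIV. g $ j $ b *\<^sub>R \<Gamma> y u (axis j 1) $ a *\<^sub>R II y (axis b 1) (axis a 1))"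
      by (simp add: scaleR_sum_left mult.commute II_sym[OF y, of "axis _ 1" "axis _ 1"])
    also have "\<dots> = (\<Sum>a\<in>UNIV. \<Sum>j\<in>UNIV. \<Sum>b\<in>UNIV. g $ j $ b *\<^sub>R \<Gamma> y u (axis j 1) $ a *\<^sub>R II y (axis b 1) (axis a 1))"
      by (intro sum.cong refl sum.swap)
    also have "\<dots> = (\<Sum>j\<in>UNIV. \<Sum>a\<in>UNIV. \<Sum>b\<in>UNIV. g $ j $ b *\<^sub>R \<Gamma> y u (axis j 1) $ a *\<^sub>R II y (axis b 1) (axis a 1))"
      by (rule sum.swap)
    also have "\<dots> = (\<Sum>j\<in>UNIV. \<Sum>b\<in>UNIV. \<Sum>a\<in>UNIV. g $ j $ b *\<^sub>R \<Gamma> y u (axis j 1) $ a *\<^sub>R II y (axis b 1) (axis a 1))"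
      by (intro sum.cong refl sum.swap)
    also have "\<dots> = (\<Sum>j\<in>UNIV. \<Sum>b\<in>UNIV. g $ j $ b *\<^sub>R II y (axis b 1) (\<Gamma> y u (axis j 1)))"
      by (simp add: II_comb[OF y, symmetric, of "axis _ 1" "\<Gamma> y u _"] comb_def scaleR_sum_right)
    finally show ?thesis .
  qed
  have tr2: "(\<Sum>a\<in>UNIV. \<Sum>b\<in>UNIV. (\<Sum>i\<in>UNIV. g $ a $ i * \<Gamma> y u (axis i 1) $ b) *\<^sub>R II y (axis a 1) (axis b 1))
      = (\<Sum>a\<in>UNIV. \<Sum>b\<in>UNIV. g $ a $ b *\<^sub>R II y (axis a 1) (\<Gamma> y u (axis b 1)))"
  proof -
    have "(\<Sum>a\<in>UNIV. \<Sum>b\<in>UNIV. (\<Sum>i\<in>UNIV. g $ a $ i * \<Gamma> y u (axis i 1) $ b) *\<^sub>R II y (axis a 1) (axis b 1))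
      = (\<Sum>a\<in>UNIV. \<Sum>b\<in>UNIV. \<Sum>i\<in>UNIV. g $ a $ i *\<^sub>R \<Gamma> y u (axis i 1) $ b *\<^sub>R II y (axis a 1) (axis b 1))"
      by (simp add: scaleR_sum_left)
    also have "\<dots> = (\<Sum>a\<in>UNIV. \<Sum>i\<in>UNIV. \<Sum>b\<in>UNIV. g $ a $ i *\<^sub>R \<Gamma> y u (axis i 1) $ b *\<^sub>R II y (axis a 1) (axis b 1))"
      by (intro sum.cong refl sum.swap)
    also have "\<dots> = (\<Sum>a\<in>UNIV. \<Sum>i\<in>UNIV. g $ a $ i *\<^sub>R II y (axis a 1) (\<Gamma> y u (axis i 1)))"
      by (simp add: II_comb[OF y, symmetric, of "axis _ 1" "\<Gamma> y u _"] comb_def scaleR_sum_right)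
    finally show ?thesis .
  qed
  have "nor \<epsilon> (F y) (dII u v w) = nor \<epsilon> (F y) (D3 y u v w) - II y u (\<Gamma> y v w)" for v w
    by (simp add: dII_def nor_simps II_def)
  then have "nor \<epsilon> (F y) (dir_deriv H y u) = (\<Sum>a\<in>UNIV. \<Sum>b\<in>UNIV. g $ a $ b *\<^sub>R
      (nor \<epsilon> (F y) (D3 y u (axis a 1) (axis b 1)) - II y u (\<Gamma> y (axis a 1) (axis b 1)))
      - (g ** G' u ** g) $ a $ b *\<^sub>R II y (axis a 1) (axis b 1))"
    by (simp add: dH(2) linear_sum[OF linear_nor] nor_simps nor_II[OF y])
  also have "\<dots> = (\<Sum>a\<in>UNIV. \<Sum>b\<in>UNIV. g $ a $ b *\<^sub>R
      (nor \<epsilon> (F y) (D3 y u (axis a 1) (axis b 1)) - II y u (\<Gamma> y (axis a 1) (axis b 1))))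
      - (\<Sum>a\<in>UNIV. \<Sum>b\<in>UNIV. (\<Sum>j\<in>UNIV. \<Gamma> y u (axis j 1) $ a * g $ j $ b) *\<^sub>R II y (axis a 1) (axis b 1))
      - (\<Sum>a\<in>UNIV. \<Sum>b\<in>UNIV. (\<Sum>i\<in>UNIV. g $ a $ i * \<Gamma> y u (axis i 1) $ b) *\<^sub>R II y (axis a 1) (axis b 1))"
    by (simp add: ggg sum_subtractf sum.distrib scaleR_add_left)
  also have "\<dots> = (\<Sum>a\<in>UNIV. \<Sum>b\<in>UNIV. g $ a $ b *\<^sub>R
      (nor \<epsilon> (F y) (D3 y u (axis a 1) (axis b 1)) - II y u (\<Gamma> y (axis a 1) (axis b 1))
        - II y (axis a 1) (\<Gamma> y u (axis b 1)) - II y (axis b 1) (\<Gamma> y u (axis a 1))))"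
    unfolding tr1 tr2 by (simp add: sum_subtractf scaleR_diff_right)
  finally show ?thesis using dH(1) by (simp add: g_def)
qed

lemmas has_derivative_H = derivative_H[THEN conjunct1]
lemmas nor_dir_deriv_H = derivative_H[THEN conjunct2]


subsection \<open>The Gauss map in graph coordinates\<close>

text \<open>G need only agree with the graph coordinate near y, since the coordinate expression of
  the Gauss map is known only inside one chart of the manifold.\<close>

lemma has_derivative_gauss:
  assumes y: "y \<in> U"
    and G: "\<forall>\<^sub>F p in nhds y. G p = graph_coord \<epsilon> (oriented_span (F y)) (oriented_span (F p))"
  shows "(G has_derivative (\<lambda>u. blin \<epsilon> (F y) (\<lambda>i. II y u (axis i 1)))) (at y)"
  unfolding II_def
  by (rule has_derivative_cong_nhds[OF
        spacelike.has_derivative_graph_coord_centre[OF spacelike_loc[OF y], of F, OF has_derivative_F[OF y] refl] G])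

text \<open>A second derivative needs the first one at all points near y, in the graph coordinates
  still centred at y; hence the derivative of \<open>slope\<close> away from the centre. It is then
  differentiated at y, where the coordinate matrix is the identity and the slope is 0.\<close>

lemma dir_deriv_dir_deriv_gauss:
  assumes y: "y \<in> U"
    and G: "\<forall>\<^sub>F p in nhds y. G p = graph_coord \<epsilon> (oriented_span (F y)) (oriented_span (F p))"
  shows "dir_deriv (\<lambda>p. dir_deriv G p v) y u = blin \<epsilon> (F y) (\<lambda>i. nor \<epsilon> (F y) (D3 y u v (axis i 1))
    - II y v (\<Gamma> y u (axis i 1)) - II y u (\<Gamma> y v (axis i 1)))"
proof -
  interpret spacelike \<epsilon> "F y" by (rule spacelike_loc) fact
  have bl: "bounded_linear (dual \<epsilon> (F y))" "bounded_linear (nor \<epsilon> (F y))"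
    using linear_dual linear_nor by (auto simp: linear_conv_bounded_linear)
  define l where "l = (\<lambda>p. mact (matrix_inv (\<chi> i. dual \<epsilon> (F y) (F p i)))
      (\<lambda>i. nor \<epsilon> (F y) (D2 p v (axis i 1)) - mact (\<chi> i. dual \<epsilon> (F y) (D2 p v (axis i 1))) (slope \<epsilon> (F y) (F p)) i))"
  have tend: "((\<lambda>q. F q i) \<longlongrightarrow> F y i) (nhds y)" for i
    by (rule tendsto_nhds_of_has_derivative[OF has_derivative_F[OF y]])
  have "\<forall>\<^sub>F p in nhds y. det (\<chi> i. dual \<epsilon> (F y) (F p i)) > 0"
    by (rule eventually_det_dual_pos[OF tend]) (simp add: matrix_axis)
  \<comment> \<open>The agreement holds on a neighbourhood of every p near y, so the derivative of G
    at such p can be read off from the formula.\<close>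
  moreover have "\<forall>\<^sub>F p in nhds y. \<forall>\<^sub>F q in nhds p. G q = graph_coord \<epsilon> (oriented_span (F y)) (oriented_span (F q))"
    using G by (simp add: eventually_eventually)
  ultimately have "\<forall>\<^sub>F p in nhds y. dir_deriv G p v = blin \<epsilon> (F y) (l p)"
    using ev_U[OF y]
  proof eventually_elim
    case (elim p)
    show ?case
      unfolding l_def
      by (rule dir_deriv_eqI[OF has_derivative_cong_nhds[OF has_derivative_graph_coord elim(2)]])
        (use elim(1,3) in \<open>auto intro: has_derivative_F spacelike_F\<close>)
  qed
  then have "dir_deriv (\<lambda>p. dir_deriv G p v) y u = dir_deriv (\<lambda>p. blin \<epsilon> (F y) (l p)) y u"
    by (rule dir_deriv_cong)
  also have "\<dots> = blin \<epsilon> (F y) (\<lambda>i. nor \<epsilon> (F y) (D3 y u v (axis i 1))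
    - II y u (\<Gamma> y v (axis i 1)) - II y v (\<Gamma> y u (axis i 1)))"
  proof (rule dir_deriv_eqI[OF has_derivative_blin])
    fix j
    have a: "((\<lambda>p. \<chi> i. dual \<epsilon> (F y) (F p i)) has_derivative (\<lambda>u. \<chi> i. \<Gamma> y u (axis i 1))) (at y)"
      unfolding has_derivative_matrix_nth_iff \<Gamma>_def
      by (auto intro!: bounded_linear.has_derivative[OF bounded_linear_vec_nth]
          bounded_linear.has_derivative[OF bl(1)] has_derivative_F y)
    have inv: "((\<lambda>p. matrix_inv (\<chi> i. dual \<epsilon> (F y) (F p i))) has_derivative
        (\<lambda>u. - (\<chi> i. \<Gamma> y u (axis i 1)))) (at y)"
      using has_derivative_matrix_inv[OF a] by (simp add: matrix_axis matrix_inv_one)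
    have a': "((\<lambda>p. \<chi> i. dual \<epsilon> (F y) (D2 p v (axis i 1))) has_derivative
        (\<lambda>u. \<chi> i. dual \<epsilon> (F y) (D3 y u v (axis i 1)))) (at y)"
      unfolding has_derivative_matrix_nth_iff
      by (auto intro!: bounded_linear.has_derivative[OF bounded_linear_vec_nth]
          bounded_linear.has_derivative[OF bl(1)] has_derivative_D2 y)
    have sl: "((\<lambda>p. slope \<epsilon> (F y) (F p) i) has_derivative (\<lambda>u. II y u (axis i 1))) (at y)" for i
      using has_derivative_slope[of F _ y, OF has_derivative_F[OF y]]
      by (simp add: matrix_axis matrix_inv_one slope_self II_def)
    \<comment> \<open>The slope vanishes at y, so the derivative of the matrix in front of it does
      not contribute.\<close>
    have "((\<lambda>p. mact (\<chi> i. dual \<epsilon> (F y) (D2 p v (axis i 1))) (slope \<epsilon> (F y) (F p)) i) has_derivative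
        (\<lambda>u. II y u (\<Gamma> y v (axis i 1)))) (at y)" for i
      using has_derivative_mact[of "\<lambda>p. slope \<epsilon> (F y) (F p)", OF sl a']
      by (simp add: slope_self mact_def II_comb[OF y] \<Gamma>_def)
    then have b: "((\<lambda>p. nor \<epsilon> (F y) (D2 p v (axis i 1)) - mact (\<chi> i. dual \<epsilon> (F y) (D2 p v (axis i 1))) (slope \<epsilon> (F y) (F p)) i)
        has_derivative (\<lambda>u. nor \<epsilon> (F y) (D3 y u v (axis i 1)) - II y u (\<Gamma> y v (axis i 1)))) (at y)" for i
      by (intro has_derivative_diff bounded_linear.has_derivative[OF bl(2)] has_derivative_D2 y)
    show "((\<lambda>p. l p j) has_derivative (\<lambda>u. nor \<epsilon> (F y) (D3 y u v (axis j 1))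
        - II y u (\<Gamma> y v (axis j 1)) - II y v (\<Gamma> y u (axis j 1)))) (at y)"
      using has_derivative_mact[where j = j and
          b = "\<lambda>p i. nor \<epsilon> (F y) (D2 p v (axis i 1)) - mact (\<chi> i. dual \<epsilon> (F y) (D2 p v (axis i 1))) (slope \<epsilon> (F y) (F p)) i" and
          b' = "\<lambda>u i. nor \<epsilon> (F y) (D3 y u v (axis i 1)) - II y u (\<Gamma> y v (axis i 1))", OF b inv]
      by (simp add: l_def matrix_axis matrix_inv_one slope_self mact_minus_left)
        (simp add: mact_def II_def[symmetric] II_comb[OF y])
  qed
  finally show ?thesis by (simp add: algebra_simps)
qed

text \<open>This is the theorem of Ruh and Vilms; the symmetry of \<open>D3\<close> plays the role of the Codazzi
  equation.\<close>

lemma tension_gauss: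
  assumes y: "y \<in> U"
    and G: "\<forall>\<^sub>F p in nhds y. G p = graph_coord \<epsilon> (oriented_span (F y)) (oriented_span (F p))"
  shows "tension h (hom_perp \<epsilon> (oriented_span (F y))) (grass_chart_metric \<epsilon> (oriented_span (F y))) G y
    = blin \<epsilon> (F y) (\<lambda>i. nor \<epsilon> (F y) (dir_deriv H y (axis i 1)))"
proof -
  interpret spacelike \<epsilon> "F y" by (rule spacelike_loc) fact
  have dG: "dir_deriv G y u = blin \<epsilon> (F y) (\<lambda>i. II y u (axis i 1))" for u
    by (rule dir_deriv_eqI[OF has_derivative_gauss[OF y G]])
  have mem: "dir_deriv G y u \<in> hom_perp \<epsilon> (oriented_span (F y))" for u
    unfolding dG by (rule blin_in_hom_perp) (simp add: II_def)
  \<comment> \<open>The Christoffel map of the target is evaluated at \<open>G y\<close>; it was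
    computed only at the centre of the chart, which is 0.\<close>
  have "G y = graph_coord \<epsilon> (oriented_span (F y)) (oriented_span (F y))"
    using eventually_nhds_x_imp_x[OF G] .
  also have "\<dots> = 0"
    using graph_coord_eq[OF spacelike] by (simp add: matrix_axis slope_self)
  finally have G0: "G y = 0" .
  have "map_hessian h (hom_perp \<epsilon> (oriented_span (F y))) (grass_chart_metric \<epsilon> (oriented_span (F y))) G y u v
      = blin \<epsilon> (F y) (\<lambda>i. nor \<epsilon> (F y) (D3 y (axis i 1) u v) - II y (axis i 1) (\<Gamma> y u v)
        - II y u (\<Gamma> y (axis i 1) v) - II y v (\<Gamma> y (axis i 1) u))" for u v
  proof -
    have "D3 y u v w = D3 y w u v" for w
      using D3_sym[OF y] D3_sym_right[OF y] by metis
    then show ?thesis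
      by (simp add: map_hessian_def G0 christoffel_grass_centre[OF mem mem eps_nz, unfolded dG] christoffel_eq[OF y]
          dir_deriv_dir_deriv_gauss[OF y G] dG blin_diff II_sym[OF y, of "\<Gamma> y u v"] \<Gamma>_sym[OF y, of _ "axis _ 1"] diff_diff_eq add_ac)
  qed
  then show ?thesis
    by (simp add: tension_def metric_trace_eq blin_scaleR blin_sum nor_dir_deriv_H[OF y])
qed


subsection \<open>Gradient solitons in a patch\<close>

lemma gradient_unique:
  assumes "y \<in> U" "\<And>z. h y w z = dir_deriv f y z"
  shows "gradient h f y = w"
  unfolding gradient_def
proof (rule the_equality)
  fix w' assume "\<forall>z. h y w' z = dir_deriv f y z"
  then show "w' = w" by (intro h_nondegenerate[OF assms(1)]) (simp add: assms(2))
qed (simp add: assms(2))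

text \<open>The solution of the defining equation is exhibited explicitly, because the formula is
  what makes the gradient differentiable in y.\<close>

lemma h_gradient:
  assumes y: "y \<in> U" and f: "smooth_on U f"
  shows "gradient h f y = matrix_inv (gram \<epsilon> (F y)) *v (\<chi> j. dir_deriv f y (axis j 1))"
    and "h y (gradient h f y) z = dir_deriv f y z"
proof -
  interpret spacelike \<epsilon> "F y" by (rule spacelike_loc) fact
  define w where "w = matrix_inv (gram \<epsilon> (F y)) *v (\<chi> j. dir_deriv f y (axis j 1))"
  have "gram \<epsilon> (F y) *v w = (\<chi> j. dir_deriv f y (axis j 1))"
    by (simp add: w_def matrix_vector_mul_assoc matrix_inv_mult[OF det_gram])
  then have w: "ip \<epsilon> (F y j) (comb (F y) w) = dir_deriv f y (axis j 1)" for j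
    by (simp add: gram_mult vec_eq_iff)
  have *: "h y w z = dir_deriv f y z" for z
  proof -
    have "h y w z = comb (\<lambda>i. ip \<epsilon> (F y i) (comb (F y) w)) z"
      by (simp add: h_def dphi[OF y] ip_commute[of \<epsilon> "comb (F y) w"] linear_apply_comb[OF linear_ip_left[of \<epsilon> "comb (F y) w"], of "F y" z])
    also have "\<dots> = dir_deriv f y z"
      unfolding w by (rule linear_eq_comb[OF smooth_on_dir_deriv_linear[OF f y], symmetric])
    finally show ?thesis .
  qed
  show "gradient h f y = matrix_inv (gram \<epsilon> (F y)) *v (\<chi> j. dir_deriv f y (axis j 1))"
    using gradient_unique[OF y *] by (simp add: w_def)
  show "h y (gradient h f y) z = dir_deriv f y z"
    using gradient_unique[OF y *] * by simp
qed

lemma has_derivative_gradient: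
  assumes y: "y \<in> U" and f: "smooth_on U f"
  shows "\<exists>D. (gradient h f has_derivative D) (at y)"
proof -
  interpret spacelike \<epsilon> "F y" by (rule spacelike_loc) fact
  have "((\<lambda>p. \<chi> j. dir_deriv f p (axis j 1)) has_derivative
      (\<lambda>u. \<chi> j. dir_deriv (\<lambda>p. dir_deriv f p (axis j 1)) y u)) (at y)"
    unfolding has_derivative_vec_nth_iff
    by (auto intro: smooth_on_has_derivative[OF smooth_on_dir_deriv[OF f] y])
  from bounded_bilinear.FDERIV[OF bounded_bilinear_matrix_vector_mult
      has_derivative_matrix_inv[OF has_derivative_gram[of F _ y, OF has_derivative_F[OF y]] det_gram] this]
  obtain D where "((\<lambda>p. matrix_inv (gram \<epsilon> (F p)) *v (\<chi> j. dir_deriv f p (axis j 1))) has_derivative D) (at y)"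
    by blast
  then have "(gradient h f has_derivative D) (at y)"
    by (rule has_derivative_transform_within_open[OF _ open_U y]) (rule h_gradient(1)[OF _ f, symmetric])
  then show ?thesis by blast
qed

text \<open>The soliton equations say exactly that this vector is constant.\<close>

definition W :: "(real^'n \<Rightarrow> real) \<Rightarrow> real \<Rightarrow> real^'n \<Rightarrow> ('n, 'k) ambient" where
  "W f lam y = comb (F y) (gradient h f y) - H y - lam *\<^sub>R \<phi> y"

text \<open>The derivative D of the gradient is never computed. Pairing the gradient term with
  \<open>F y j\<close> gives a partial derivative of f, and differentiating that produces the
  Hessian; in normal components the term with D disappears. Weingarten's formula handles H, and the
  position vector contributes only a tangent vector.\<close>

lemma has_derivative_W:
  assumes y: "y \<in> U" and f: "smooth_on U f"
  shows "\<exists>W'. (W f lam has_derivative W') (at y) \<and>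
    (\<forall>u j. ip \<epsilon> (F y j) (W' u) = hessian h f y u (axis j 1) + ip \<epsilon> (H y) (II y u (axis j 1)) - lam * h y u (axis j 1)) \<and>
    (\<forall>u. nor \<epsilon> (F y) (W' u) = II y u (gradient h f y) - nor \<epsilon> (F y) (dir_deriv H y u))"
proof -
  interpret spacelike \<epsilon> "F y" by (rule spacelike_loc) fact
  let ?w = "gradient h f y"
  obtain D where D: "(gradient h f has_derivative D) (at y)" using has_derivative_gradient[OF y f] ..
  have T: "((\<lambda>p. comb (F p) (gradient h f p)) has_derivative (\<lambda>u. comb (F y) (D u) + D2 y u ?w)) (at y)"
    using has_derivative_comb[of F _ y, OF has_derivative_F[OF y] D] by (simp add: D2_comb[OF y])
  have 1: "(W f lam has_derivative (\<lambda>u. comb (F y) (D u) + D2 y u ?w - dir_deriv H y u - lam *\<^sub>R dir_deriv \<phi> y u)) (at y)"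
    unfolding W_def[abs_def]
    by (intro has_derivative_diff T has_derivative_H[OF y] has_derivative_scaleR_right smooth_on_has_derivative[OF smooth y])
  have ipT: "((\<lambda>p. ip \<epsilon> (F p j) (comb (F p) (gradient h f p))) has_derivative
      (\<lambda>u. ip \<epsilon> (F y j) (comb (F y) (D u) + D2 y u ?w) + ip \<epsilon> (D2 y u (axis j 1)) (comb (F y) ?w))) (at y)" for j
    by (intro bounded_bilinear.FDERIV[OF bounded_bilinear_ip] has_derivative_F y T)
  have "ip \<epsilon> (F p j) (comb (F p) (gradient h f p)) = dir_deriv f p (axis j 1)" if "p \<in> U" for p j
    using h_gradient(2)[OF that f, of "axis j 1"] by (simp add: h_def dphi[OF that] ip_commute)
  from has_derivative_transform_within_open[OF ipT open_U y this]
  have "((\<lambda>p. dir_deriv f p (axis j 1)) has_derivative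
      (\<lambda>u. ip \<epsilon> (F y j) (comb (F y) (D u) + D2 y u ?w) + ip \<epsilon> (D2 y u (axis j 1)) (comb (F y) ?w))) (at y)" for j
    .
  then have "dir_deriv (\<lambda>p. dir_deriv f p (axis j 1)) y u
      = ip \<epsilon> (F y j) (comb (F y) (D u) + D2 y u ?w) + ip \<epsilon> (D2 y u (axis j 1)) (comb (F y) ?w)" for j u
    by (rule dir_deriv_eqI)
  moreover have "ip \<epsilon> (D2 y u v) (comb (F y) ?w) = dir_deriv f y (\<Gamma> y u v)" for u v
    using h_gradient(2)[OF y f, of "\<Gamma> y u v"]
    by (simp add: D2_decomp[of y u v] ip_simps ip_II_F[OF y] h_def dphi[OF y] ip_commute)
  ultimately have hess: "ip \<epsilon> (F y j) (comb (F y) (D u) + D2 y u ?w) = hessian h f y u (axis j 1)" for j u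
    by (simp add: hessian_def christoffel_eq[OF y])
  have "ip \<epsilon> (F y j) (dir_deriv H y u) = - ip \<epsilon> (H y) (II y u (axis j 1))" for j u
    by (rule weingarten[OF y has_derivative_H[OF y]]) (rule nor_H)
  then have 2: "ip \<epsilon> (F y j) (comb (F y) (D u) + D2 y u ?w - dir_deriv H y u - lam *\<^sub>R dir_deriv \<phi> y u)
      = hessian h f y u (axis j 1) + ip \<epsilon> (H y) (II y u (axis j 1)) - lam * h y u (axis j 1)" for j u
    unfolding hess[symmetric] by (simp add: ip_simps h_def F_def[symmetric] ip_commute)
  have 3: "nor \<epsilon> (F y) (comb (F y) (D u) + D2 y u ?w - dir_deriv H y u - lam *\<^sub>R dir_deriv \<phi> y u)
      = II y u ?w - nor \<epsilon> (F y) (dir_deriv H y u)" for u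
    by (simp add: nor_simps dphi[OF y] II_def)
  from 1 2 3 show ?thesis by blast
qed

lemma soliton_iff:
  assumes y: "y \<in> U" and f: "smooth_on U f"
    and G: "\<forall>\<^sub>F p in nhds y. G p = graph_coord \<epsilon> (oriented_span (F y)) (oriented_span (F p))"
  shows "(\<forall>u v. ricci h y u v
        - (- \<epsilon>) * grass_metric \<epsilon> (oriented_span (F y)) (dir_deriv G y u) (dir_deriv G y v)
        + hessian h f y u v = lam * h y u v) \<and>
      tension h (hom_perp \<epsilon> (oriented_span (F y))) (grass_chart_metric \<epsilon> (oriented_span (F y))) G y
        = dir_deriv G y (gradient h f y)
    \<longleftrightarrow> (W f lam has_derivative (\<lambda>u. 0)) (at y)" (is "?E1 \<and> ?E2 \<longleftrightarrow> _")
proof -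
  interpret spacelike \<epsilon> "F y" by (rule spacelike_loc) fact
  obtain W' where W: "(W f lam has_derivative W') (at y)"
    and tan: "\<And>u j. ip \<epsilon> (F y j) (W' u) = hessian h f y u (axis j 1) + ip \<epsilon> (H y) (II y u (axis j 1)) - lam * h y u (axis j 1)"
    and nrm: "\<And>u. nor \<epsilon> (F y) (W' u) = II y u (gradient h f y) - nor \<epsilon> (F y) (dir_deriv H y u)"
    using has_derivative_W[OF y f] by blast
  have dG: "dir_deriv G y u = blin \<epsilon> (F y) (\<lambda>i. II y u (axis i 1))" for u
    by (rule dir_deriv_eqI[OF has_derivative_gauss[OF y G]])
  \<comment> \<open>One factor \<epsilon> comes from the metric of the Grassmannian and one from the
    coupling constant; with product 1, the pullback cancels the quadratic sum in
    \<open>ricci_eq\<close>.\<close>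
  have "\<epsilon> * \<epsilon> = 1" using eps by auto
  then have ric: "ricci h y u v - (- \<epsilon>) * grass_metric \<epsilon> (oriented_span (F y)) (dir_deriv G y u) (dir_deriv G y v)
      = ip \<epsilon> (H y) (II y u v)" for u v
    by (simp add: ricci_eq[OF y] grass_metric_eq dG mult.assoc[symmetric])
  \<comment> \<open>The tangential part of W' is tested on the frame only, whereas the soliton
    equation concerns all v. Linearity of the Hessian in its second argument rests on the smoothness
    of f.\<close>
  have lin: "linear (\<lambda>v. ip \<epsilon> (H y) (II y u v) + hessian h f y u v - lam * h y u v)" for u
  proof -
    have "linear (\<lambda>v. dir_deriv (\<lambda>p. dir_deriv f p v) y u)"
    proof (rule linearI)
      fix v w and r :: real
      have L: "linear (dir_deriv f p)" if "p \<in> U" for p by (rule smooth_on_dir_deriv_linear[OF f that])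
      have dd: "((\<lambda>p. dir_deriv f p v) has_derivative dir_deriv (\<lambda>p. dir_deriv f p v) y) (at y)" for v
        by (rule smooth_on_has_derivative[OF smooth_on_dir_deriv[OF f] y])
      have "dir_deriv (\<lambda>p. dir_deriv f p (v + w)) y u = dir_deriv (\<lambda>p. dir_deriv f p v + dir_deriv f p w) y u"
        by (intro dir_deriv_cong eventually_mono[OF ev_U[OF y]] linear_add L)
      also have "\<dots> = dir_deriv (\<lambda>p. dir_deriv f p v) y u + dir_deriv (\<lambda>p. dir_deriv f p w) y u"
        by (rule dir_deriv_eqI[OF has_derivative_add[OF dd dd]])
      finally show "dir_deriv (\<lambda>p. dir_deriv f p (v + w)) y u
          = dir_deriv (\<lambda>p. dir_deriv f p v) y u + dir_deriv (\<lambda>p. dir_deriv f p w) y u" .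
      have "dir_deriv (\<lambda>p. dir_deriv f p (r *\<^sub>R v)) y u = dir_deriv (\<lambda>p. r *\<^sub>R dir_deriv f p v) y u"
        by (intro dir_deriv_cong eventually_mono[OF ev_U[OF y]] linear_cmul L)
      also have "\<dots> = r *\<^sub>R dir_deriv (\<lambda>p. dir_deriv f p v) y u"
        by (rule dir_deriv_eqI[OF has_derivative_scaleR_right[OF dd]])
      finally show "dir_deriv (\<lambda>p. dir_deriv f p (r *\<^sub>R v)) y u = r *\<^sub>R dir_deriv (\<lambda>p. dir_deriv f p v) y u" .
    qed
    moreover have "linear (\<lambda>v. dir_deriv f y (\<Gamma> y u v))"
      using linear_compose[OF linear_compose[OF D2_linear[OF y] linear_dual] smooth_on_dir_deriv_linear[OF f y]]
      by (simp add: \<Gamma>_def o_def)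
    moreover have "linear (\<lambda>v. ip \<epsilon> (H y) (II y u v))"
      using linear_compose[OF II_linear[OF y] linear_ip_right] by (simp add: o_def)
    moreover have "linear (\<lambda>v. lam * h y u v)"
      using linear_compose_scale_right[OF linear_compose[OF smooth_on_dir_deriv_linear[OF smooth y] linear_ip_right], of lam]
      by (simp add: o_def h_def)
    ultimately show ?thesis
      unfolding hessian_def christoffel_eq[OF y]
      by (intro linear_compose_add linear_compose_sub) auto
  qed
  have "?E1 \<longleftrightarrow> (\<forall>u v. ip \<epsilon> (H y) (II y u v) + hessian h f y u v - lam * h y u v = 0)"
    unfolding ric by auto
  also have "\<dots> \<longleftrightarrow> (\<forall>u j. ip \<epsilon> (F y j) (W' u) = 0)"
  proof
    assume *: "\<forall>u j. ip \<epsilon> (F y j) (W' u) = 0"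
    then have "ip \<epsilon> (H y) (II y u (axis j 1)) + hessian h f y u (axis j 1) - lam * h y u (axis j 1) = 0" for u j
      by (simp add: tan add.commute)
    then show "\<forall>u v. ip \<epsilon> (H y) (II y u v) + hessian h f y u v - lam * h y u v = 0"
      by (subst linear_eq_comb[OF lin]) simp
  qed (simp add: tan add.commute)
  finally have E1: "?E1 \<longleftrightarrow> (\<forall>u j. ip \<epsilon> (F y j) (W' u) = 0)" .
  have linW: "linear W'" by (rule has_derivative_linear[OF W])
  have "?E2 \<longleftrightarrow> (\<forall>i. nor \<epsilon> (F y) (dir_deriv H y (axis i 1)) = II y (axis i 1) (gradient h f y))"
    unfolding tension_gauss[OF y G] dG blin_eq_iff by (simp add: fun_eq_iff II_sym[OF y, of "gradient h f y"])
  also have "\<dots> \<longleftrightarrow> (\<forall>i. nor \<epsilon> (F y) (W' (axis i 1)) = 0)"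
    unfolding nrm by auto
  also have "\<dots> \<longleftrightarrow> (\<forall>u. nor \<epsilon> (F y) (W' u) = 0)"
  proof
    assume *: "\<forall>i. nor \<epsilon> (F y) (W' (axis i 1)) = 0"
    have "linear (\<lambda>u. nor \<epsilon> (F y) (W' u))"
      using linear_compose[OF linW linear_nor] by (simp add: o_def)
    from linear_eq_comb[OF this] * show "\<forall>u. nor \<epsilon> (F y) (W' u) = 0" by simp
  qed simp
  finally have E2: "?E2 \<longleftrightarrow> (\<forall>u. nor \<epsilon> (F y) (W' u) = 0)" .
  have "?E1 \<and> ?E2 \<longleftrightarrow> (\<forall>u. W' u = 0)"
    unfolding E1 E2 using eq_0_iff_nor by blast
  also have "\<dots> \<longleftrightarrow> W' = (\<lambda>u. 0)" by (simp add: fun_eq_iff)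
  also have "\<dots> \<longleftrightarrow> (W f lam has_derivative (\<lambda>u. 0)) (at y)"
  proof
    assume "W' = (\<lambda>u. 0)"
    with W show "(W f lam has_derivative (\<lambda>u. 0)) (at y)" by (simp only:)
  qed (rule has_derivative_unique[OF W])
  finally show ?thesis .
qed

end

section \<open>Change of coordinates\<close>

lemma dir_deriv_chain:
  assumes "(\<tau> has_derivative \<tau>') (at y)" "(F has_derivative F') (at (\<tau> y))"
    and "\<forall>\<^sub>F p in nhds y. G p = F (\<tau> p)"
  shows "dir_deriv G y u = F' (\<tau>' u)"
  by (rule dir_deriv_eqI[OF has_derivative_cong_nhds[OF has_derivative_compose[OF assms(1,2)] assms(3)]])

text \<open>A transition map between two coordinate expressions of one immersion, developed as far
  as needed to see that the oriented tangent plane and \<open>W\<close> do not depend on the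
  chart.\<close>

locale patch_change =
  P1: immersion_patch \<epsilon> U1 \<phi>1 + P2: immersion_patch \<epsilon> U2 \<phi>2
  for \<epsilon> :: real and U1 U2 and \<phi>1 \<phi>2 :: "real^'n \<Rightarrow> ('n::finite, 'k::finite) ambient" +
  fixes \<tau> :: "real^'n \<Rightarrow> real^'n" and V :: "(real^'n) set"
  assumes open_V: "open V" and VU: "V \<subseteq> U1" and \<tau>U: "\<tau> ` V \<subseteq> U2" and smooth_\<tau>: "smooth_on V \<tau>"
    and \<phi>\<tau>: "\<And>p. p \<in> V \<Longrightarrow> \<phi>1 p = \<phi>2 (\<tau> p)"
    and det_\<tau>: "\<And>p. p \<in> V \<Longrightarrow> det (matrix (dir_deriv \<tau> p)) > 0"
begin

lemma ev_V: "y \<in> V \<Longrightarrow> \<forall>\<^sub>F p in nhds y. p \<in> V"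
  using open_V by (rule eventually_nhds_in_open)

lemma dphi_\<tau>:
  assumes "y \<in> V"
  shows "dir_deriv \<phi>1 y u = dir_deriv \<phi>2 (\<tau> y) (dir_deriv \<tau> y u)"
  by (rule dir_deriv_chain[OF smooth_on_has_derivative[OF smooth_\<tau>] smooth_on_has_derivative[OF P2.smooth]
      eventually_mono[OF ev_V]]) (use assms \<tau>U \<phi>\<tau> in auto)

text \<open>The transposed Jacobian matrix, because \<open>mact\<close> takes its coefficients from
  rows.\<close>

definition a :: "real^'n \<Rightarrow> real^'n^'n" where
  "a y = (\<chi> i. dir_deriv \<tau> y (axis i 1))"

lemma det_a: "y \<in> V \<Longrightarrow> det (a y) > 0"
proof -
  assume y: "y \<in> V"
  have "a y = transpose (matrix (dir_deriv \<tau> y))"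
    by (simp add: a_def vec_eq_iff transpose_def matrix_def)
  then show "det (a y) > 0" using det_\<tau>[OF y] by simp
qed

lemma F_\<tau>: "y \<in> V \<Longrightarrow> P1.F y = mact (a y) (P2.F (\<tau> y))"
  using \<tau>U P2.dphi[of "\<tau> y"] by (auto simp: fun_eq_iff P1.F_def dphi_\<tau> mact_def a_def)

lemma oriented_span_F: "y \<in> V \<Longrightarrow> oriented_span (P1.F y) = oriented_span (P2.F (\<tau> y))"
  by (simp add: F_\<tau> oriented_span_mact det_a)

lemma nor_F:
  assumes y: "y \<in> V"
  shows "nor \<epsilon> (P1.F y) v = nor \<epsilon> (P2.F (\<tau> y)) v"
proof -
  have "y \<in> U1" "\<tau> y \<in> U2" using y VU \<tau>U by auto
  then show ?thesis
    using spacelike.normal_part_eq[OF P1.spacelike_loc, of y v] spacelike.normal_part_eq[OF P2.spacelike_loc, of "\<tau> y" v]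
      arg_cong[OF oriented_span_F[OF y], of plane] by (simp add: plane_oriented_span)
qed

text \<open>In the chain rule the second derivatives of \<tau> occur only as coefficients of tangent
  vectors, which the normal projection annihilates.\<close>

lemma II_\<tau>:
  assumes y: "y \<in> V"
  shows "P1.II y u v = P2.II (\<tau> y) (dir_deriv \<tau> y u) (dir_deriv \<tau> y v)"
proof -
  have \<tau>y: "\<tau> y \<in> U2" using y \<tau>U by auto
  have "((\<lambda>p. P2.F (\<tau> p) i) has_derivative (\<lambda>u. P2.D2 (\<tau> y) (dir_deriv \<tau> y u) (axis i 1))) (at y)" for i
    by (rule has_derivative_compose[OF smooth_on_has_derivative[OF smooth_\<tau> y] P2.has_derivative_F[OF \<tau>y]])
  from has_derivative_comb[of "\<lambda>p. P2.F (\<tau> p)" _ y, OF this smooth_on_has_derivative[OF smooth_on_dir_deriv[OF smooth_\<tau>] y]]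
  have "((\<lambda>p. comb (P2.F (\<tau> p)) (dir_deriv \<tau> p v)) has_derivative
      (\<lambda>u. comb (P2.F (\<tau> y)) (dir_deriv (\<lambda>p. dir_deriv \<tau> p v) y u)
        + P2.D2 (\<tau> y) (dir_deriv \<tau> y u) (dir_deriv \<tau> y v))) (at y)"
    by (simp add: P2.D2_comb[OF \<tau>y])
  moreover have "dir_deriv \<phi>1 p v = comb (P2.F (\<tau> p)) (dir_deriv \<tau> p v)" if "p \<in> V" for p
    using that \<tau>U by (auto simp: dphi_\<tau> intro: P2.dphi)
  ultimately have "((\<lambda>p. dir_deriv \<phi>1 p v) has_derivative
      (\<lambda>u. comb (P2.F (\<tau> y)) (dir_deriv (\<lambda>p. dir_deriv \<tau> p v) y u)
        + P2.D2 (\<tau> y) (dir_deriv \<tau> y u) (dir_deriv \<tau> y v))) (at y)"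
    by (rule has_derivative_cong_nhds[OF _ eventually_mono[OF ev_V[OF y]]])
  then have "P1.D2 y u v = comb (P2.F (\<tau> y)) (dir_deriv (\<lambda>p. dir_deriv \<tau> p v) y u)
        + P2.D2 (\<tau> y) (dir_deriv \<tau> y u) (dir_deriv \<tau> y v)"
    unfolding P1.D2_def by (rule dir_deriv_eqI)
  then show ?thesis
    by (simp add: P1.II_def P2.II_def nor_F[OF y] nor_simps spacelike.nor_comb[OF P2.spacelike_loc[OF \<tau>y]])
qed

lemma H_\<tau>:
  assumes y: "y \<in> V"
  shows "P1.H y = P2.H (\<tau> y)"
proof -
  have y1: "y \<in> U1" and \<tau>y: "\<tau> y \<in> U2" using y VU \<tau>U by auto
  interpret spacelike \<epsilon> "P2.F (\<tau> y)" by (rule P2.spacelike_loc) fact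
  let ?g1 = "matrix_inv (gram \<epsilon> (P1.F y))"
  let ?g2 = "matrix_inv (gram \<epsilon> (P2.F (\<tau> y)))"
  let ?B = "\<lambda>k l. P2.II (\<tau> y) (axis k 1) (axis l 1)"
  have gram: "gram \<epsilon> (P1.F y) = a y ** gram \<epsilon> (P2.F (\<tau> y)) ** transpose (a y)"
    unfolding F_\<tau>[OF y] by (rule gram_mact)
  have g1: "a y ** gram \<epsilon> (P2.F (\<tau> y)) ** transpose (a y) ** ?g1 = mat 1"
    using matrix_inv_mult(2)[OF spacelike.det_gram[OF P1.spacelike_loc[OF y1]]] by (simp add: gram)
  then have "a y ** (gram \<epsilon> (P2.F (\<tau> y)) ** transpose (a y) ** ?g1) = mat 1"
    by (simp add: matrix_mul_assoc)
  then have "gram \<epsilon> (P2.F (\<tau> y)) ** transpose (a y) ** ?g1 ** a y = mat 1"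
    using matrix_left_right_inverse by blast
  \<comment> \<open>A right inverse of a square matrix is a left inverse, so \<open>a y\<close>
    could be moved cyclically to the other end of the product. The result is the transformation law
    that makes the trace invariant.\<close>
  then have g2: "?g2 = transpose (a y) ** ?g1 ** a y"
    by (intro matrix_inv_unique) (simp add: matrix_mul_assoc)
  have B: "P1.II y (axis i 1) (axis j 1) = (\<Sum>k\<in>UNIV. \<Sum>l\<in>UNIV. (a y $ i $ k * a y $ j $ l) *\<^sub>R ?B k l)" for i j
  proof -
    have "P1.II y (axis i 1) (axis j 1) = P2.II (\<tau> y) (a y $ i) (a y $ j)"
      by (simp add: II_\<tau>[OF y] a_def)
    also have "\<dots> = comb (\<lambda>l. P2.II (\<tau> y) (axis l 1) (a y $ i)) (a y $ j)"
      by (simp add: P2.II_comb[OF \<tau>y] P2.II_sym[OF \<tau>y, of "axis _ 1"])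
    also have "\<dots> = (\<Sum>l\<in>UNIV. a y $ j $ l *\<^sub>R (\<Sum>k\<in>UNIV. a y $ i $ k *\<^sub>R ?B k l))"
      by (simp add: comb_def P2.II_comb[OF \<tau>y, symmetric, of "axis _ 1" "a y $ i"] P2.II_sym[OF \<tau>y, of "axis _ 1" "axis _ 1"])
    also have "\<dots> = (\<Sum>k\<in>UNIV. \<Sum>l\<in>UNIV. (a y $ i $ k * a y $ j $ l) *\<^sub>R ?B k l)"
      by (subst sum.swap) (simp add: scaleR_sum_right mult.commute)
    finally show ?thesis .
  qed
  have "P1.H y = (\<Sum>i\<in>UNIV. \<Sum>j\<in>UNIV. \<Sum>k\<in>UNIV. \<Sum>l\<in>UNIV. (?g1 $ i $ j * (a y $ i $ k * a y $ j $ l)) *\<^sub>R ?B k l)"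
    by (simp add: P1.H_def B scaleR_sum_right)
  also have "\<dots> = (\<Sum>i\<in>UNIV. \<Sum>k\<in>UNIV. \<Sum>j\<in>UNIV. \<Sum>l\<in>UNIV. (?g1 $ i $ j * (a y $ i $ k * a y $ j $ l)) *\<^sub>R ?B k l)"
    by (intro sum.cong refl sum.swap)
  also have "\<dots> = (\<Sum>k\<in>UNIV. \<Sum>i\<in>UNIV. \<Sum>j\<in>UNIV. \<Sum>l\<in>UNIV. (?g1 $ i $ j * (a y $ i $ k * a y $ j $ l)) *\<^sub>R ?B k l)"
    by (rule sum.swap)
  also have "\<dots> = (\<Sum>k\<in>UNIV. \<Sum>i\<in>UNIV. \<Sum>l\<in>UNIV. \<Sum>j\<in>UNIV. (?g1 $ i $ j * (a y $ i $ k * a y $ j $ l)) *\<^sub>R ?B k l)"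
    by (intro sum.cong refl sum.swap)
  also have "\<dots> = (\<Sum>k\<in>UNIV. \<Sum>l\<in>UNIV. \<Sum>i\<in>UNIV. \<Sum>j\<in>UNIV. (?g1 $ i $ j * (a y $ i $ k * a y $ j $ l)) *\<^sub>R ?B k l)"
    by (intro sum.cong refl sum.swap)
  also have "\<dots> = (\<Sum>k\<in>UNIV. \<Sum>l\<in>UNIV. ?g2 $ k $ l *\<^sub>R ?B k l)"
  proof -
    have "?g2 $ k $ l = (\<Sum>i\<in>UNIV. \<Sum>j\<in>UNIV. ?g1 $ i $ j * (a y $ i $ k * a y $ j $ l))" for k l
    proof -
      have "?g2 $ k $ l = (\<Sum>j\<in>UNIV. \<Sum>i\<in>UNIV. ?g1 $ i $ j * (a y $ i $ k * a y $ j $ l))"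
        unfolding g2 by (simp add: matrix_matrix_mult_def transpose_def sum_distrib_left mult_ac)
      then show ?thesis by (subst sum.swap)
    qed
    then show ?thesis by (simp add: scaleR_sum_left)
  qed
  finally show ?thesis by (simp add: P2.H_def)
qed

text \<open>The differential of \<tau> maps the gradient of f1 to that of f2: the defining equation
  is transported to test vectors in the image of the differential, and these are all vectors because
  its determinant is positive.\<close>

lemma W_\<tau>:
  assumes y: "y \<in> V" and f1: "smooth_on U1 f1" and f2: "smooth_on U2 f2"
    and f: "\<And>p. p \<in> V \<Longrightarrow> f1 p = f2 (\<tau> p)"
  shows "P1.W f1 lam y = P2.W f2 lam (\<tau> y)"
proof -
  have y1: "y \<in> U1" and \<tau>y: "\<tau> y \<in> U2" using y VU \<tau>U by auto
  let ?w = "gradient P1.h f1 y"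
  have L: "linear (dir_deriv \<tau> y)" by (rule smooth_on_dir_deriv_linear[OF smooth_\<tau> y])
  have "dir_deriv f1 y z = dir_deriv f2 (\<tau> y) (dir_deriv \<tau> y z)" for z
    by (rule dir_deriv_chain[OF smooth_on_has_derivative[OF smooth_\<tau> y]
        smooth_on_has_derivative[OF f2 \<tau>y] eventually_mono[OF ev_V[OF y]]]) (rule f)
  then have grad: "P2.h (\<tau> y) (dir_deriv \<tau> y ?w) (dir_deriv \<tau> y z) = dir_deriv f2 (\<tau> y) (dir_deriv \<tau> y z)" for z
    using P1.h_gradient(2)[OF y1 f1, of z] by (simp add: P1.h_def P2.h_def dphi_\<tau>[OF y])
  have surj: "surj (dir_deriv \<tau> y)"
  proof -
    have "det (matrix (dir_deriv \<tau> y)) \<noteq> 0" using det_\<tau>[OF y] by simp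
    then have "\<exists>B. matrix (dir_deriv \<tau> y) ** B = mat 1" by (intro exI) (rule matrix_inv_mult(2))
    then have "surj ((*v) (matrix (dir_deriv \<tau> y)))" by (simp only: matrix_right_invertible_surjective)
    then show ?thesis by (simp add: matrix_vector_mul(2)[OF L])
  qed
  have "P2.h (\<tau> y) (dir_deriv \<tau> y ?w) z = dir_deriv f2 (\<tau> y) z" for z
  proof -
    obtain z' where "z = dir_deriv \<tau> y z'" using surj by (rule surjE)
    then show ?thesis using grad[of z'] by simp
  qed
  then have "gradient P2.h f2 (\<tau> y) = dir_deriv \<tau> y ?w" by (rule P2.gradient_unique[OF \<tau>y])
  then have "comb (P2.F (\<tau> y)) (gradient P2.h f2 (\<tau> y)) = comb (P1.F y) ?w"
    using P1.dphi[OF y1] P2.dphi[OF \<tau>y] dphi_\<tau>[OF y] by metis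
  then show ?thesis by (simp add: P1.W_def P2.W_def H_\<tau>[OF y] \<phi>\<tau>[OF y])
qed

end


section \<open>Immersed manifolds\<close>

locale immersed =
  fixes \<epsilon> :: real and \<A> :: "('a::{t2_space,second_countable_topology}, 'n::finite) chart set"
    and X :: "'a \<Rightarrow> ('n, 'k::finite) ambient"
  assumes eps: "\<epsilon> = 1 \<or> \<epsilon> = -1"
    and atlas: "oriented_atlas \<A>" and immersion: "spacelike_immersion \<epsilon> \<A> X"
begin

abbreviation U :: "('a, 'n) chart \<Rightarrow> (real^'n) set" where "U C \<equiv> snd C ` fst C"
abbreviation ph :: "('a, 'n) chart \<Rightarrow> real^'n \<Rightarrow> ('n, 'k) ambient" where "ph C \<equiv> X \<circ> chart_inv C"

lemma patch:
  assumes "C \<in> \<A>"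
  shows "immersion_patch \<epsilon> (U C) (ph C)"
  using assms eps atlas immersion
  by unfold_locales (auto simp: oriented_atlas_def spacelike_immersion_def smooth_map_def induced_metric_def)

lemma chart_homeomorphism:
  assumes "C \<in> \<A>"
  shows "open (fst C)" "open (U C)" "homeomorphism (fst C) (U C) (snd C) (chart_inv C)"
  using assms atlas unfolding oriented_atlas_def by blast+

lemma chart_inv_chart: "C \<in> \<A> \<Longrightarrow> x \<in> fst C \<Longrightarrow> chart_inv C (snd C x) = x"
  by (rule homeomorphism_apply1[OF chart_homeomorphism(3)])

lemma chart_chart_inv: "C \<in> \<A> \<Longrightarrow> y \<in> U C \<Longrightarrow> snd C (chart_inv C y) = y"
  by (rule homeomorphism_apply2[OF chart_homeomorphism(3)])

lemma chart_inv_in: "C \<in> \<A> \<Longrightarrow> y \<in> U C \<Longrightarrow> chart_inv C y \<in> fst C"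
  using homeomorphism_image2[OF chart_homeomorphism(3)] by blast

lemmas open_dom = chart_homeomorphism(1)
lemmas open_U = chart_homeomorphism(2)
lemmas continuous_chart = homeomorphism_cont1[OF chart_homeomorphism(3)]
lemmas continuous_chart_inv = homeomorphism_cont2[OF chart_homeomorphism(3)]

lemma ex_chart: "\<exists>C\<in>\<A>. x \<in> fst C"
  using atlas by (auto simp: oriented_atlas_def)

lemma change:
  assumes C: "C \<in> \<A>" and D: "D \<in> \<A>"
  shows "patch_change \<epsilon> (U C) (U D) (ph C) (ph D) (snd D \<circ> chart_inv C) (snd C ` (fst C \<inter> fst D))"
proof -
  interpret C: immersion_patch \<epsilon> "U C" "ph C" by (rule patch[OF C])
  interpret D: immersion_patch \<epsilon> "U D" "ph D" by (rule patch[OF D])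
  have "open (chart_inv C -` fst D \<inter> U C)"
    using continuous_on_open_vimage[OF open_U[OF C]] continuous_chart_inv[OF C] open_dom[OF D] by blast
  also have "chart_inv C -` fst D \<inter> U C = snd C ` (fst C \<inter> fst D)"
    using chart_inv_chart[OF C] by auto
  finally have "open (snd C ` (fst C \<inter> fst D))" .
  then show ?thesis
    using atlas C D chart_inv_chart[OF C] chart_inv_chart[OF D]
    by unfold_locales (auto simp: oriented_atlas_def)
qed

text \<open>The definition collects the bases coming from all charts at x. Each chart contributes
  one orbit of the matrices of positive determinant, and the positive Jacobians of the atlas make
  these orbits coincide.\<close>

lemma gauss_map_eq:
  assumes C: "C \<in> \<A>" and x: "x \<in> fst C"
  shows "gauss_map \<A> X x = oriented_span (immersion_patch.F (ph C) (snd C x))"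
proof -
  have span: "{(\<lambda>i. dir_deriv (ph D) (snd D x) (u i)) | u. det (\<chi> i. u i) > 0}
      = oriented_span (immersion_patch.F (ph D) (snd D x))" if D: "D \<in> \<A>" "x \<in> fst D" for D
  proof -
    interpret D: immersion_patch \<epsilon> "U D" "ph D" by (rule patch[OF D(1)])
    have y: "snd D x \<in> U D" using D by auto
    have "(\<lambda>i. dir_deriv (ph D) (snd D x) (u i)) = mact (\<chi> i. u i) (D.F (snd D x))" for u
      by (simp add: mact_def D.dphi[OF y] fun_eq_iff)
    then have "{(\<lambda>i. dir_deriv (ph D) (snd D x) (u i)) | u. det (\<chi> i. u i) > 0}
        = {mact (\<chi> i. u i) (D.F (snd D x)) | u. det (\<chi> i. u i) > 0}" by simp
    also have "\<dots> = {mact a (D.F (snd D x)) | a. det a > 0}"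
      by (intro Collect_cong) (metis vec_lambda_eta)
    finally show ?thesis by (simp add: oriented_span_eq)
  qed
  have indep: "oriented_span (immersion_patch.F (ph D) (snd D x)) = oriented_span (immersion_patch.F (ph C) (snd C x))"
    if D: "D \<in> \<A>" "x \<in> fst D" for D
    using patch_change.oriented_span_F[OF change[OF D(1) C], of "snd D x"] x D chart_inv_chart[OF D] by auto
  have "gauss_map \<A> X x
      = (\<Union>D\<in>{D\<in>\<A>. x \<in> fst D}. {(\<lambda>i. dir_deriv (ph D) (snd D x) (u i)) | u. det (\<chi> i. u i) > 0})"
    by (auto simp: gauss_map_def)
  also have "\<dots> = (\<Union>D\<in>{D\<in>\<A>. x \<in> fst D}. oriented_span (immersion_patch.F (ph C) (snd C x)))"
    using span indep by (intro SUP_cong) auto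
  also have "\<dots> = oriented_span (immersion_patch.F (ph C) (snd C x))" using C x by auto
  finally show ?thesis .
qed

lemma gauss_coord_eq:
  assumes C: "C \<in> \<A>" and x: "x \<in> fst C" and p: "p \<in> U C"
  shows "gauss_coord \<epsilon> \<A> X C x p = graph_coord \<epsilon> (oriented_span (immersion_patch.F (ph C) (snd C x)))
    (oriented_span (immersion_patch.F (ph C) p))"
  by (simp add: gauss_coord_def gauss_map_eq[OF C x] gauss_map_eq[OF C chart_inv_in[OF C p]] chart_chart_inv[OF C p])

lemma induced_metric_eq: "C \<in> \<A> \<Longrightarrow> induced_metric \<epsilon> X C = immersion_patch.h \<epsilon> (ph C)"
  by (simp add: fun_eq_iff induced_metric_def immersion_patch.h_def[OF patch])

lemma smooth_map_chart: "smooth_map \<A> f \<Longrightarrow> C \<in> \<A> \<Longrightarrow> smooth_on (U C) (f \<circ> chart_inv C)"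
  by (simp add: smooth_map_def)

lemma gradient_soliton_iff:
  assumes "\<alpha> = - \<epsilon>"
  shows "gradient_soliton \<epsilon> \<alpha> \<A> X f lam \<longleftrightarrow> smooth_map \<A> f \<and> (\<forall>C\<in>\<A>. \<forall>y\<in>U C.
    (immersion_patch.W \<epsilon> (ph C) (f \<circ> chart_inv C) lam has_derivative (\<lambda>u. 0)) (at y))"
proof -
  have eq: "((\<forall>u v. ricci (induced_metric \<epsilon> X C) (snd C x) u v
           - \<alpha> * grass_metric \<epsilon> (gauss_map \<A> X x) (d_gauss \<epsilon> \<A> X C x u) (d_gauss \<epsilon> \<A> X C x v)
           + hessian (induced_metric \<epsilon> X C) (f \<circ> chart_inv C) (snd C x) u v
         = lam * induced_metric \<epsilon> X C (snd C x) u v) \<and>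
       gauss_tension \<epsilon> \<A> X C x = d_gauss \<epsilon> \<A> X C x (gradient (induced_metric \<epsilon> X C) (f \<circ> chart_inv C) (snd C x)))
    \<longleftrightarrow> (immersion_patch.W \<epsilon> (ph C) (f \<circ> chart_inv C) lam has_derivative (\<lambda>u. 0)) (at (snd C x))"
    if f: "smooth_map \<A> f" and C: "C \<in> \<A>" and x: "x \<in> fst C" for C x
  proof -
    interpret C: immersion_patch \<epsilon> "U C" "ph C" by (rule patch[OF C])
    have y: "snd C x \<in> U C" using x by auto
    show ?thesis
      unfolding d_gauss_def gauss_tension_def induced_metric_eq[OF C] gauss_map_eq[OF C x] assms
      by (rule C.soliton_iff[OF y smooth_map_chart[OF f C]])
        (rule eventually_mono[OF C.ev_U[OF y]], rule gauss_coord_eq[OF C x])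
  qed
  have ball: "(\<forall>y\<in>U C. P y) \<longleftrightarrow> (\<forall>x\<in>fst C. P (snd C x))" for C and P :: "real^'n \<Rightarrow> bool" by auto
  show ?thesis
    unfolding gradient_soliton_def Let_def ball by (intro conj_cong ball_cong refl eq)
qed

section \<open>The equations of mean curvature flow solitons in charts\<close>

lemma tangent_plane_eq: "C \<in> \<A> \<Longrightarrow> y \<in> U C \<Longrightarrow> tangent_plane X C y = range (comb (immersion_patch.F (ph C) y))"
  using immersion_patch.dphi[OF patch] by (simp add: tangent_plane_def)

lemma normal_part_tangent_plane:
  assumes "C \<in> \<A>" "y \<in> U C"
  shows "normal_part \<epsilon> (tangent_plane X C y) v = nor \<epsilon> (immersion_patch.F (ph C) y) v"
  using assms by (simp add: tangent_plane_eq spacelike.normal_part_eq[OF immersion_patch.spacelike_loc[OF patch]])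

lemma mean_curvature_eq:
  assumes C: "C \<in> \<A>" and y: "y \<in> U C"
  shows "mean_curvature \<epsilon> X C y = immersion_patch.H \<epsilon> (ph C) y"
proof -
  interpret C: immersion_patch \<epsilon> "U C" "ph C" by (rule patch[OF C])
  have "second_fundamental_form \<epsilon> X C y = C.II y"
    by (simp add: fun_eq_iff second_fundamental_form_def normal_part_tangent_plane[OF C y] C.II_def C.D2_def)
  then show ?thesis by (simp add: mean_curvature_def induced_metric_eq[OF C] C.H_eq)
qed

lemma self_similar_iff: "self_similar \<epsilon> \<A> X lam \<longleftrightarrow> (\<forall>C\<in>\<A>. \<forall>y\<in>U C.
    immersion_patch.H \<epsilon> (ph C) y + lam *\<^sub>R nor \<epsilon> (immersion_patch.F (ph C) y) (ph C y) = 0)"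
proof -
  have "(\<forall>x\<in>fst C. mean_curvature \<epsilon> X C (snd C x) + lam *\<^sub>R normal_part \<epsilon> (tangent_plane X C (snd C x)) (X x) = 0)
    \<longleftrightarrow> (\<forall>y\<in>U C. immersion_patch.H \<epsilon> (ph C) y + lam *\<^sub>R nor \<epsilon> (immersion_patch.F (ph C) y) (ph C y) = 0)"
    if C: "C \<in> \<A>" for C
    using mean_curvature_eq[OF C] normal_part_tangent_plane[OF C] chart_inv_chart[OF C] by auto
  then show ?thesis unfolding self_similar_def by auto
qed

lemma translating_iff: "translating \<epsilon> \<A> X V \<longleftrightarrow> (\<forall>C\<in>\<A>. \<forall>y\<in>U C.
    immersion_patch.H \<epsilon> (ph C) y = nor \<epsilon> (immersion_patch.F (ph C) y) V)"
proof -
  have "(\<forall>x\<in>fst C. mean_curvature \<epsilon> X C (snd C x) = normal_part \<epsilon> (tangent_plane X C (snd C x)) V)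
    \<longleftrightarrow> (\<forall>y\<in>U C. immersion_patch.H \<epsilon> (ph C) y = nor \<epsilon> (immersion_patch.F (ph C) y) V)"
    if C: "C \<in> \<A>" for C
    using mean_curvature_eq[OF C] normal_part_tangent_plane[OF C] by auto
  then show ?thesis unfolding translating_def by auto
qed


subsection \<open>Solitons of the mean curvature flow are gradient solitons\<close>

text \<open>The gradient of (\<lambda>/2) |X|^2 is \<lambda> times the tangential part of X, so
  \<open>W\<close> is minus the left-hand side of the equation of a self-similar soliton.\<close>

lemma self_similar_imp_gradient_soliton:
  assumes \<alpha>: "\<alpha> = - \<epsilon>" and ss: "self_similar \<epsilon> \<A> X lam"
  shows "gradient_soliton \<epsilon> \<alpha> \<A> X (\<lambda>x. lam / 2 * ip \<epsilon> (X x) (X x)) lam"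
proof -
  let ?f = "\<lambda>x. lam / 2 * ip \<epsilon> (X x) (X x)"
  have sm: "smooth_map \<A> ?f"
    unfolding smooth_map_def
  proof
    fix C assume C: "C \<in> \<A>"
    interpret C: immersion_patch \<epsilon> "U C" "ph C" by (rule patch[OF C])
    show "smooth_on (U C) (?f \<circ> chart_inv C)"
      using smooth_on_bounded_linear[OF bounded_linear_mult_right C.open_U
          smooth_on_bilinear[OF bounded_bilinear_ip C.open_U C.smooth C.smooth], of "lam / 2" \<epsilon>]
      by (simp add: o_def)
  qed
  have "(immersion_patch.W \<epsilon> (ph C) (?f \<circ> chart_inv C) lam has_derivative (\<lambda>u. 0)) (at y)"
    if C: "C \<in> \<A>" and y: "y \<in> U C" for C y
  proof -
    interpret C: immersion_patch \<epsilon> "U C" "ph C" by (rule patch[OF C])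
    show ?thesis
    proof (rule has_derivative_zero_on_open[OF C.open_U y])
      fix p assume p: "p \<in> U C"
      interpret spacelike \<epsilon> "C.F p" by (rule C.spacelike_loc[OF p])
      have "((\<lambda>p. lam / 2 * ip \<epsilon> (ph C p) (ph C p)) has_derivative
          (\<lambda>u. lam / 2 * (ip \<epsilon> (ph C p) (dir_deriv (ph C) p u) + ip \<epsilon> (dir_deriv (ph C) p u) (ph C p)))) (at p)"
        by (intro has_derivative_mult_right bounded_bilinear.FDERIV[OF bounded_bilinear_ip]
            smooth_on_has_derivative[OF C.smooth p])
      from dir_deriv_eqI[OF this]
      have "dir_deriv (?f \<circ> chart_inv C) p z = lam * ip \<epsilon> (ph C p) (dir_deriv (ph C) p z)" for z
        by (simp add: o_def ip_commute)
      moreover have "C.h p (lam *\<^sub>R dual \<epsilon> (C.F p) (ph C p)) z = lam * ip \<epsilon> (ph C p) (dir_deriv (ph C) p z)" for z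
      proof -
        have "ip \<epsilon> (tang \<epsilon> (C.F p) (ph C p)) (comb (C.F p) z) + ip \<epsilon> (nor \<epsilon> (C.F p) (ph C p)) (comb (C.F p) z)
            = ip \<epsilon> (ph C p) (comb (C.F p) z)"
          by (simp only: ip_simps(3,4)[symmetric] tang_plus_nor)
        then show ?thesis
          by (simp add: C.h_def C.dphi[OF p] comb_scaleR_right ip_simps tang_def)
      qed
      ultimately have "gradient C.h (?f \<circ> chart_inv C) p = lam *\<^sub>R dual \<epsilon> (C.F p) (ph C p)"
        by (intro C.gradient_unique[OF p]) simp
      then have "C.W (?f \<circ> chart_inv C) lam p = - (C.H p + lam *\<^sub>R nor \<epsilon> (C.F p) (ph C p))"
        by (simp add: C.W_def comb_scaleR_right nor_def tang_def algebra_simps)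
      moreover have "C.H p + lam *\<^sub>R nor \<epsilon> (C.F p) (ph C p) = 0"
        by (rule ss[unfolded self_similar_iff, rule_format, OF C p])
      ultimately show "C.W (?f \<circ> chart_inv C) lam p = 0" by (simp only: minus_zero)
    qed
  qed
  with sm show ?thesis by (simp add: gradient_soliton_iff[OF \<alpha>])
qed

text \<open>The gradient of -<X, V> is minus the tangential part of V; as H is the normal part of V,
  this gives the constant value - V of \<open>W\<close>.\<close>

lemma translating_imp_gradient_soliton:
  assumes \<alpha>: "\<alpha> = - \<epsilon>" and tr: "translating \<epsilon> \<A> X V"
  shows "gradient_soliton \<epsilon> \<alpha> \<A> X (\<lambda>x. - ip \<epsilon> (X x) V) 0"
proof -
  let ?f = "\<lambda>x. - ip \<epsilon> (X x) V"
  have bl: "bounded_linear (\<lambda>v. - ip \<epsilon> v V)"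
    by (intro bounded_linear_minus bounded_bilinear.bounded_linear_left[OF bounded_bilinear_ip])
  have sm: "smooth_map \<A> ?f"
    unfolding smooth_map_def
  proof
    fix C assume C: "C \<in> \<A>"
    interpret C: immersion_patch \<epsilon> "U C" "ph C" by (rule patch[OF C])
    show "smooth_on (U C) (?f \<circ> chart_inv C)"
      using smooth_on_bounded_linear[OF bl C.open_U C.smooth] by (simp add: o_def)
  qed
  have "(immersion_patch.W \<epsilon> (ph C) (?f \<circ> chart_inv C) 0 has_derivative (\<lambda>u. 0)) (at y)"
    if C: "C \<in> \<A>" and y: "y \<in> U C" for C y
  proof -
    interpret C: immersion_patch \<epsilon> "U C" "ph C" by (rule patch[OF C])
    show ?thesis
    proof (rule has_derivative_zero_on_open[OF C.open_U y])
      fix p assume p: "p \<in> U C"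
      interpret spacelike \<epsilon> "C.F p" by (rule C.spacelike_loc[OF p])
      have "dir_deriv (?f \<circ> chart_inv C) p z = - ip \<epsilon> (dir_deriv (ph C) p z) V" for z
        using dir_deriv_bounded_linear[OF bl C.smooth p, of z] by (simp add: o_def)
      moreover have "C.h p (- dual \<epsilon> (C.F p) V) z = - ip \<epsilon> (dir_deriv (ph C) p z) V" for z
      proof -
        have "ip \<epsilon> (tang \<epsilon> (C.F p) V) (comb (C.F p) z) + ip \<epsilon> (nor \<epsilon> (C.F p) V) (comb (C.F p) z)
            = ip \<epsilon> V (comb (C.F p) z)"
          by (simp only: ip_simps(3,4)[symmetric] tang_plus_nor)
        then show ?thesis
          by (simp add: C.h_def C.dphi[OF p] comb_minus_right ip_simps tang_def ip_commute[of \<epsilon> V])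
      qed
      ultimately have "gradient C.h (?f \<circ> chart_inv C) p = - dual \<epsilon> (C.F p) V"
        by (intro C.gradient_unique[OF p]) simp
      moreover have "C.H p = nor \<epsilon> (C.F p) V" by (rule tr[unfolded translating_iff, rule_format, OF C p])
      ultimately show "C.W (?f \<circ> chart_inv C) 0 p = - V"
        by (simp add: C.W_def comb_minus_right nor_def tang_def)
    qed
  qed
  with sm show ?thesis by (simp add: gradient_soliton_iff[OF \<alpha>])
qed


subsection \<open>Gradient solitons are solitons of the mean curvature flow\<close>

text \<open>A vanishing derivative on a ball inside a chart makes Q constant on an open subset of
  the manifold, and a locally constant function on a connected space is constant.\<close>

lemma constant_if_derivative_zero:
  fixes Q :: "'a \<Rightarrow> 'b::real_normed_vector"
  assumes conn: "connected (UNIV :: 'a set)"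
    and Q: "\<And>C y. C \<in> \<A> \<Longrightarrow> y \<in> U C \<Longrightarrow> ((Q \<circ> chart_inv C) has_derivative (\<lambda>u. 0)) (at y)"
  shows "\<exists>c. \<forall>x. Q x = c"
proof -
  have "\<forall>\<^sub>F x' in nhds x. Q x = Q x'" for x
  proof -
    obtain C where C: "C \<in> \<A>" and x: "x \<in> fst C" using ex_chart by blast
    then have y: "snd C x \<in> U C" by auto
    then obtain r where r: "r > 0" "ball (snd C x) r \<subseteq> U C"
      using open_U[OF C] open_contains_ball by blast
    have "\<exists>c. \<forall>p\<in>ball (snd C x) r. (Q \<circ> chart_inv C) p = c"
      by (rule has_derivative_zero_constant[OF convex_ball])
        (use Q[OF C] r(2) has_derivative_at_withinI in blast)
    then obtain c where c: "\<And>p. p \<in> ball (snd C x) r \<Longrightarrow> Q (chart_inv C p) = c" by auto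
    have "open (snd C -` ball (snd C x) r \<inter> fst C)"
      using continuous_on_open_vimage[OF open_dom[OF C]] continuous_chart[OF C] by blast
    moreover have "x \<in> snd C -` ball (snd C x) r \<inter> fst C" using x r(1) by simp
    moreover have "Q x' = c" if "x' \<in> snd C -` ball (snd C x) r \<inter> fst C" for x'
      using c[of "snd C x'"] that chart_inv_chart[OF C, of x'] by simp
    ultimately show ?thesis unfolding eventually_nhds by metis
  qed
  then have "\<forall>\<^sub>F x' in at x within UNIV. Q x = Q x'" for x
    unfolding eventually_at_filter by (rule eventually_mono) auto
  then have "Q x = Q x'" for x x' by (intro connected_local_const[OF conn]) auto
  then show ?thesis by blast
qed

lemma gradient_soliton_constant:
  assumes conn: "connected (UNIV :: 'a set)" and \<alpha>: "\<alpha> = - \<epsilon>"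
    and gs: "gradient_soliton \<epsilon> \<alpha> \<A> X f lam"
  shows "\<exists>c. \<forall>C\<in>\<A>. \<forall>y\<in>U C. immersion_patch.W \<epsilon> (ph C) (f \<circ> chart_inv C) lam y = c"
proof -
  have f: "smooth_map \<A> f" and W0: "\<And>C y. C \<in> \<A> \<Longrightarrow> y \<in> U C \<Longrightarrow>
    (immersion_patch.W \<epsilon> (ph C) (f \<circ> chart_inv C) lam has_derivative (\<lambda>u. 0)) (at y)"
    using gs unfolding gradient_soliton_iff[OF \<alpha>] by auto
  \<comment> \<open>This is \<open>W\<close> as a function on the manifold, each point using some
    chart around it; by \<open>W_\<tau>\<close> the chart is immaterial.\<close>
  define Q where "Q = (\<lambda>x. let C = (SOME C. C \<in> \<A> \<and> x \<in> fst C) in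
    immersion_patch.W \<epsilon> (ph C) (f \<circ> chart_inv C) lam (snd C x))"
  have Q: "Q x = immersion_patch.W \<epsilon> (ph C) (f \<circ> chart_inv C) lam (snd C x)" if C: "C \<in> \<A>" and x: "x \<in> fst C" for C x
  proof -
    define D where "D = (SOME C. C \<in> \<A> \<and> x \<in> fst C)"
    have "\<exists>C. C \<in> \<A> \<and> x \<in> fst C" using C x by auto
    from someI_ex[OF this] have D: "D \<in> \<A>" "x \<in> fst D" unfolding D_def by blast+
    have "immersion_patch.W \<epsilon> (ph D) (f \<circ> chart_inv D) lam (snd D x)
        = immersion_patch.W \<epsilon> (ph C) (f \<circ> chart_inv C) lam ((snd C \<circ> chart_inv D) (snd D x))"
      by (rule patch_change.W_\<tau>[OF change[OF D(1) C] _ smooth_map_chart[OF f D(1)] smooth_map_chart[OF f C]])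
        (use D x chart_inv_chart[OF D(1)] chart_inv_chart[OF C] in auto)
    then show ?thesis by (simp add: Q_def D_def[symmetric] chart_inv_chart[OF D])
  qed
  have "((Q \<circ> chart_inv C) has_derivative (\<lambda>u. 0)) (at y)" if C: "C \<in> \<A>" and y: "y \<in> U C" for C y
    by (rule has_derivative_transform_within_open[OF W0[OF C y] open_U[OF C] y])
      (simp add: Q[OF C chart_inv_in[OF C]] chart_chart_inv[OF C])
  from constant_if_derivative_zero[OF conn this] obtain c where c: "\<And>x. Q x = c" by blast
  have "immersion_patch.W \<epsilon> (ph C) (f \<circ> chart_inv C) lam y = c" if C: "C \<in> \<A>" and y: "y \<in> U C" for C y
    using Q[OF C chart_inv_in[OF C y]] c chart_chart_inv[OF C y] by simp
  then show ?thesis by (intro exI ballI)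
qed

text \<open>Recovers a potential from its differential; this is where the additive constant in the
  converse statements arises.\<close>

lemma smooth_function_constant:
  fixes f Q :: "'a \<Rightarrow> real"
  assumes conn: "connected (UNIV :: 'a set)" and f: "smooth_map \<A> f" and Q: "smooth_map \<A> Q"
    and eq: "\<And>C y z. C \<in> \<A> \<Longrightarrow> y \<in> U C \<Longrightarrow> dir_deriv (f \<circ> chart_inv C) y z = dir_deriv (Q \<circ> chart_inv C) y z"
  shows "\<exists>c. f = (\<lambda>x. Q x + c)"
proof -
  have "(((\<lambda>x. f x - Q x) \<circ> chart_inv C) has_derivative (\<lambda>u. 0)) (at y)" if C: "C \<in> \<A>" and y: "y \<in> U C" for C y
  proof -
    have "((\<lambda>p. (f \<circ> chart_inv C) p - (Q \<circ> chart_inv C) p) has_derivative (\<lambda>u. 0)) (at y)"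
      using has_derivative_diff[OF smooth_on_has_derivative[OF smooth_map_chart[OF f C] y]
        smooth_on_has_derivative[OF smooth_map_chart[OF Q C] y]] by (simp only: eq[OF C y] diff_self)
    then show ?thesis by (simp only: o_def)
  qed
  from constant_if_derivative_zero[OF conn this] obtain c where "\<And>x. f x - Q x = c" by blast
  then have "f = (\<lambda>x. Q x + c)" by (simp add: fun_eq_iff algebra_simps)
  then show ?thesis by blast
qed

lemma gradient_soliton_imp_translating:
  assumes conn: "connected (UNIV :: 'a set)" and \<alpha>: "\<alpha> = - \<epsilon>"
    and gs: "gradient_soliton \<epsilon> \<alpha> \<A> X f 0"
  shows "\<exists>V c. translating \<epsilon> \<A> X V \<and> f = (\<lambda>x. - ip \<epsilon> (X x) V + c)"
proof -
  from gradient_soliton_constant[OF assms] obtain c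
    where c: "\<And>C y. C \<in> \<A> \<Longrightarrow> y \<in> U C \<Longrightarrow> immersion_patch.W \<epsilon> (ph C) (f \<circ> chart_inv C) 0 y = c" by blast
  have f: "smooth_map \<A> f" using gs by (simp add: gradient_soliton_def)
  \<comment> \<open>The gradient term of \<open>W\<close> is tangential and H is normal, so the
    constant value c has normal part - H. Hence V = - c.\<close>
  have tr: "translating \<epsilon> \<A> X (- c)"
    unfolding translating_iff
  proof (intro ballI)
    fix C y assume C: "C \<in> \<A>" and y: "y \<in> U C"
    interpret C: immersion_patch \<epsilon> "U C" "ph C" by (rule patch[OF C])
    interpret spacelike \<epsilon> "C.F y" by (rule C.spacelike_loc[OF y])
    show "C.H y = nor \<epsilon> (C.F y) (- c)"
      unfolding c[OF C y, symmetric] by (simp add: C.W_def nor_simps C.nor_H[OF y])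
  qed
  have sQ: "smooth_map \<A> (\<lambda>x. - ip \<epsilon> (X x) (- c))"
    using translating_imp_gradient_soliton[OF \<alpha> tr] by (simp add: gradient_soliton_def)
  have "\<exists>d. f = (\<lambda>x. - ip \<epsilon> (X x) (- c) + d)"
  proof (rule smooth_function_constant[OF conn f sQ])
    fix C y z assume C: "C \<in> \<A>" and y: "y \<in> U C"
    interpret C: immersion_patch \<epsilon> "U C" "ph C" by (rule patch[OF C])
    interpret spacelike \<epsilon> "C.F y" by (rule C.spacelike_loc[OF y])
    let ?w = "gradient C.h (f \<circ> chart_inv C) y"
    have bl: "bounded_linear (\<lambda>v. - ip \<epsilon> v (- c))"
      by (intro bounded_linear_minus bounded_bilinear.bounded_linear_left[OF bounded_bilinear_ip])
    have "dir_deriv (f \<circ> chart_inv C) y z = ip \<epsilon> (comb (C.F y) z) (comb (C.F y) ?w)"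
      using C.h_gradient(2)[OF y smooth_map_chart[OF f C], of z] by (simp add: C.h_def C.dphi[OF y] ip_commute)
    \<comment> \<open>The constancy of \<open>W\<close> expresses the gradient as c + H, and H does
      not pair with tangent vectors; so c alone determines the differential of f.\<close>
    also have "\<dots> = ip \<epsilon> (comb (C.F y) z) (c + C.H y)"
      using c[OF C y] by (simp add: C.W_def algebra_simps)
    also have "\<dots> = ip \<epsilon> (comb (C.F y) z) c"
      using ip_comb_nor(1)[of z "C.H y"] by (simp add: ip_simps C.nor_H[OF y])
    also have "\<dots> = dir_deriv ((\<lambda>x. - ip \<epsilon> (X x) (- c)) \<circ> chart_inv C) y z"
      using dir_deriv_bounded_linear[OF bl C.smooth y, of z] by (simp add: o_def ip_simps C.dphi[OF y, unfolded o_def])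
    finally show "dir_deriv (f \<circ> chart_inv C) y z = dir_deriv ((\<lambda>x. - ip \<epsilon> (X x) (- c)) \<circ> chart_inv C) y z" .
  qed
  with tr show ?thesis by blast
qed

end


subsection \<open>Translations of the ambient space\<close>

lemma dir_deriv_comp_diff_const [simp]: "dir_deriv ((\<lambda>x. X x - p) \<circ> g) = dir_deriv (X \<circ> g)"
  using dir_deriv_diff_const[of "X \<circ> g" p] by (simp add: o_def)

lemma dir_deriv_comp_add_const [simp]: "dir_deriv ((\<lambda>x. X x + p) \<circ> g) = dir_deriv (X \<circ> g)"
  using dir_deriv_add_const[of "X \<circ> g" p] by (simp add: o_def)

lemma induced_metric_translate [simp]: "induced_metric \<epsilon> (\<lambda>x. X x - p) = induced_metric \<epsilon> X"
  by (simp add: fun_eq_iff induced_metric_def)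

lemma gauss_map_translate [simp]: "gauss_map \<A> (\<lambda>x. X x - p) = gauss_map \<A> X"
  by (simp add: fun_eq_iff gauss_map_def)

lemma tangent_plane_translate [simp]: "tangent_plane (\<lambda>x. X x - p) = tangent_plane X"
  by (simp add: fun_eq_iff tangent_plane_def)

lemma mean_curvature_translate [simp]: "mean_curvature \<epsilon> (\<lambda>x. X x - p) = mean_curvature \<epsilon> X"
proof -
  have "second_fundamental_form \<epsilon> (\<lambda>x. X x - p) = second_fundamental_form \<epsilon> X"
    by (simp add: fun_eq_iff second_fundamental_form_def)
  then show ?thesis by (intro ext) (simp add: mean_curvature_def)
qed

lemma translating_translate [simp]: "translating \<epsilon> \<A> (\<lambda>x. X x - p) V \<longleftrightarrow> translating \<epsilon> \<A> X V"
  by (simp add: translating_def)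

text \<open>X enters these equations only through its derivatives. Results about solitons centred at
  the origin, applied to X - p, therefore yield gradient solitons for X.\<close>

lemma gradient_soliton_translate [simp]:
  "gradient_soliton \<epsilon> \<alpha> \<A> (\<lambda>x. X x - p) f lam \<longleftrightarrow> gradient_soliton \<epsilon> \<alpha> \<A> X f lam"
proof -
  have "gauss_coord \<epsilon> \<A> (\<lambda>x. X x - p) = gauss_coord \<epsilon> \<A> X"
    by (simp add: fun_eq_iff gauss_coord_def)
  then have "d_gauss \<epsilon> \<A> (\<lambda>x. X x - p) = d_gauss \<epsilon> \<A> X"
    "gauss_tension \<epsilon> \<A> (\<lambda>x. X x - p) = gauss_tension \<epsilon> \<A> X"
    by (intro ext, simp add: d_gauss_def gauss_tension_def)+
  then show ?thesis by (simp add: gradient_soliton_def)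
qed

context immersed
begin

lemma immersed_translate: "immersed \<epsilon> \<A> (\<lambda>x. X x - p)"
proof
  have "smooth_on (U C) ((\<lambda>x. X x - p) \<circ> chart_inv C)" if C: "C \<in> \<A>" for C
    using smooth_on_add[OF open_U[OF C] _ smooth_on_const[of _ "- p"], of "ph C"] immersion C
    by (simp add: spacelike_immersion_def smooth_map_def o_def)
  then show "spacelike_immersion \<epsilon> \<A> (\<lambda>x. X x - p)"
    using immersion by (simp add: spacelike_immersion_def smooth_map_def)
qed (fact eps atlas)+

lemma gradient_soliton_add_const:
  assumes "gradient_soliton \<epsilon> \<alpha> \<A> X f lam"
  shows "gradient_soliton \<epsilon> \<alpha> \<A> X (\<lambda>x. f x + c) lam"
proof -
  have "smooth_on (U C) ((\<lambda>x. f x + c) \<circ> chart_inv C)" if C: "C \<in> \<A>" for C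
    using smooth_on_add[OF open_U[OF C] _ smooth_on_const[of _ c], of "f \<circ> chart_inv C"] assms C
    by (simp add: gradient_soliton_def smooth_map_def o_def)
  then show ?thesis
    using assms by (simp add: gradient_soliton_def smooth_map_def hessian_def gradient_def)
qed

lemma self_similar_translate_imp_gradient_soliton:
  assumes "\<alpha> = - \<epsilon>" and "self_similar \<epsilon> \<A> (\<lambda>x. X x - p) lam"
  shows "gradient_soliton \<epsilon> \<alpha> \<A> X (\<lambda>x. lam / 2 * ip \<epsilon> (X x - p) (X x - p) + c) lam"
  using immersed.self_similar_imp_gradient_soliton[OF immersed_translate assms]
  by (intro gradient_soliton_add_const) simp

lemma gradient_soliton_imp_self_similar:
  assumes conn: "connected (UNIV :: 'a set)" and \<alpha>: "\<alpha> = - \<epsilon>" and lam: "lam \<noteq> 0"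
    and gs: "gradient_soliton \<epsilon> \<alpha> \<A> X f lam"
  shows "\<exists>p c. self_similar \<epsilon> \<A> (\<lambda>x. X x - p) lam \<and> f = (\<lambda>x. lam / 2 * ip \<epsilon> (X x - p) (X x - p) + c)"
proof -
  from gradient_soliton_constant[OF conn \<alpha> gs] obtain c
    where c: "\<And>C y. C \<in> \<A> \<Longrightarrow> y \<in> U C \<Longrightarrow> immersion_patch.W \<epsilon> (ph C) (f \<circ> chart_inv C) lam y = c" by blast
  have f: "smooth_map \<A> f" using gs by (simp add: gradient_soliton_def)
  \<comment> \<open>Chosen so that c = - \<lambda> p, which makes \<open>W\<close> vanish for the
    translate X - p with the same potential. Here \<lambda> \<noteq> 0 is essential; for \<lambda> =
    0 the constant becomes the vector V instead.\<close>
  define p where "p = - ((1 / lam) *\<^sub>R c)"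
  have cp: "c = - (lam *\<^sub>R p)" using lam by (simp add: p_def)
  have grad: "comb (immersion_patch.F (ph C) y) (gradient (immersion_patch.h \<epsilon> (ph C)) (f \<circ> chart_inv C) y)
      = immersion_patch.H \<epsilon> (ph C) y + lam *\<^sub>R (X (chart_inv C y) - p)" if "C \<in> \<A>" "y \<in> U C" for C y
    using c[OF that] by (simp add: immersion_patch.W_def[OF patch[OF that(1)]] cp algebra_simps)
  have ss: "self_similar \<epsilon> \<A> (\<lambda>x. X x - p) lam"
    unfolding self_similar_def mean_curvature_translate tangent_plane_translate
  proof (intro ballI)
    fix C x assume C: "C \<in> \<A>" and x: "x \<in> fst C"
    then have y: "snd C x \<in> U C" by auto
    interpret C: immersion_patch \<epsilon> "U C" "ph C" by (rule patch[OF C])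
    interpret spacelike \<epsilon> "C.F (snd C x)" by (rule C.spacelike_loc[OF y])
    have "nor \<epsilon> (C.F (snd C x)) (C.H (snd C x) + lam *\<^sub>R (X x - p)) = 0"
      using grad[OF C y, symmetric] by (simp add: chart_inv_chart[OF C x])
    then show "mean_curvature \<epsilon> X C (snd C x) + lam *\<^sub>R normal_part \<epsilon> (tangent_plane X C (snd C x)) (X x - p) = 0"
      by (simp add: mean_curvature_eq[OF C y] normal_part_tangent_plane[OF C y] C.nor_H[OF y]
          linear_add[OF linear_nor, of _ _ "C.H (snd C x)"] linear_cmul[OF linear_nor])
  qed
  have sQ: "smooth_map \<A> (\<lambda>x. lam / 2 * ip \<epsilon> (X x - p) (X x - p))"
    using immersed.self_similar_imp_gradient_soliton[OF immersed_translate \<alpha> ss] by (simp add: gradient_soliton_def)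
  have "\<exists>d. f = (\<lambda>x. lam / 2 * ip \<epsilon> (X x - p) (X x - p) + d)"
  proof (rule smooth_function_constant[OF conn f sQ])
    fix C y z assume C: "C \<in> \<A>" and y: "y \<in> U C"
    interpret C: immersion_patch \<epsilon> "U C" "ph C" by (rule patch[OF C])
    interpret spacelike \<epsilon> "C.F y" by (rule C.spacelike_loc[OF y])
    let ?w = "gradient C.h (f \<circ> chart_inv C) y"
    have "dir_deriv (f \<circ> chart_inv C) y z = ip \<epsilon> (comb (C.F y) z) (comb (C.F y) ?w)"
      using C.h_gradient(2)[OF y smooth_map_chart[OF f C], of z] by (simp add: C.h_def C.dphi[OF y] ip_commute)
    also have "\<dots> = lam * ip \<epsilon> (comb (C.F y) z) (ph C y - p)"
      using ip_comb_nor(1)[of z "C.H y"]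
      by (simp add: grad[OF C y] C.nor_H[OF y] linear_add[OF linear_ip_right] linear_cmul[OF linear_ip_right])
    also have "\<dots> = dir_deriv ((\<lambda>x. lam / 2 * ip \<epsilon> (X x - p) (X x - p)) \<circ> chart_inv C) y z"
    proof -
      have d: "((\<lambda>q. ph C q - p) has_derivative dir_deriv (ph C) y) (at y)"
        using has_derivative_diff[OF smooth_on_has_derivative[OF C.smooth y] has_derivative_const[of p]] by simp
      have "((\<lambda>q. lam / 2 * ip \<epsilon> (ph C q - p) (ph C q - p)) has_derivative
          (\<lambda>u. lam / 2 * (ip \<epsilon> (ph C y - p) (dir_deriv (ph C) y u) + ip \<epsilon> (dir_deriv (ph C) y u) (ph C y - p)))) (at y)"
        by (intro has_derivative_mult_right bounded_bilinear.FDERIV[OF bounded_bilinear_ip] d)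
      from dir_deriv_eqI[OF this, of z] show ?thesis
        by (simp add: o_def ip_commute C.dphi[OF y, unfolded o_def])
    qed
    finally show "dir_deriv (f \<circ> chart_inv C) y z
        = dir_deriv ((\<lambda>x. lam / 2 * ip \<epsilon> (X x - p) (X x - p)) \<circ> chart_inv C) y z" .
  qed
  with ss show ?thesis by blast
qed

lemma gradient_soliton_iff_self_similar:
  assumes "connected (UNIV :: 'a set)" "\<alpha> = - \<epsilon>" "lam \<noteq> 0"
  shows "gradient_soliton \<epsilon> \<alpha> \<A> X f lam \<longleftrightarrow>
    (\<exists>p c. self_similar \<epsilon> \<A> (\<lambda>x. X x - p) lam \<and> f = (\<lambda>x. lam / 2 * ip \<epsilon> (X x - p) (X x - p) + c))"
  using gradient_soliton_imp_self_similar[OF assms] self_similar_translate_imp_gradient_soliton[OF assms(2)]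
  by blast

lemma gradient_soliton_iff_translating:
  assumes "connected (UNIV :: 'a set)" "\<alpha> = - \<epsilon>"
  shows "gradient_soliton \<epsilon> \<alpha> \<A> X f 0 \<longleftrightarrow>
    (\<exists>V c. translating \<epsilon> \<A> X V \<and> f = (\<lambda>x. - ip \<epsilon> (X x) V + c))"
  using gradient_soliton_imp_translating[OF assms]
    gradient_soliton_add_const[OF translating_imp_gradient_soliton[OF assms(2)]] by blast

end

text \<open>Connectedness gives \<open>W\<close> a single constant value: in the Euclidean case two
  disjoint round spheres of radius sqrt n with different centres form a gradient soliton, although
  no translation centres both at the origin. The potentials are determined up to an additive
  constant, as the equations contain only derivatives of f.\<close>

theorem corollary1p4:
  fixes \<A> :: "('a::{t2_space,second_countable_topology}, 'n::finite) chart set"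
    and X :: "'a \<Rightarrow> ('n, 'k::finite) ambient"
    and \<epsilon> \<alpha> :: real
  assumes "\<epsilon> = 1 \<or> \<epsilon> = -1"
    and "\<alpha> = - \<epsilon>"
    and "oriented_atlas \<A>"
    and "spacelike_immersion \<epsilon> \<A> X"
    and "compact (UNIV :: 'a set) \<or> complete_induced_metric \<epsilon> \<A> X"
  shows
    "(self_similar \<epsilon> \<A> X 1 \<longrightarrow>
        gradient_soliton \<epsilon> \<alpha> \<A> X (\<lambda>x. 1/2 * ip \<epsilon> (X x) (X x)) 1) \<and>
     (self_similar \<epsilon> \<A> X (-1) \<longrightarrow>
        gradient_soliton \<epsilon> \<alpha> \<A> X (\<lambda>x. - 1/2 * ip \<epsilon> (X x) (X x)) (-1)) \<and>
     (\<forall>V. translating \<epsilon> \<A> X V \<longrightarrow>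
        gradient_soliton \<epsilon> \<alpha> \<A> X (\<lambda>x. - ip \<epsilon> (X x) V) 0) \<and>
     (connected (UNIV :: 'a set) \<longrightarrow>
        ((\<exists>p. mcf_soliton \<epsilon> \<A> (\<lambda>x. X x - p)) \<longleftrightarrow>
           (\<exists>f. \<exists>lam\<in>{-1, 0, 1}. gradient_soliton \<epsilon> \<alpha> \<A> X f lam)) \<and>
        (\<forall>f. gradient_soliton \<epsilon> \<alpha> \<A> X f 1 \<longleftrightarrow>
           (\<exists>p c. self_similar \<epsilon> \<A> (\<lambda>x. X x - p) 1 \<and>
                  f = (\<lambda>x. 1/2 * ip \<epsilon> (X x - p) (X x - p) + c))) \<and>
        (\<forall>f. gradient_soliton \<epsilon> \<alpha> \<A> X f (-1) \<longleftrightarrow>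
           (\<exists>p c. self_similar \<epsilon> \<A> (\<lambda>x. X x - p) (-1) \<and>
                  f = (\<lambda>x. - 1/2 * ip \<epsilon> (X x - p) (X x - p) + c))) \<and>
        (\<forall>f. gradient_soliton \<epsilon> \<alpha> \<A> X f 0 \<longleftrightarrow>
           (\<exists>V c. translating \<epsilon> \<A> X V \<and> f = (\<lambda>x. - ip \<epsilon> (X x) V + c))))"
proof -
  interpret immersed \<epsilon> \<A> X by unfold_locales fact+
  have ss: "gradient_soliton \<epsilon> \<alpha> \<A> X (\<lambda>x. 1/2 * ip \<epsilon> (X x) (X x)) 1" if "self_similar \<epsilon> \<A> X 1"
    using self_similar_imp_gradient_soliton[OF assms(2) that] by simp
  have se: "gradient_soliton \<epsilon> \<alpha> \<A> X (\<lambda>x. - 1/2 * ip \<epsilon> (X x) (X x)) (-1)" if "self_similar \<epsilon> \<A> X (-1)"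
    using self_similar_imp_gradient_soliton[OF assms(2) that] by simp
  have iff1: "gradient_soliton \<epsilon> \<alpha> \<A> X f 1 \<longleftrightarrow> (\<exists>p c. self_similar \<epsilon> \<A> (\<lambda>x. X x - p) 1 \<and>
      f = (\<lambda>x. 1/2 * ip \<epsilon> (X x - p) (X x - p) + c))" if "connected (UNIV :: 'a set)" for f
    by (rule gradient_soliton_iff_self_similar[OF that assms(2)]) simp
  have iff2: "gradient_soliton \<epsilon> \<alpha> \<A> X f (-1) \<longleftrightarrow> (\<exists>p c. self_similar \<epsilon> \<A> (\<lambda>x. X x - p) (-1) \<and>
      f = (\<lambda>x. - 1/2 * ip \<epsilon> (X x - p) (X x - p) + c))" if "connected (UNIV :: 'a set)" for f
    by (rule gradient_soliton_iff_self_similar[OF that assms(2)]) simp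
  note iff0 = gradient_soliton_iff_translating[OF _ assms(2)]
  have "(\<exists>p. mcf_soliton \<epsilon> \<A> (\<lambda>x. X x - p)) \<longleftrightarrow>
      (\<exists>f. \<exists>lam\<in>{-1, 0, 1}. gradient_soliton \<epsilon> \<alpha> \<A> X f lam)" if conn: "connected (UNIV :: 'a set)"
  proof -
    \<comment> \<open>For each \<lambda> the potential is given explicitly in terms of X, the
      translation p or the vector V, and a constant, so the quantifier over f disappears.\<close>
    have "(\<exists>f. gradient_soliton \<epsilon> \<alpha> \<A> X f 1) \<longleftrightarrow> (\<exists>p. self_similar \<epsilon> \<A> (\<lambda>x. X x - p) 1)"
      unfolding iff1[OF conn] by blast
    moreover have "(\<exists>f. gradient_soliton \<epsilon> \<alpha> \<A> X f (-1)) \<longleftrightarrow> (\<exists>p. self_similar \<epsilon> \<A> (\<lambda>x. X x - p) (-1))"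
      unfolding iff2[OF conn] by blast
    moreover have "(\<exists>f. gradient_soliton \<epsilon> \<alpha> \<A> X f 0) \<longleftrightarrow> (\<exists>V. translating \<epsilon> \<A> X V)"
      unfolding iff0[OF conn] by blast
    ultimately show ?thesis unfolding mcf_soliton_def translating_translate by blast
  qed
  then show ?thesis
    using ss se translating_imp_gradient_soliton[OF assms(2)] iff1 iff2 iff0 by (intro conjI impI allI) assumption+
qed

end
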